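(* Let $k,\ell,m\in\mathbb N$ be such that $\ell\ge m\ge k$ and let $\lambda\in L^+$. Then there exists an isomorphism of $\mathfrak g[t]$-modules $$V(\boldsymbol\xi^{\ell,\ell\lambda}_{m,k\theta})\cong\mathbf V^{\ell,\ell\lambda}_{m,k\theta}.$$
   Context: **Lie algebra notation.** $\mathfrak g$ is a finite-dimensional complex simple Lie algebra of rank $n$ with Cartan subalgebra $\mathfrak h$ and triangular decomposition $\mathfrak g=\mathfrak n^-\oplus\mathfrak h\oplus\mathfrak n^+$; $R^+$ is the set of positive roots, $\theta$ the highest root, $I=\{1,\dots,n\}$, $\alpha_i,\varpi_i$ ($i\in I$) the simple roots and fundamental weights, $\alpha^\vee\in\mathfrak h$ the coroot of $\alpha$. $(\cdot|\cdot)$ is the nondegenerate symmetric invariant form on $\mathfrak h^*$ normalized so that long roots have square length $2$ (so $(\theta|\alpha)\in\{0,1\}$ for $\alpha\in R^+\setminus\{\theta\}$); $d_\alpha=2/(\alpha|\alpha)$, $d_i=d_{\alpha_i}$. For $\alpha\in R^+$ fix nonzero $x^\pm_\alpha\in\mathfrak g_{\pm\alpha}$ with $[x^+_\alpha,x^-_\alpha]=\alpha^\vee$; $x_i^\pm=x_{\alpha_i}^\pm$. $P^+=\sum_i\mathbb Z_{\ge0}\varpi_i$, $L^+=\sum_i\mathbb Z_{\ge0}d_i\varpi_i$ (so $(\lambda|\alpha)\in\mathbb Z_{\ge0}$ for $\lambda\in L^+,\alpha\in R^+$). $\mathbb N$ is the set of positive integers. $\mathfrak g[t]=\mathfrak g\otimes\mathbb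 C[t]$ is the current algebra. **Modules $\mathbf V^{\ell,\ell\lambda}_{m,k\theta}$.** For $k,\ell,m\in\mathbb Z_{\ge0}$ with $k\le m$ and $\lambda\in L^+$, $\mathbf V^{\ell,\ell\lambda}_{m,k\theta}$ is the cyclic graded $\mathfrak g[t]$-module generated by $v=v^{\ell,\ell\lambda}_{m,k\theta}$ (grade $0$) with defining relations: - $(x_i^+\otimes t^s)v=0$, $(\alpha_i^\vee\otimes t^s)v=\delta_{s,0}\langle\ell\lambda+k\theta,\alpha_i^\vee\rangle v$, $(x_i^-\otimes1)^{\langle\ell\lambda+k\theta,\alpha_i^\vee\rangle+1}v=0$ for all $s\ge0$, $i\in I$; - $(x_\alpha^-\otimes t^{(\lambda+\theta|\alpha)})v=0$ for all $\alpha\in R^+$; - $(x_\alpha^-\otimes t^{(\lambda|\alpha)})^{\langle(k-i)\theta,\alpha^\vee\rangle+1}(x_\theta^-\otimes t^{(\lambda|\theta)+1})^iv=0$ for all $\alpha\in R^+$, $0\le i\le k$; - $(x_\theta^-\otimes t^{(\lambda|\theta)+1})^{2k-m+1}v=0$ if $m\le2k$; - $(x_\theta^-\otimes t^{(\lambda|\theta)+1})v=0$ if $m\ge2k$. **Chari–Venkatesh modules $V(\boldsymbol\xi)$.** For $r,s\in\mathbb Z_{\ge0}$ let $\mathbf S(r,s)$ be the set of sequences $(b_p)_{p\ge0}$ of nonnegative integers with $\sum_pb_p=r$, $\sum_ppb_p=s$, and for $\alpha\in R^+$ put $\mathbf x^-_\alpha(r,s)=\sum_{(b_p)\in\mathbf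 S(r,s)}(x_\alpha^-\otimes1)^{(b_0)}(x_\alpha^-\otimes t)^{(b_1)}\cdots(x_\alpha^-\otimes t^s)^{(b_s)}$, where $X^{(b)}=X^b/b!$. Given $\mu\in P^+$ and a tuple $\boldsymbol\xi=(\xi(\alpha))_{\alpha\in R^+}$ of partitions $\xi(\alpha)=(\xi(\alpha)_1\ge\xi(\alpha)_2\ge\cdots)$ with $|\xi(\alpha)|=\langle\mu,\alpha^\vee\rangle$, $V(\boldsymbol\xi)$ is the cyclic $\mathfrak g[t]$-module generated by $v_{\boldsymbol\xi}$ with defining relations: $(x_i^+\otimes t^s)v_{\boldsymbol\xi}=0$, $(\alpha_i^\vee\otimes t^s)v_{\boldsymbol\xi}=\delta_{s,0}\langle\mu,\alpha_i^\vee\rangle v_{\boldsymbol\xi}$, $(x_i^-\otimes1)^{\langle\mu,\alpha_i^\vee\rangle+1}v_{\boldsymbol\xi}=0$ for $s\ge0,i\in I$; and $\mathbf x^-_\alpha(r,s)v_{\boldsymbol\xi}=0$ for all $\alpha\in R^+$ and $s,r\in\mathbb N$ such that $s+r\ge1+rK+\sum_{j\ge K+1}\xi(\alpha)_j$ for some $K\in\mathbb N$. **The tuple $\boldsymbol\xi^{\ell,\ell\lambda}_{m,k\theta}$** (with $\mu=\ell\lambda+k\theta$): with $a^{b}$ denoting $b$ parts equal to $a$, $$\xi^{\ell,\ell\lambda}_{m,k\theta}(\alpha)=\begin{cases}((d_\alpha\ell)^{(\lambda|\alpha)}),&(\theta|\alpha)=0,\\((d_\alpha\ell)^{(\lambda|\alpha)},\,d_\alpha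 k),&(\theta|\alpha)=1,\\(\ell^{(\lambda|\theta)},\,m,\,2k-m),&\alpha=\theta,\ m\le2k,\\(\ell^{(\lambda|\theta)},\,2k),&\alpha=\theta,\ m\ge2k.\end{cases}$$ *)

theory Defs
  imports
    Complex_Main
    "HOL-Library.Poly_Mapping"
    "HOL-Computational_Algebra.Polynomial"
begin

section \<open>Simple Lie algebras with a Cartan subalgebra, simple roots and root vectors\<close>

text \<open>
  The underlying space of the Lie algebra is the whole type \<open>'g\<close>. The simple roots are
  \<open>sroot G i\<close> for \<open>i \<in> {1..rank G}\<close>; values of \<open>sroot\<close> at other indices, and values of
  \<open>xplus\<close> and \<open>xminus\<close> at arguments that are not positive roots, are irrelevant.
\<close>

record 'g lie_datum =
  scl :: "complex \<Rightarrow> 'g \<Rightarrow> 'g"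
  brk :: "'g \<Rightarrow> 'g \<Rightarrow> 'g"
  cartan :: "'g set"
  iform :: "'g \<Rightarrow> 'g \<Rightarrow> complex"
  sroot :: "nat \<Rightarrow> 'g \<Rightarrow> complex"
  xplus :: "('g \<Rightarrow> complex) \<Rightarrow> 'g"
  xminus :: "('g \<Rightarrow> complex) \<Rightarrow> 'g"

definition lie_algebra :: "'g::ab_group_add lie_datum \<Rightarrow> bool" where
  "lie_algebra G \<longleftrightarrow>
     vector_space (scl G) \<and>
     (\<forall>x y z. brk G (x + y) z = brk G x z + brk G y z) \<and>
     (\<forall>x y z. brk G x (y + z) = brk G x y + brk G x z) \<and>
     (\<forall>c x y. brk G (scl G c x) y = scl G c (brk G x y)) \<and>
     (\<forall>c x y. brk G x (scl G c y) = scl G c (brk G x y)) \<and>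
     (\<forall>x. brk G x x = 0) \<and>
     (\<forall>x y z. brk G x (brk G y z) + brk G y (brk G z x) + brk G z (brk G x y) = 0)"

definition fin_dim :: "'g::ab_group_add lie_datum \<Rightarrow> bool" where
  "fin_dim G \<longleftrightarrow> (\<exists>B. finite B \<and> module.span (scl G) B = UNIV)"

definition lie_ideal :: "'g::ab_group_add lie_datum \<Rightarrow> 'g set \<Rightarrow> bool" where
  "lie_ideal G J \<longleftrightarrow> module.subspace (scl G) J \<and> (\<forall>x. \<forall>y\<in>J. brk G x y \<in> J)"

definition simple_lie_algebra :: "'g::ab_group_add lie_datum \<Rightarrow> bool" where
  "simple_lie_algebra G \<longleftrightarrow> lie_algebra G \<and>
     (\<exists>x y. brk G x y \<noteq> 0) \<and> (\<forall>J. lie_ideal G J \<longrightarrow> J = {0} \<or> J = UNIV)"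

text \<open>
  Cartan subalgebra of a complex semisimple Lie algebra: a maximal commutative subalgebra
  all of whose elements act diagonalizably in the adjoint representation.
\<close>

definition cartan_subalgebra :: "'g::ab_group_add lie_datum \<Rightarrow> 'g set \<Rightarrow> bool" where
  "cartan_subalgebra G h \<longleftrightarrow>
     module.subspace (scl G) h \<and>
     (\<forall>H\<in>h. \<forall>H'\<in>h. brk G H H' = 0) \<and>
     (\<forall>x. (\<forall>H\<in>h. brk G H x = 0) \<longrightarrow> x \<in> h) \<and>
     (\<forall>H\<in>h. module.span (scl G) {x. \<exists>c. brk G H x = scl G c x} = UNIV)"

definition rank :: "'g::ab_group_add lie_datum \<Rightarrow> nat" where
  "rank G = vector_space.dim (scl G) (cartan G)"

text \<open>
  Functionals on the Cartan subalgebra are extended by zero to the whole type, so that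
  equality of functions is equality of functionals.
\<close>

definition hstar :: "'g::ab_group_add lie_datum \<Rightarrow> ('g \<Rightarrow> complex) set" where
  "hstar G = {f. (\<forall>H\<in>cartan G. \<forall>H'\<in>cartan G. f (H + H') = f H + f H') \<and>
                 (\<forall>c. \<forall>H\<in>cartan G. f (scl G c H) = c * f H) \<and>
                 (\<forall>x. x \<notin> cartan G \<longrightarrow> f x = 0)}"

definition root_space :: "'g::ab_group_add lie_datum \<Rightarrow> ('g \<Rightarrow> complex) \<Rightarrow> 'g set" where
  "root_space G \<beta> = {x. \<forall>H\<in>cartan G. brk G H x = scl G (\<beta> H) x}"

definition roots :: "'g::ab_group_add lie_datum \<Rightarrow> ('g \<Rightarrow> complex) set" where
  "roots G = {\<beta>\<in>hstar G. \<beta> \<noteq> (\<lambda>x. 0) \<and> root_space G \<beta> \<noteq> {0}}"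

definition pos_roots :: "'g::ab_group_add lie_datum \<Rightarrow> ('g \<Rightarrow> complex) set" where
  "pos_roots G =
     {\<beta>\<in>roots G. \<exists>c::nat \<Rightarrow> nat. \<beta> = (\<lambda>x. \<Sum>i=1..rank G. of_nat (c i) * sroot G i x)}"

text \<open>
  The choice of a triangular decomposition is encoded by the choice of simple roots:
  a basis of the dual of the Cartan subalgebra (of the right cardinality, by the use of
  \<open>rank\<close>) such that every root is, up to sign, positive.
\<close>

definition simple_system :: "'g::ab_group_add lie_datum \<Rightarrow> bool" where
  "simple_system G \<longleftrightarrow>
     (\<forall>i\<in>{1..rank G}. sroot G i \<in> roots G) \<and>
     (\<forall>c::nat \<Rightarrow> complex. (\<forall>x. (\<Sum>i=1..rank G. c i * sroot G i x) = 0)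
        \<longrightarrow> (\<forall>i\<in>{1..rank G}. c i = 0)) \<and>
     (\<forall>\<beta>\<in>roots G. \<beta> \<in> pos_roots G \<or> (\<lambda>x. - \<beta> x) \<in> pos_roots G)"

definition highest_root :: "'g::ab_group_add lie_datum \<Rightarrow> 'g \<Rightarrow> complex" where
  "highest_root G = (THE \<theta>. \<theta> \<in> roots G \<and>
     (\<forall>\<beta>\<in>roots G. \<exists>c::nat \<Rightarrow> nat.
        \<theta> = (\<lambda>x. \<beta> x + (\<Sum>i=1..rank G. of_nat (c i) * sroot G i x))))"

text \<open>
  The form on the dual of the Cartan subalgebra is transported from the invariant form on
  the Lie algebra: \<open>(lam|\<mu>)\<close> is the value of the latter at the elements representing
  \<open>lam\<close> and \<open>\<mu>\<close>.
\<close>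

definition rep_elt :: "'g::ab_group_add lie_datum \<Rightarrow> ('g \<Rightarrow> complex) \<Rightarrow> 'g" where
  "rep_elt G lam = (THE t. t \<in> cartan G \<and> (\<forall>H\<in>cartan G. iform G t H = lam H))"

definition wform :: "'g::ab_group_add lie_datum \<Rightarrow> ('g \<Rightarrow> complex) \<Rightarrow> ('g \<Rightarrow> complex) \<Rightarrow> complex"
  where "wform G lam \<mu> = iform G (rep_elt G lam) (rep_elt G \<mu>)"

definition coroot :: "'g::ab_group_add lie_datum \<Rightarrow> ('g \<Rightarrow> complex) \<Rightarrow> 'g" where
  "coroot G \<alpha> = scl G (2 / wform G \<alpha> \<alpha>) (rep_elt G \<alpha>)"

definition invariant_form :: "'g::ab_group_add lie_datum \<Rightarrow> bool" where
  "invariant_form G \<longleftrightarrow>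
     (\<forall>x y z. iform G (x + y) z = iform G x z + iform G y z) \<and>
     (\<forall>c x y. iform G (scl G c x) y = c * iform G x y) \<and>
     (\<forall>x y. iform G x y = iform G y x) \<and>
     (\<forall>x y z. iform G (brk G x y) z = iform G x (brk G y z)) \<and>
     (\<forall>x. (\<forall>y. iform G x y = 0) \<longrightarrow> x = 0)"

text \<open>Long roots, i.e.\ those of maximal square length, have square length \<open>2\<close>.\<close>

definition normalized_form :: "'g::ab_group_add lie_datum \<Rightarrow> bool" where
  "normalized_form G \<longleftrightarrow>
     (\<forall>\<beta>\<in>roots G. wform G \<beta> \<beta> \<in> \<real> \<and> 0 < Re (wform G \<beta> \<beta>) \<and> Re (wform G \<beta> \<beta>) \<le> 2) \<and>
     (\<exists>\<beta>\<in>roots G. wform G \<beta> \<beta> = 2)"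

definition simple_lie_datum :: "'g::ab_group_add lie_datum \<Rightarrow> bool" where
  "simple_lie_datum G \<longleftrightarrow>
     simple_lie_algebra G \<and> fin_dim G \<and> cartan_subalgebra G (cartan G) \<and>
     simple_system G \<and> invariant_form G \<and> normalized_form G \<and>
     (\<forall>\<alpha>\<in>pos_roots G.
        xplus G \<alpha> \<in> root_space G \<alpha> \<and> xplus G \<alpha> \<noteq> 0 \<and>
        xminus G \<alpha> \<in> root_space G (\<lambda>x. - \<alpha> x) \<and> xminus G \<alpha> \<noteq> 0 \<and>
        brk G (xplus G \<alpha>) (xminus G \<alpha>) = coroot G \<alpha>)"

definition dnum :: "'g::ab_group_add lie_datum \<Rightarrow> ('g \<Rightarrow> complex) \<Rightarrow> complex" where
  "dnum G \<alpha> = 2 / wform G \<alpha> \<alpha>"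

definition fund_weight :: "'g::ab_group_add lie_datum \<Rightarrow> nat \<Rightarrow> 'g \<Rightarrow> complex" where
  "fund_weight G i = (THE w. w \<in> hstar G \<and>
     (\<forall>j\<in>{1..rank G}. w (coroot G (sroot G j)) = (if j = i then 1 else 0)))"

definition Lplus :: "'g::ab_group_add lie_datum \<Rightarrow> ('g \<Rightarrow> complex) set" where
  "Lplus G = {lam. \<exists>c::nat \<Rightarrow> nat.
     lam = (\<lambda>x. \<Sum>i=1..rank G. of_nat (c i) * dnum G (sroot G i) * fund_weight G i x)}"

text \<open>
  All the numbers \<open>(lam|\<alpha>)\<close>, \<open>\<langle>\<mu>, \<alpha>\<^sup>\<or>\<rangle>\<close>, \<open>d\<^sub>\<alpha>\<close> that occur below
  as exponents or as parts of partitions are nonnegative integers given as complex numbers;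
  \<open>cnat\<close> reads them as naturals.
\<close>

definition cnat :: "complex \<Rightarrow> nat" where
  "cnat z = nat \<lfloor>Re z\<rfloor>"

section \<open>The current algebra and cyclic modules given by defining relations\<close>

text \<open>
  \<open>\<gg>[t]\<close> is the type of polynomials with coefficients in \<open>'g\<close>; \<open>monom x s\<close> is
  \<open>x \<otimes> t\<^sup>s\<close>.
\<close>

definition cur_brk :: "'g::ab_group_add lie_datum \<Rightarrow> 'g poly \<Rightarrow> 'g poly \<Rightarrow> 'g poly" where
  "cur_brk G p q =
     (\<Sum>i\<le>degree p. \<Sum>j\<le>degree q. monom (brk G (coeff p i) (coeff q j)) (i + j))"

definition cur_scl :: "'g::ab_group_add lie_datum \<Rightarrow> complex \<Rightarrow> 'g poly \<Rightarrow> 'g poly" where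
  "cur_scl G c p = map_poly (scl G c) p"

text \<open>The free monoid, written additively so that \<^typ>\<open>_ \<Rightarrow>\<^sub>0 complex\<close> over it is the free algebra.\<close>

datatype 'a fword = FWord (letters: "'a list")

instantiation fword :: (type) monoid_add
begin

definition zero_fword :: "'a fword" where "zero_fword = FWord []"

definition plus_fword :: "'a fword \<Rightarrow> 'a fword \<Rightarrow> 'a fword" where
  "plus_fword u w = FWord (letters u @ letters w)"

instance
  by standard (simp_all add: zero_fword_def plus_fword_def)

end

type_synonym 'g free_alg = "'g poly fword \<Rightarrow>\<^sub>0 complex"

definition gen :: "'g::zero poly \<Rightarrow> 'g free_alg" where
  "gen a = Poly_Mapping.single (FWord [a]) 1"

definition const :: "complex \<Rightarrow> 'g::zero free_alg" where
  "const c = Poly_Mapping.single 0 c"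

text \<open>
  The universal enveloping algebra \<open>U(\<gg>[t])\<close> is the quotient of the free algebra on the set
  \<open>\<gg>[t]\<close> by the two-sided ideal generated by \<open>env_relators\<close>. For a set \<open>S\<close> of elements of the
  free algebra, \<open>rel_ideal G S\<close> is the preimage in the free algebra of the left ideal of
  \<open>U(\<gg>[t])\<close> generated by the image of \<open>S\<close>.
\<close>

definition env_relators :: "'g::ab_group_add lie_datum \<Rightarrow> 'g free_alg set" where
  "env_relators G =
     {gen (a + b) - gen a - gen b | a b. True} \<union>
     {gen (cur_scl G c a) - const c * gen a | c a. True} \<union>
     {gen a * gen b - gen b * gen a - gen (cur_brk G a b) | a b. True}"

inductive_set rel_ideal :: "'g::ab_group_add lie_datum \<Rightarrow> 'g free_alg set \<Rightarrow> 'g free_alg set"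
  for G S where
  zero: "0 \<in> rel_ideal G S"
| env: "r \<in> env_relators G \<Longrightarrow> r * u \<in> rel_ideal G S"
| rel: "r \<in> S \<Longrightarrow> r \<in> rel_ideal G S"
| add: "a \<in> rel_ideal G S \<Longrightarrow> b \<in> rel_ideal G S \<Longrightarrow> a + b \<in> rel_ideal G S"
| left: "a \<in> rel_ideal G S \<Longrightarrow> u * a \<in> rel_ideal G S"

text \<open>Spaces with an action of a Lie algebra with elements of type \<open>'a\<close>; below, \<open>'a\<close> is \<open>'g poly\<close>.\<close>

record ('a, 'm) cur_module =
  mcarrier :: "'m set"
  madd :: "'m \<Rightarrow> 'm \<Rightarrow> 'm"
  mscl :: "complex \<Rightarrow> 'm \<Rightarrow> 'm"
  mact :: "'a \<Rightarrow> 'm \<Rightarrow> 'm"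

definition cur_module_iso ::
  "('a, 'm) cur_module \<Rightarrow> ('a, 'n) cur_module \<Rightarrow> ('m \<Rightarrow> 'n) \<Rightarrow> bool" where
  "cur_module_iso M N \<phi> \<longleftrightarrow>
     bij_betw \<phi> (mcarrier M) (mcarrier N) \<and>
     (\<forall>u\<in>mcarrier M. \<forall>w\<in>mcarrier M. \<phi> (madd M u w) = madd N (\<phi> u) (\<phi> w)) \<and>
     (\<forall>c. \<forall>u\<in>mcarrier M. \<phi> (mscl M c u) = mscl N c (\<phi> u)) \<and>
     (\<forall>a. \<forall>u\<in>mcarrier M. \<phi> (mact M a u) = mact N a (\<phi> u))"

definition cur_module_isomorphic ::
  "('a, 'm) cur_module \<Rightarrow> ('a, 'n) cur_module \<Rightarrow> bool" where
  "cur_module_isomorphic M N \<longleftrightarrow> (\<exists>\<phi>. cur_module_iso M N \<phi>)"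

text \<open>
  The cyclic \<open>\<gg>[t]\<close>-module with generator \<open>v\<close> and defining relations \<open>r v = 0\<close>, \<open>r \<in> S\<close>:
  the quotient of \<open>U(\<gg>[t])\<close> by the left ideal generated by \<open>S\<close>. Its elements are cosets in
  the free algebra, and \<open>v\<close> is the coset of \<open>1\<close>.
\<close>

definition cls :: "'g::ab_group_add lie_datum \<Rightarrow> 'g free_alg set \<Rightarrow> 'g free_alg \<Rightarrow> 'g free_alg set"
  where "cls G S u = {w. w - u \<in> rel_ideal G S}"

definition cyclic_module ::
  "'g::ab_group_add lie_datum \<Rightarrow> 'g free_alg set \<Rightarrow> ('g poly, 'g free_alg set) cur_module" where
  "cyclic_module G S = \<lparr>
     mcarrier = range (cls G S),
     madd = (\<lambda>A B. \<Union>a\<in>A. \<Union>b\<in>B. cls G S (a + b)),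
     mscl = (\<lambda>c A. \<Union>a\<in>A. cls G S (const c * a)),
     mact = (\<lambda>x A. \<Union>a\<in>A. cls G S (gen x * a)) \<rparr>"

lemma rel_ideal_minus: "a \<in> rel_ideal G S \<Longrightarrow> - a \<in> rel_ideal G S"
  using rel_ideal.left[of a G S "- 1"] by simp

lemma rel_ideal_diff: "a \<in> rel_ideal G S \<Longrightarrow> b \<in> rel_ideal G S \<Longrightarrow> a - b \<in> rel_ideal G S"
  using rel_ideal.add[OF _ rel_ideal_minus] by force

lemma cls_self: "u \<in> cls G S u"
  by (simp add: cls_def rel_ideal.zero)

lemma cls_eq_iff: "cls G S u = cls G S w \<longleftrightarrow> u - w \<in> rel_ideal G S"
proof
  assume "cls G S u = cls G S w"
  then show "u - w \<in> rel_ideal G S"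
    using cls_self[of u G S] by (simp add: cls_def)
next
  assume *: "u - w \<in> rel_ideal G S"
  have "x - u \<in> rel_ideal G S \<longleftrightarrow> x - w \<in> rel_ideal G S" for x
    using rel_ideal.add[OF _ *, of "x - u"] rel_ideal_diff[OF _ *, of "x - w"] by auto
  then show "cls G S u = cls G S w"
    by (simp add: cls_def)
qed

lemma mem_cls_iff: "a \<in> cls G S u \<longleftrightarrow> a - u \<in> rel_ideal G S"
  by (simp add: cls_def)

lemma UN_cls_const:
  assumes "\<And>a. a \<in> cls G S u \<Longrightarrow> F a = F u"
  shows "(\<Union>a\<in>cls G S u. F a) = F u"
  using assms cls_self[of u G S] by blast

lemma madd_cls: "madd (cyclic_module G S) (cls G S u) (cls G S w) = cls G S (u + w)"
proof -
  have *: "cls G S (a + b) = cls G S (u + w)" if "a \<in> cls G S u" "b \<in> cls G S w" for a b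
  proof -
    have "(a + b) - (u + w) = (a - u) + (b - w)" by simp
    with that show ?thesis
      unfolding cls_eq_iff mem_cls_iff by (metis rel_ideal.add)
  qed
  have "(\<Union>a\<in>cls G S u. \<Union>b\<in>cls G S w. cls G S (a + b)) = cls G S (u + w)"
    using * cls_self[of u G S] cls_self[of w G S] by blast
  then show ?thesis
    unfolding cyclic_module_def cur_module.simps .
qed

lemma mscl_cls: "mscl (cyclic_module G S) c (cls G S u) = cls G S (const c * u)"
proof -
  have "cls G S (const c * a) = cls G S (const c * u)" if "a \<in> cls G S u" for a
    using that unfolding cls_eq_iff mem_cls_iff right_diff_distrib[symmetric]
    by (rule rel_ideal.left)
  then show ?thesis
    unfolding cyclic_module_def cur_module.simps by (rule UN_cls_const)
qed

lemma mact_cls: "mact (cyclic_module G S) x (cls G S u) = cls G S (gen x * u)"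
proof -
  have "cls G S (gen x * a) = cls G S (gen x * u)" if "a \<in> cls G S u" for a
    using that unfolding cls_eq_iff mem_cls_iff right_diff_distrib[symmetric]
    by (rule rel_ideal.left)
  then show ?thesis
    unfolding cyclic_module_def cur_module.simps by (rule UN_cls_const)
qed

lemma mact_brk:
  "madd (cyclic_module G S) (mact (cyclic_module G S) (cur_brk G x y) (cls G S u))
        (mact (cyclic_module G S) y (mact (cyclic_module G S) x (cls G S u)))
   = mact (cyclic_module G S) x (mact (cyclic_module G S) y (cls G S u))"
proof -
  have "gen x * gen y - gen y * gen x - gen (cur_brk G x y) \<in> env_relators G"
    unfolding env_relators_def by blast
  then have "- ((gen x * gen y - gen y * gen x - gen (cur_brk G x y)) * u) \<in> rel_ideal G S"
    by (intro rel_ideal_minus rel_ideal.env)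
  moreover have "- ((gen x * gen y - gen y * gen x - gen (cur_brk G x y)) * u)
      = (gen (cur_brk G x y) * u + gen y * (gen x * u)) - gen x * (gen y * u)"
    by (simp add: left_diff_distrib mult.assoc)
  ultimately show ?thesis
    unfolding mact_cls madd_cls cls_eq_iff by simp
qed

section \<open>The two families of modules\<close>

definition lkweight :: "'g::ab_group_add lie_datum \<Rightarrow> nat \<Rightarrow> ('g \<Rightarrow> complex) \<Rightarrow> nat \<Rightarrow> 'g \<Rightarrow> complex"
  where "lkweight G l lam k = (\<lambda>x. of_nat l * lam x + of_nat k * highest_root G x)"

definition hw_relators :: "'g::ab_group_add lie_datum \<Rightarrow> ('g \<Rightarrow> complex) \<Rightarrow> 'g free_alg set" where
  "hw_relators G \<mu> =
     {gen (monom (xplus G (sroot G i)) s) | i s. i \<in> {1..rank G}} \<union>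
     {gen (monom (coroot G (sroot G i)) s)
        - const (if s = 0 then \<mu> (coroot G (sroot G i)) else 0) | i s. i \<in> {1..rank G}} \<union>
     {gen (monom (xminus G (sroot G i)) 0) ^ (cnat (\<mu> (coroot G (sroot G i))) + 1)
        | i. i \<in> {1..rank G}}"

definition bold_relators ::
  "'g::ab_group_add lie_datum \<Rightarrow> nat \<Rightarrow> ('g \<Rightarrow> complex) \<Rightarrow> nat \<Rightarrow> nat \<Rightarrow> 'g free_alg set" where
  "bold_relators G l lam m k =
     (let \<theta> = highest_root G;
          X = (\<lambda>\<alpha> s. gen (monom (xminus G \<alpha>) s));
          p = (\<lambda>\<alpha>. cnat (wform G lam \<alpha>))
      in hw_relators G (lkweight G l lam k) \<union>
         {X \<alpha> (cnat (wform G (\<lambda>x. lam x + \<theta> x) \<alpha>)) | \<alpha>. \<alpha> \<in> pos_roots G} \<union>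
         {X \<alpha> (p \<alpha>) ^ (cnat (of_nat (k - i) * \<theta> (coroot G \<alpha>)) + 1) * X \<theta> (p \<theta> + 1) ^ i
            | \<alpha> i. \<alpha> \<in> pos_roots G \<and> i \<le> k} \<union>
         (if m \<le> 2 * k then {X \<theta> (p \<theta> + 1) ^ (2 * k - m + 1)} else {}) \<union>
         (if m \<ge> 2 * k then {X \<theta> (p \<theta> + 1)} else {}))"

definition bold_V ::
  "'g::ab_group_add lie_datum \<Rightarrow> nat \<Rightarrow> ('g \<Rightarrow> complex) \<Rightarrow> nat \<Rightarrow> nat \<Rightarrow> ('g poly, 'g free_alg set) cur_module"
  where "bold_V G l lam m k = cyclic_module G (bold_relators G l lam m k)"

definition seqs :: "nat \<Rightarrow> nat \<Rightarrow> (nat \<Rightarrow> nat) set" where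
  "seqs r s = {b. finite {p. b p \<noteq> 0} \<and>
     (\<Sum>p | b p \<noteq> 0. b p) = r \<and> (\<Sum>p | b p \<noteq> 0. p * b p) = s}"

lemma seqs_bounds:
  assumes "b \<in> seqs r s"
  shows "b p \<le> r" and "p > s \<Longrightarrow> b p = 0"
proof -
  have fin: "finite {p. b p \<noteq> 0}" and r: "(\<Sum>p | b p \<noteq> 0. b p) = r"
    and s: "(\<Sum>p | b p \<noteq> 0. p * b p) = s"
    using assms by (auto simp: seqs_def)
  show "b p \<le> r"
    using member_le_sum[OF _ _ fin, of p b] r by (cases "b p = 0") auto
  show "b p = 0" if "p > s"
  proof (rule ccontr)
    assume nz: "b p \<noteq> 0"
    then have "p * b p \<le> s"
      using member_le_sum[OF _ _ fin, of p "\<lambda>p. p * b p"] s by auto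
    moreover have "p \<le> p * b p" using nz by simp
    ultimately show False using that by linarith
  qed
qed

lemma finite_seqs: "finite (seqs r s)"
proof (rule finite_subset)
  show "seqs r s \<subseteq> {b. \<forall>p. (p \<in> {..s} \<longrightarrow> b p \<in> {..r}) \<and> (p \<notin> {..s} \<longrightarrow> b p = 0)}"
    using seqs_bounds by (auto simp: not_le)
qed (rule finite_set_of_finite_funs; simp)

definition divpow :: "'g::zero free_alg \<Rightarrow> nat \<Rightarrow> 'g free_alg" where
  "divpow X b = const (1 / fact b) * X ^ b"

definition xbold :: "'g::ab_group_add lie_datum \<Rightarrow> ('g \<Rightarrow> complex) \<Rightarrow> nat \<Rightarrow> nat \<Rightarrow> 'g free_alg" where
  "xbold G \<alpha> r s =
     (\<Sum>b\<in>seqs r s. prod_list (map (\<lambda>p. divpow (gen (monom (xminus G \<alpha>) p)) (b p)) [0..<s + 1]))"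

text \<open>
  Partitions are lists of parts in weakly decreasing order, possibly with trailing zeros.
  The list index starts at \<open>0\<close>, so \<open>drop K\<close> keeps the parts with number at least \<open>K + 1\<close>.
\<close>

definition CV_relators ::
  "'g::ab_group_add lie_datum \<Rightarrow> ('g \<Rightarrow> complex) \<Rightarrow> (('g \<Rightarrow> complex) \<Rightarrow> nat list) \<Rightarrow> 'g free_alg set"
  where
  "CV_relators G \<mu> \<xi> = hw_relators G \<mu> \<union>
     {xbold G \<alpha> r s | \<alpha> r s. \<alpha> \<in> pos_roots G \<and> r \<ge> 1 \<and> s \<ge> 1 \<and>
        (\<exists>K\<ge>1. s + r \<ge> 1 + r * K + sum_list (drop K (\<xi> \<alpha>)))}"

definition CV_module ::
  "'g::ab_group_add lie_datum \<Rightarrow> ('g \<Rightarrow> complex) \<Rightarrow> (('g \<Rightarrow> complex) \<Rightarrow> nat list)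
     \<Rightarrow> ('g poly, 'g free_alg set) cur_module"
  where "CV_module G \<mu> \<xi> = cyclic_module G (CV_relators G \<mu> \<xi>)"

text \<open>For a positive root \<open>\<alpha> \<noteq> \<theta>\<close> the value of \<open>(\<theta>|\<alpha>)\<close> is \<open>0\<close> or \<open>1\<close>; the last branch is the value \<open>1\<close>.\<close>

definition xi_tuple ::
  "'g::ab_group_add lie_datum \<Rightarrow> nat \<Rightarrow> ('g \<Rightarrow> complex) \<Rightarrow> nat \<Rightarrow> nat \<Rightarrow> ('g \<Rightarrow> complex) \<Rightarrow> nat list"
  where
  "xi_tuple G l lam m k \<alpha> =
     (let \<theta> = highest_root G;
          p = cnat (wform G lam \<alpha>);
          d = cnat (dnum G \<alpha>)
      in if \<alpha> = \<theta> then
           (if m \<le> 2 * k then replicate p l @ [m, 2 * k - m] else replicate p l @ [2 * k])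
         else if wform G \<theta> \<alpha> = 0 then replicate p (d * l)
         else replicate p (d * l) @ [d * k])"

end

theory Submission
  imports Defs "HOL-Library.Function_Algebras"
begin

text \<open>
  Both modules are quotients of one free algebra by left ideals that contain the relations of
  \<open>U(\<gg>[t])\<close>, so it suffices that the two left ideals are equal: in any \<open>\<gg>[t]\<close>-module, a vector \<open>v\<close> that
  satisfies the highest weight relations satisfies one set of further relations if and only if it
  satisfies the other (\<open>CV_rel_iff_bold_rel\<close>).

  One root \<open>\<alpha>\<close> at a time, write \<open>x\<^sub>j = x\<^sup>-\<^sub>\<alpha> \<otimes> t\<^sup>j\<close> and \<open>p = (\<lambda>|\<alpha>)\<close>.  By Garland's identity (\<open>e_xb\<close>) the operator
  \<open>x\<^sup>+\<^sub>\<alpha> \<otimes> t\<close> maps \<open>\<^bold>x(r + 1, s) v\<close> to \<open>- (s + 1) \<^bold>x(r, s + 1) v\<close>; hence \<open>\<^bold>x(r, s) v = 0\<close> whenever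
  \<open>r + s > \<langle>\<mu>, \<alpha>\<^sup>\<or>\<rangle>\<close>.  With this, the relations of \<open>V(\<xi>)\<close> for a partition \<open>(L\<^sup>p, m', m'')\<close> reduce to relations for
  single monomials: \<open>x\<^sub>j v = 0\<close> for \<open>j \<ge> p + 2\<close>, \<open>x\<^bsub>p+1\<^esub>\<^bsup>m''+1\<^esup> v = 0\<close>, and \<open>x\<^sub>p\<^sup>b x\<^bsub>p+1\<^esub>\<^sup>a v = 0\<close> for
  \<open>b + 2 a > m' + m''\<close> (\<open>relations_imp_xb\<close>, \<open>xb_imp_relations\<close>).

  For the tuple in question these monomial relations are among the relations of \<open>\<^bold>V\<close> or follow from
  them at once (\<open>bold_imp_root_rel\<close>).  Conversely they give all relations of \<open>\<^bold>V\<close> except the third family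
  for \<open>\<alpha> \<noteq> \<theta>\<close> and \<open>i \<ge> 1\<close>, which couples \<open>\<alpha>\<close> with \<open>\<theta>\<close>.  Put \<open>y\<^sub>\<gamma> = x\<^sup>-\<^sub>\<gamma> \<otimes> t\<^bsup>(\<lambda>|\<gamma>)\<^esup>\<close> and
  \<open>z = x\<^sup>-\<^sub>\<theta> \<otimes> t\<^bsup>(\<lambda>|\<theta>)+1\<^esup>\<close>; the claim is that \<open>y\<^sub>\<alpha>\<close> to the power \<open>\<langle>(k - i)\<theta>, \<alpha>\<^sup>\<or>\<rangle> + 1\<close> annihilates \<open>z\<^sup>i v\<close>.
  For a simple root \<open>\<alpha>\<^sub>j\<close> with \<open>d = \<langle>\<theta>, \<alpha>\<^sub>j\<^sup>\<or>\<rangle>\<close>, multiplication by \<open>x\<^sup>-\<^sub>\<gamma> \<otimes> t\<^bsup>(\<lambda>|\<gamma>)+1\<^esup>\<close> for \<open>\<gamma> = \<theta> - d \<alpha>\<^sub>j\<close>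
  turns \<open>d\<close> factors \<open>y\<close> of a relation into one more factor \<open>z\<close> (\<open>simple_exchange\<close>), so the claim follows by
  induction on \<open>i\<close>.  Since \<open>(\<lambda>|_)\<close> is additive, the \<open>y\<^sub>\<gamma>\<close> satisfy the commutation relations of \<open>\<nn>\<^sup>-\<close>, and
  \<open>z\<^sup>i v\<close> now behaves like the generator of the integrable module of highest weight \<open>(k - i)\<theta>\<close>: the powers
  of the simple lowering operators annihilate it.  In such a module the corresponding power of
  every \<open>y\<^sub>\<alpha>\<close> annihilates the generator.

  That last fact (\<open>power_of_root_vector_in_left_ideal\<close>) is needed for \<open>\<nn>\<^sup>-\<close> alone, where no raising operators
  are at hand.  They are constructed on the free algebra over the positive roots, as on a Verma
  module; the weights of its quotient by the relations are stable under the Weyl group, while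
  the power in question, if nonzero, would have a weight whose reflection lies above the highest weight.

  The facts on roots that enter are derived from the structure of \<open>\<gg>\<close> as a sum of \<open>sl\<^sub>2\<close>-modules: root
  spaces are lines, every positive root arises from a simple one by simple reflections, the highest
  root exists and is long, and the numbers \<open>d\<^sub>\<alpha>\<close>, \<open>(\<lambda>|\<alpha>)\<close>, \<open>(\<theta>|\<alpha>)\<close> are natural.
\<close>

section \<open>Eigenvectors and representations of \<open>sl\<^sub>2\<close>\<close>

context vector_space
begin

text \<open>Applying \<open>f i - \<chi> a i\<close> to a vanishing sum removes the summand \<open>a\<close> and rescales the others; the operator
  used may depend on the pair of summands to be separated.\<close>

lemma joint_eigenvectors_independent:
  fixes f :: "'i \<Rightarrow> 'b \<Rightarrow> 'b" and \<chi> :: "'j \<Rightarrow> 'i \<Rightarrow> 'a"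
  assumes add: "\<And>i x y. i \<in> I \<Longrightarrow> f i (x + y) = f i x + f i y"
    and scl: "\<And>i c x. i \<in> I \<Longrightarrow> f i (scale c x) = scale c (f i x)"
    and "finite C"
    and "\<And>c i. c \<in> C \<Longrightarrow> i \<in> I \<Longrightarrow> f i (x c) = scale (\<chi> c i) (x c)"
    and "\<And>c c'. c \<in> C \<Longrightarrow> c' \<in> C \<Longrightarrow> c \<noteq> c' \<Longrightarrow> \<exists>i\<in>I. \<chi> c i \<noteq> \<chi> c' i"
    and "(\<Sum>c\<in>C. x c) = 0"
  shows "\<forall>c\<in>C. x c = 0"
  using assms(3-)
proof (induction C arbitrary: x)
  case empty
  then show ?case by simp
next
  case (insert a C)
  have f0: "f i 0 = 0" if "i \<in> I" for i
    using scl[OF that, of 0 0] by simp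
  have fsum: "f i (\<Sum>c\<in>D. y c) = (\<Sum>c\<in>D. f i (y c))" if "i \<in> I" "finite D" for i D and y :: "'j \<Rightarrow> 'b"
    using that(2) by (induction D) (simp_all add: f0[OF that(1)] add[OF that(1)])
  have zero: "x c = 0" if c: "c \<in> C" for c
  proof -
    from c insert.hyps have "c \<noteq> a" by auto
    then obtain i where i: "i \<in> I" and ne: "\<chi> c i \<noteq> \<chi> a i"
      using insert.prems(2)[of c a] c by auto
    define y where "y c' = scale (\<chi> c' i - \<chi> a i) (x c')" for c'
    have "(\<Sum>c'\<in>insert a C. y c') = f i (\<Sum>c'\<in>insert a C. x c') - scale (\<chi> a i) (\<Sum>c'\<in>insert a C. x c')"
      unfolding fsum[OF i finite.insertI[OF insert.hyps(1)]] scale_sum_right sum_subtractf[symmetric]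
      by (rule sum.cong) (use insert.prems(1) i in \<open>auto simp: y_def scale_left_diff_distrib\<close>)
    also have "\<dots> = 0"
      using insert.prems(3) f0[OF i] by simp
    finally have "(\<Sum>c'\<in>C. y c') = 0"
      using insert.hyps by (simp add: y_def)
    moreover have "f j (y c') = scale (\<chi> c' j) (y c')" if "c' \<in> C" "j \<in> I" for c' j
      using insert.prems(1)[of c' j] that scl[OF that(2)] by (simp add: y_def mult.commute)
    ultimately have "\<forall>c'\<in>C. y c' = 0"
      using insert.prems(2) by (intro insert.IH) auto
    then show "x c = 0"
      using c ne by (auto simp: y_def)
  qed
  then have "x a = 0"
    using insert.prems(3) insert.hyps by simp
  with zero show ?case by simp
qed

text \<open>Summands with the same eigenvalue are merged, so that the eigenvalues themselves can serve as indices.\<close>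

lemma span_eigenvectors_decomposition:
  assumes add: "\<And>x y. f (x + y) = f x + f y"
    and scl: "\<And>c x. f (scale c x) = scale c (f x)"
    and "x \<in> span {y. \<exists>c. f y = scale c y}"
  shows "\<exists>C y. finite C \<and> (\<forall>c\<in>C. f (y c) = scale c (y c)) \<and> x = (\<Sum>c\<in>C. y c)"
  using assms(3)
proof (induction rule: span_induct_alt)
  case base
  show ?case by (rule exI[of _ "{}"]) simp
next
  case (step r z x)
  then obtain C y d where *: "finite C" "\<forall>c\<in>C. f (y c) = scale c (y c)" "x = (\<Sum>c\<in>C. y c)"
    and d: "f z = scale d z" by blast
  define y' where "y' c = (if c \<in> C then y c else 0) + (if c = d then scale r z else 0)" for c
  have f0: "f 0 = 0" using scl[of 0 0] by simp
  have "\<forall>c\<in>insert d C. f (y' c) = scale c (y' c)"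
    using *(2) d by (auto simp: y'_def f0 add scl scale_right_distrib mult.commute)
  moreover have "(\<Sum>c\<in>insert d C. if c \<in> C then y c else 0) = x"
    unfolding *(3) by (rule sum.mono_neutral_cong_right) (use *(1) in auto)
  then have "scale r z + x = (\<Sum>c\<in>insert d C. y' c)"
    using *(1) by (simp only: y'_def sum.distrib) simp
  ultimately show ?case
    using *(1) by blast
qed

end

text \<open>Operators \<open>e\<close>, \<open>f\<close> whose commutator is the scalar \<open>c\<close> on the weight space \<open>W c\<close>, with an invariant
  subspace \<open>K\<close>.  All conclusions are modulo \<open>K\<close>: this covers the adjoint representation (\<open>K = {0}\<close>) as well as
  modules presented by generators and relations, without forming the quotient.\<close>

locale sl2_weights = vector_space scale
  for scale :: "complex \<Rightarrow> 'b::ab_group_add \<Rightarrow> 'b" +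
  fixes e f :: "'b \<Rightarrow> 'b" and K :: "'b set" and W :: "complex \<Rightarrow> 'b set"
  assumes K: "subspace K"
    and e_add: "\<And>u w. e (u + w) = e u + e w" and e_scale: "\<And>c u. e (scale c u) = scale c (e u)"
    and f_add: "\<And>u w. f (u + w) = f u + f w" and f_scale: "\<And>c u. f (scale c u) = scale c (f u)"
    and e_K: "\<And>u. u \<in> K \<Longrightarrow> e u \<in> K" and f_K: "\<And>u. u \<in> K \<Longrightarrow> f u \<in> K"
    and e_W: "\<And>u c. u \<in> W c \<Longrightarrow> e u \<in> W (c + 2)" and f_W: "\<And>u c. u \<in> W c \<Longrightarrow> f u \<in> W (c - 2)"
    and e_f: "\<And>u c. u \<in> W c \<Longrightarrow> e (f u) - f (e u) = scale c u"
begin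

text \<open>Exchanging \<open>e\<close> and \<open>f\<close> allows every statement to be used in both directions.\<close>

lemma dual: "sl2_weights scale f e K (\<lambda>c. W (- c))"
proof unfold_locales
  show "f (e u) - e (f u) = scale c u" if "u \<in> W (- c)" for u c
    using arg_cong[OF e_f[OF that], of uminus] by simp
  show "f u \<in> W (- (c + 2))" if "u \<in> W (- c)" for u c
    using f_W[OF that] by simp
  show "e u \<in> W (- (c - 2))" if "u \<in> W (- c)" for u c
    using e_W[OF that] by (simp add: algebra_simps)
qed (auto simp: K e_add e_scale f_add f_scale e_K f_K)

lemma f_pow_W: "u \<in> W c \<Longrightarrow> (f ^^ n) u \<in> W (c - 2 * of_nat n)"
proof (induction n)
  case (Suc n)
  then have "(f ^^ Suc n) u \<in> W (c - 2 * of_nat n - 2)"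
    using f_W[of "(f ^^ n) u" "c - 2 * of_nat n"] by simp
  also have "c - 2 * of_nat n - 2 = c - 2 * of_nat (Suc n)"
    by simp
  finally show ?case .
qed simp

lemma f_pow_K: "u \<in> K \<Longrightarrow> (f ^^ n) u \<in> K"
  by (induction n) (auto intro: f_K)

lemma e_f_pow:
  assumes u: "u \<in> W c"
  shows "e ((f ^^ n) u) = (f ^^ n) (e u) + scale (of_nat n * (c - of_nat n + 1)) ((f ^^ (n - 1)) u)"
proof (induction n)
  case 0
  show ?case by simp
next
  case (Suc n)
  have "e (f ((f ^^ n) u)) = f (e ((f ^^ n) u)) + scale (c - 2 * of_nat n) ((f ^^ n) u)"
    using e_f[OF f_pow_W[OF u, of n]] by (simp add: algebra_simps)
  also have "f (e ((f ^^ n) u)) = (f ^^ Suc n) (e u) + scale (of_nat n * (c - of_nat n + 1)) ((f ^^ n) u)"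
    unfolding Suc.IH f_add f_scale by (cases n) simp_all
  finally show ?case
    by (simp add: scale_left_distrib[symmetric] add.assoc) (simp add: algebra_simps)
qed

text \<open>If \<open>e u\<close> vanishes, then applying \<open>e\<close> to \<open>f\<^sup>n u\<close> gives a nonzero multiple of \<open>f\<^bsup>n-1\<^esup> u\<close> for \<open>0 < n \<le> c\<close>, so
  \<open>u\<close> is recovered from \<open>f\<^sup>c u\<close>.  In general \<open>e u\<close> satisfies the same hypotheses with \<open>c + 2\<close>, whence an
  induction on the order of nilpotency of \<open>e\<close>.\<close>

lemma f_pow_injective:
  assumes "u \<in> W (of_nat c)" "(e ^^ r) u \<in> K" "(f ^^ c) u \<in> K"
  shows "u \<in> K"
  using assms
proof (induction r arbitrary: u c)
  case 0
  then show ?case by simp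
next
  case (Suc r)
  have eu: "e u \<in> K"
  proof (rule Suc.IH[of "e u" "c + 2"])
    show "e u \<in> W (of_nat (c + 2))"
      using e_W[OF Suc.prems(1)] by (simp add: add.commute)
    show "(e ^^ r) (e u) \<in> K"
      using Suc.prems(2) by (simp add: funpow_swap1)
    have "(f ^^ (c + n)) u \<in> K" for n
      using f_pow_K[OF Suc.prems(3), of n] by (simp only: funpow_add add.commute[of c] o_apply)
    from this[of 1] this[of 2] have "(f ^^ (c + 1)) u \<in> K" "(f ^^ (c + 2)) u \<in> K" .
    moreover have "(f ^^ (c + 2)) (e u) = e ((f ^^ (c + 2)) u) - scale (of_nat (c + 2) * (of_nat c - of_nat (c + 2) + 1)) ((f ^^ (c + 1)) u)"
      using e_f_pow[OF Suc.prems(1), of "c + 2"] by simp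
    ultimately show "(f ^^ (c + 2)) (e u) \<in> K"
      using e_K K subspace_diff subspace_scale by metis
  qed
  have "(f ^^ (c - n)) u \<in> K" if "n \<le> c" for n
    using that
  proof (induction n)
    case 0
    then show ?case using Suc.prems(3) by simp
  next
    case (Suc n)
    define a :: complex where "a = of_nat (c - n) * (of_nat c - of_nat (c - n) + 1)"
    have "e ((f ^^ (c - n)) u) = (f ^^ (c - n)) (e u) + scale a ((f ^^ (c - Suc n)) u)"
      using e_f_pow[OF \<open>u \<in> W (of_nat c)\<close>, of "c - n"] by (simp add: a_def)
    moreover have "(f ^^ (c - n)) (e u) \<in> K" "e ((f ^^ (c - n)) u) \<in> K"
      using Suc eu f_pow_K e_K by simp_all
    ultimately have "scale a ((f ^^ (c - Suc n)) u) \<in> K"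
      using subspace_diff[OF K] by (metis add_diff_cancel_left')
    moreover have "of_nat c - of_nat (c - n) = (of_nat n :: complex)"
      using Suc.prems by (simp add: of_nat_diff)
    then have a: "a = of_nat (c - n) * of_nat (n + 1)"
      by (simp add: a_def)
    have "a \<noteq> 0"
      unfolding a mult_eq_0_iff of_nat_eq_0_iff using Suc.prems by simp
    ultimately show ?case
      using subspace_scale[OF K, of _ "inverse a"] by force
  qed
  from this[of c] show ?case by simp
qed

text \<open>If \<open>m + 1\<close> is the first exponent for which the power of \<open>f\<close> annihilates \<open>u\<close>, applying \<open>e\<close> shows
  that \<open>(m + 1) (c - m) f\<^sup>m u\<close> vanishes.\<close>

lemma highest_weight_natural:
  assumes u: "u \<in> W c" "u \<notin> K" "e u \<in> K" "(f ^^ n) u \<in> K"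
  shows "\<exists>m. c = of_nat m \<and> m < n \<and> (f ^^ Suc m) u \<in> K"
proof -
  define n0 where "n0 = (LEAST n. (f ^^ n) u \<in> K)"
  have n0: "(f ^^ n0) u \<in> K" "n0 \<le> n"
    unfolding n0_def by (rule LeastI, fact u, rule Least_le, fact u)
  then obtain m where m: "n0 = Suc m"
    using u(2) by (cases n0) auto
  then have nm: "(f ^^ m) u \<notin> K"
    using not_less_Least[of m "\<lambda>n. (f ^^ n) u \<in> K"] unfolding n0_def by auto
  have "scale (of_nat (Suc m) * (c - of_nat (Suc m) + 1)) ((f ^^ m) u) = e ((f ^^ n0) u) - (f ^^ n0) (e u)"
    using e_f_pow[OF u(1), of n0] by (simp add: m)
  then have *: "scale (of_nat (Suc m) * (c - of_nat (Suc m) + 1)) ((f ^^ m) u) \<in> K"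
    using n0 u(3) e_K f_pow_K subspace_diff[OF K] by metis
  have "of_nat (Suc m) * (c - of_nat (Suc m) + 1) = 0"
  proof (rule ccontr)
    assume "of_nat (Suc m) * (c - of_nat (Suc m) + 1) \<noteq> 0"
    then have "inverse (of_nat (Suc m) * (c - of_nat (Suc m) + 1)) * (of_nat (Suc m) * (c - of_nat (Suc m) + 1)) = 1"
      by (rule left_inverse)
    with subspace_scale[OF K *, of "inverse (of_nat (Suc m) * (c - of_nat (Suc m) + 1))"] nm
    show False by (simp del: of_nat_Suc)
  qed
  then have "c = of_nat m"
    by (simp only: mult_eq_0_iff of_nat_eq_0_iff) (simp add: algebra_simps)
  with m n0 show ?thesis by auto
qed

text \<open>Applying \<open>e\<close> as often as possible leads to a highest weight vector, and shifts the weight by even integers.\<close>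

lemma weight_integral:
  assumes u: "u \<in> W c" "u \<notin> K" "(e ^^ r) u \<in> K" and nil: "\<And>x. \<exists>n. (f ^^ n) x \<in> K"
  shows "c \<in> \<int>"
  using u
proof (induction r arbitrary: u c)
  case 0
  then show ?case by simp
next
  case (Suc r)
  show ?case
  proof (cases "e u \<in> K")
    case True
    from nil obtain n where "(f ^^ n) u \<in> K" by blast
    with highest_weight_natural[OF Suc.prems(1,2) True] show ?thesis
      by (metis Ints_of_nat)
  next
    case False
    with Suc.IH[of "e u" "c + 2"] e_W[OF Suc.prems(1)] Suc.prems(3)
    have "c + 2 \<in> \<int>" by (simp add: funpow_swap1)
    then have "(c + 2) - 2 \<in> \<int>" using Ints_diff Ints_numeral by blast
    then show ?thesis by simp
  qed
qed

end

section \<open>Roots of a simple Lie algebra\<close>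

locale simple_datum =
  fixes G :: "'g::ab_group_add lie_datum"
  assumes datum: "simple_lie_datum G"
begin

lemma lie: "lie_algebra G"
  using datum by (simp add: simple_lie_datum_def simple_lie_algebra_def)

sublocale vector_space "scl G"
  using lie by (simp add: lie_algebra_def)

lemma brk_add_left: "brk G (x + y) z = brk G x z + brk G y z"
  and brk_add_right: "brk G x (y + z) = brk G x y + brk G x z"
  and brk_scl_left: "brk G (scl G c x) y = scl G c (brk G x y)"
  and brk_scl_right: "brk G x (scl G c y) = scl G c (brk G x y)"
  and brk_self [simp]: "brk G x x = 0"
  and brk_cyclic: "brk G x (brk G y z) + brk G y (brk G z x) + brk G z (brk G x y) = 0"
  using lie by (auto simp: lie_algebra_def)

lemma brk_zero [simp]: "brk G 0 x = 0" "brk G x 0 = 0"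
  using brk_scl_left[of 0 0 x] brk_scl_right[of x 0 0] by simp_all

lemma brk_minus_left: "brk G (- x) y = - brk G x y"
  and brk_minus_right: "brk G x (- y) = - brk G x y"
  using brk_scl_left[of "-1" x y] brk_scl_right[of x "-1" y] by simp_all

lemma brk_diff_left: "brk G (x - y) z = brk G x z - brk G y z"
  and brk_diff_right: "brk G x (y - z) = brk G x y - brk G x z"
  using brk_add_left[of x "- y" z] brk_add_right[of x y "- z"] by (simp_all add: brk_minus_left brk_minus_right)

lemma brk_anti: "brk G x y = - brk G y x"
proof -
  have "brk G x y + brk G y x = 0"
    using brk_self[of "x + y"] by (simp add: brk_add_left brk_add_right del: brk_self) (simp add: add.commute)
  then show ?thesis
    by (simp add: eq_neg_iff_add_eq_0)
qed

lemma jacobi: "brk G x (brk G y z) = brk G (brk G x y) z + brk G y (brk G x z)"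
proof -
  have "brk G y (brk G z x) = - brk G y (brk G x z)" "brk G z (brk G x y) = - brk G (brk G x y) z"
    using brk_anti[of z x] brk_anti[of z "brk G x y"] by (simp_all add: brk_minus_right)
  then show ?thesis
    using brk_cyclic[of x y z] by (simp add: algebra_simps add_eq_0_iff)
qed

lemma brk_sum_right: "brk G x (\<Sum>i\<in>S. y i) = (\<Sum>i\<in>S. brk G x (y i))"
  by (induction S rule: infinite_finite_induct) (simp_all add: brk_add_right)

lemma finite_basis: "\<exists>B. finite B \<and> independent B \<and> span B = UNIV"
proof -
  from datum obtain S where S: "finite S" "span S = UNIV"
    by (auto simp: simple_lie_datum_def fin_dim_def)
  obtain B where "B \<subseteq> S" "independent B" "S \<subseteq> span B"
    using maximal_independent_subset[of S] by metis
  then show ?thesis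
    using S span_mono[of S "span B"] finite_subset by (intro exI[of _ B]) (auto simp: span_span)
qed

lemma independent_imp_finite: "independent S \<Longrightarrow> finite S"
  using finite_basis independent_span_bound by (metis subset_UNIV)

subsection \<open>The root space decomposition\<close>

lemma cartan: "cartan_subalgebra G (cartan G)"
  using datum by (simp add: simple_lie_datum_def)

lemma cartan_subspace: "subspace (cartan G)"
  and cartan_commute: "H \<in> cartan G \<Longrightarrow> H' \<in> cartan G \<Longrightarrow> brk G H H' = 0"
  and cartan_self_centralizing: "(\<And>H. H \<in> cartan G \<Longrightarrow> brk G H x = 0) \<Longrightarrow> x \<in> cartan G"
  and cartan_diagonalizable: "H \<in> cartan G \<Longrightarrow> span {x. \<exists>c. brk G H x = scl G c x} = UNIV"
  using cartan unfolding cartan_subalgebra_def by blast+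

text \<open>The components of an eigenvector of \<open>F\<close> with respect to a further element \<open>H\<^sub>0\<close> remain eigenvectors of \<open>F\<close>,
  because the operators commute.\<close>

lemma finite_joint_eigenvectors_span:
  assumes "finite F" "F \<subseteq> cartan G"
  shows "span {x. \<forall>H\<in>F. \<exists>c. brk G H x = scl G c x} = UNIV"
  using assms
proof (induction F)
  case empty
  show ?case by (simp add: span_UNIV)
next
  case (insert H0 F)
  let ?E = "{x. \<forall>H\<in>insert H0 F. \<exists>c. brk G H x = scl G c x}"
  have H0: "H0 \<in> cartan G" and F: "F \<subseteq> cartan G" using insert.prems by auto
  have "x \<in> span ?E" if x: "\<forall>H\<in>F. \<exists>c. brk G H x = scl G c x" for x
  proof -
    have "x \<in> span {y. \<exists>c. brk G H0 y = scl G c y}"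
      using cartan_diagonalizable[OF H0] by simp
    then obtain C y where C: "finite C" "\<forall>c\<in>C. brk G H0 (y c) = scl G c (y c)" "x = (\<Sum>c\<in>C. y c)"
      using span_eigenvectors_decomposition[of "brk G H0" x, OF brk_add_right brk_scl_right] by auto
    have "y c \<in> ?E" if c: "c \<in> C" for c
    proof -
      have "\<exists>a. brk G H (y c) = scl G a (y c)" if H: "H \<in> F" for H
      proof -
        obtain a where a: "brk G H x = scl G a x" using x H by blast
        define z where "z c = brk G H (y c) - scl G a (y c)" for c
        have "(\<Sum>c\<in>C. z c) = 0"
          using a by (simp add: z_def C(3) sum_subtractf brk_sum_right scale_sum_right)
        moreover have "brk G H0 (z c) = scl G c (z c)" if "c \<in> C" for c
        proof -
          have "brk G H0 (brk G H (y c)) = brk G H (brk G H0 (y c))"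
            using jacobi[of H0 H "y c"] cartan_commute[of H0 H] H0 F H by auto
          then show ?thesis
            using C(2) that
            by (simp add: z_def brk_diff_right brk_scl_right scale_right_diff_distrib mult.commute)
        qed
        ultimately have "\<forall>c\<in>C. z c = 0"
          using C(1) by (intro joint_eigenvectors_independent[where I = "{()}" and f = "\<lambda>_. brk G H0" and \<chi> = "\<lambda>c _. c"])
            (auto simp: brk_add_right brk_scl_right)
        then show ?thesis
          using c by (auto simp: z_def)
      qed
      then show ?thesis
        using C(2) c by auto
    qed
    then show ?thesis
      unfolding C(3) by (intro span_sum span_base)
  qed
  then have "span {x. \<forall>H\<in>F. \<exists>c. brk G H x = scl G c x} \<subseteq> span ?E"
    by (intro span_minimal subspace_span) auto
  then show ?case
    using insert.IH F by auto
qed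

lemma hstar_add: "\<alpha> \<in> hstar G \<Longrightarrow> \<beta> \<in> hstar G \<Longrightarrow> \<alpha> + \<beta> \<in> hstar G"
  and hstar_scale: "\<alpha> \<in> hstar G \<Longrightarrow> (\<lambda>x. c * \<alpha> x) \<in> hstar G"
  and hstar_zero: "0 \<in> hstar G"
  by (auto simp: hstar_def algebra_simps)

lemma hstar_uminus: "\<alpha> \<in> hstar G \<Longrightarrow> - \<alpha> \<in> hstar G"
  using hstar_scale[of \<alpha> "-1"] by (simp add: fun_Compl_def)

lemma hstar_diff: "\<alpha> \<in> hstar G \<Longrightarrow> \<beta> \<in> hstar G \<Longrightarrow> \<alpha> - \<beta> \<in> hstar G"
  using hstar_add[OF _ hstar_uminus, of \<alpha> \<beta>] by simp

lemma hstar_sum: "(\<And>i. i \<in> S \<Longrightarrow> f i \<in> hstar G) \<Longrightarrow> (\<lambda>x. \<Sum>i\<in>S. c i * f i x) \<in> hstar G"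
proof (induction S rule: infinite_finite_induct)
  case (insert a S)
  have "(\<lambda>x. c a * f a x) + (\<lambda>x. \<Sum>i\<in>S. c i * f i x) \<in> hstar G"
    using insert by (intro hstar_add hstar_scale) auto
  with insert show ?case by (simp add: plus_fun_def)
qed (use hstar_zero in \<open>simp_all add: zero_fun_def\<close>)

lemma hstar_additive: "\<alpha> \<in> hstar G \<Longrightarrow> H \<in> cartan G \<Longrightarrow> H' \<in> cartan G \<Longrightarrow> \<alpha> (H + H') = \<alpha> H + \<alpha> H'"
  and hstar_homogeneous: "\<alpha> \<in> hstar G \<Longrightarrow> H \<in> cartan G \<Longrightarrow> \<alpha> (scl G c H) = c * \<alpha> H"
  and hstar_outside: "\<alpha> \<in> hstar G \<Longrightarrow> x \<notin> cartan G \<Longrightarrow> \<alpha> x = 0"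
  by (auto simp: hstar_def)

lemma hstar_eqI: "\<alpha> \<in> hstar G \<Longrightarrow> \<beta> \<in> hstar G \<Longrightarrow> (\<And>H. H \<in> cartan G \<Longrightarrow> \<alpha> H = \<beta> H) \<Longrightarrow> \<alpha> = \<beta>"
  by (rule ext) (metis hstar_outside)

lemma root_space_subspace: "subspace (root_space G \<alpha>)"
  by (auto simp: subspace_def root_space_def brk_add_right brk_scl_right scale_right_distrib mult.commute)

lemma root_space_zero: "root_space G 0 = cartan G"
  using cartan_commute cartan_self_centralizing by (auto simp: root_space_def)

lemma root_space_brk:
  "x \<in> root_space G \<alpha> \<Longrightarrow> y \<in> root_space G \<beta> \<Longrightarrow> brk G x y \<in> root_space G (\<alpha> + \<beta>)"
  by (auto simp: root_space_def jacobi brk_scl_left brk_scl_right scale_left_distrib)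

lemma rootD: "\<alpha> \<in> roots G \<Longrightarrow> \<alpha> \<in> hstar G" "\<alpha> \<in> roots G \<Longrightarrow> \<alpha> \<noteq> 0"
  "\<alpha> \<in> roots G \<Longrightarrow> \<exists>x. x \<in> root_space G \<alpha> \<and> x \<noteq> 0"
  using subspace_0[OF root_space_subspace[of \<alpha>]] by (auto simp: roots_def zero_fun_def)

lemma rootI: "\<alpha> \<in> hstar G \<Longrightarrow> \<alpha> \<noteq> 0 \<Longrightarrow> x \<in> root_space G \<alpha> \<Longrightarrow> x \<noteq> 0 \<Longrightarrow> \<alpha> \<in> roots G"
  by (auto simp: roots_def zero_fun_def)

lemma not_root_imp_zero:
  "\<alpha> \<in> hstar G \<Longrightarrow> \<alpha> \<noteq> 0 \<Longrightarrow> \<alpha> \<notin> roots G \<Longrightarrow> x \<in> root_space G \<alpha> \<Longrightarrow> x = 0"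
  using rootI by blast

lemma weight_vectors_independent:
  assumes "finite S" "S \<subseteq> hstar G" "\<And>\<alpha>. \<alpha> \<in> S \<Longrightarrow> x \<alpha> \<in> root_space G \<alpha>" "(\<Sum>\<alpha>\<in>S. x \<alpha>) = 0"
    and "\<alpha> \<in> S"
  shows "x \<alpha> = 0"
proof -
  have "\<forall>\<alpha>\<in>S. x \<alpha> = 0"
  proof (rule joint_eigenvectors_independent[where I = "cartan G" and f = "brk G" and \<chi> = "\<lambda>c i. c i"])
    fix \<alpha> \<beta> assume "\<alpha> \<in> S" "\<beta> \<in> S" "\<alpha> \<noteq> \<beta>"
    then show "\<exists>H\<in>cartan G. \<alpha> H \<noteq> \<beta> H"
      using hstar_eqI assms(2) by blast
  qed (use assms in \<open>auto simp: brk_add_right brk_scl_right root_space_def\<close>)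
  with assms(5) show ?thesis by blast
qed

lemma root_space_unique:
  assumes "x \<in> root_space G \<alpha>" "x \<in> root_space G \<beta>" "x \<noteq> 0" "\<alpha> \<in> hstar G" "\<beta> \<in> hstar G"
  shows "\<alpha> = \<beta>"
proof (rule hstar_eqI)
  fix H assume "H \<in> cartan G"
  then have "scl G (\<alpha> H) x = scl G (\<beta> H) x"
    using assms by (auto simp: root_space_def)
  then show "\<alpha> H = \<beta> H" using assms(3) by simp
qed (use assms in auto)

text \<open>One nonzero vector from each root space gives an independent family.\<close>

lemma finite_roots: "finite (roots G)"
proof -
  define x where "x \<alpha> = (SOME x. x \<in> root_space G \<alpha> \<and> x \<noteq> 0)" for \<alpha>
  have x: "x \<alpha> \<in> root_space G \<alpha>" "x \<alpha> \<noteq> 0" if "\<alpha> \<in> roots G" for \<alpha>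
    using someI_ex[OF rootD(3)[OF that]] by (auto simp: x_def)
  have inj: "inj_on x (roots G)"
    using x root_space_unique rootD(1) by (intro inj_onI) metis
  have "independent (x ` roots G)"
    unfolding independent_explicit_finite_subsets
  proof (intro allI impI ballI)
    fix S u v assume S: "S \<subseteq> x ` roots G" "finite S" "(\<Sum>v\<in>S. scl G (u v) v) = 0" and v: "v \<in> S"
    define T where "T = {\<alpha>\<in>roots G. x \<alpha> \<in> S}"
    have inj': "inj_on x T" and im: "S = x ` T"
      using inj S(1) by (auto simp: T_def inj_on_def)
    have "finite T" using S(2) inj' finite_image_iff im by blast
    moreover have "(\<Sum>\<alpha>\<in>T. scl G (u (x \<alpha>)) (x \<alpha>)) = 0"
      using S(3) unfolding im sum.reindex[OF inj'] by simp
    moreover have "T \<subseteq> hstar G"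
      using rootD(1) by (auto simp: T_def)
    moreover have "scl G (u (x \<alpha>)) (x \<alpha>) \<in> root_space G \<alpha>" if "\<alpha> \<in> T" for \<alpha>
      using that x(1)[of \<alpha>] subspace_scale[OF root_space_subspace] by (simp add: T_def)
    ultimately have *: "scl G (u (x \<alpha>)) (x \<alpha>) = 0" if "\<alpha> \<in> T" for \<alpha>
      using that weight_vectors_independent[of T "\<lambda>\<alpha>. scl G (u (x \<alpha>)) (x \<alpha>)"] by blast
    obtain \<alpha> where "\<alpha> \<in> T" "v = x \<alpha>" using v im by blast
    with *[of \<alpha>] x(2)[of \<alpha>] show "u v = 0"
      by (simp add: T_def)
  qed
  then show ?thesis
    using independent_imp_finite finite_image_iff[OF inj] by blast
qed

text \<open>A joint eigenvector for a basis of the Cartan subalgebra is one for all of it, and its eigenvalue is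
  linear on the Cartan subalgebra, that is, a root or zero.\<close>

lemma root_decomposition: "span (cartan G \<union> (\<Union>\<beta>\<in>roots G. root_space G \<beta>)) = UNIV"
proof -
  let ?S = "span (cartan G \<union> (\<Union>\<beta>\<in>roots G. root_space G \<beta>))"
  obtain B where B: "B \<subseteq> cartan G" "independent B" "cartan G \<subseteq> span B"
    using maximal_independent_subset[of "cartan G"] by metis
  have "x \<in> ?S" if x: "\<forall>H\<in>B. \<exists>c. brk G H x = scl G c x" for x
  proof (cases "x = 0")
    case False
    have "subspace {H. \<exists>c. brk G H x = scl G c x}"
    proof (rule subspaceI)
      show "H + H' \<in> {H. \<exists>c. brk G H x = scl G c x}"
        if "H \<in> {H. \<exists>c. brk G H x = scl G c x}" "H' \<in> {H. \<exists>c. brk G H x = scl G c x}" for H H'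
        using that by (auto simp: brk_add_left scale_left_distrib[symmetric])
      show "scl G a H \<in> {H. \<exists>c. brk G H x = scl G c x}" if "H \<in> {H. \<exists>c. brk G H x = scl G c x}" for a H
        using that by (auto simp: brk_scl_left)
    qed (auto intro: exI[of _ 0])
    then have "span B \<subseteq> {H. \<exists>c. brk G H x = scl G c x}"
      using x by (intro span_minimal) auto
    with B(3) have "\<forall>H\<in>cartan G. \<exists>c. brk G H x = scl G c x" by auto
    then obtain b where b: "\<And>H. H \<in> cartan G \<Longrightarrow> brk G H x = scl G (b H) x" by metis
    define \<beta> where "\<beta> H = (if H \<in> cartan G then b H else 0)" for H
    have xb: "x \<in> root_space G \<beta>"
      using b by (simp add: root_space_def \<beta>_def)
    have "\<beta> \<in> hstar G"
    proof -
      have "b (H + H') = b H + b H'" if "H \<in> cartan G" "H' \<in> cartan G" for H H'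
      proof -
        have "scl G (b (H + H')) x = scl G (b H + b H') x"
          using b that subspace_add[OF cartan_subspace that]
          by (simp flip: b add: scale_left_distrib brk_add_left)
        then show ?thesis using False by simp
      qed
      moreover have "b (scl G c H) = c * b H" if "H \<in> cartan G" for H c
      proof -
        have "scl G (b (scl G c H)) x = scl G (c * b H) x"
          using b[OF that] b[of "scl G c H"] that subspace_scale[OF cartan_subspace that]
          by (auto simp: brk_scl_left)
        then show ?thesis using False scale_cancel_right by blast
      qed
      ultimately show ?thesis
        using subspace_add[OF cartan_subspace] subspace_scale[OF cartan_subspace]
        by (auto simp: hstar_def \<beta>_def)
    qed
    then have "\<beta> = 0 \<or> \<beta> \<in> roots G"
      using rootI[OF _ _ xb False] by blast
    then show ?thesis
    proof
      assume "\<beta> = 0"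
      then have "x \<in> cartan G" using xb root_space_zero by simp
      then show ?thesis by (auto intro: span_base)
    next
      assume "\<beta> \<in> roots G"
      then show ?thesis using xb by (auto intro: span_base)
    qed
  qed (simp add: span_zero)
  then have "span {x. \<forall>H\<in>B. \<exists>c. brk G H x = scl G c x} \<subseteq> ?S"
    by (intro span_minimal subspace_span) auto
  moreover have "span {x. \<forall>H\<in>B. \<exists>c. brk G H x = scl G c x} = UNIV"
    using independent_imp_finite[OF B(2)] B(1) by (rule finite_joint_eigenvectors_span)
  ultimately show ?thesis by auto
qed

lemma span_decomposition_induct:
  assumes "subspace S" "\<And>H. H \<in> cartan G \<Longrightarrow> H \<in> S"
    "\<And>\<beta> y. \<beta> \<in> roots G \<Longrightarrow> y \<in> root_space G \<beta> \<Longrightarrow> y \<in> S"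
  shows "x \<in> S"
proof -
  have "span (cartan G \<union> (\<Union>\<beta>\<in>roots G. root_space G \<beta>)) \<subseteq> S"
    using assms by (intro span_minimal) auto
  with root_decomposition show ?thesis by auto
qed

lemma invariant: "invariant_form G"
  using datum by (simp add: simple_lie_datum_def)

lemma form_add_left: "iform G (x + y) z = iform G x z + iform G y z"
  and form_scl_left: "iform G (scl G c x) y = c * iform G x y"
  and form_sym: "iform G x y = iform G y x"
  and form_brk: "iform G (brk G x y) z = iform G x (brk G y z)"
  using invariant unfolding invariant_form_def by blast+

lemma form_nondegenerate: "(\<And>y. iform G x y = 0) \<Longrightarrow> x = 0"
  using invariant unfolding invariant_form_def by blast

lemma form_add_right: "iform G x (y + z) = iform G x y + iform G x z"
  and form_scl_right: "iform G x (scl G c y) = c * iform G x y"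
  using form_add_left[of y z x] form_scl_left[of c y x] by (simp_all add: form_sym)

lemma form_zero [simp]: "iform G 0 x = 0" "iform G x 0 = 0"
  using form_scl_left[of 0 0 x] form_scl_right[of x 0 0] by simp_all

lemma form_diff_left: "iform G (x - y) z = iform G x z - iform G y z"
  using form_add_left[of "x - y" y z] by simp

lemma form_sum_left: "iform G (\<Sum>i\<in>S. f i) y = (\<Sum>i\<in>S. iform G (f i) y)"
  and form_sum_right: "iform G y (\<Sum>i\<in>S. f i) = (\<Sum>i\<in>S. iform G y (f i))"
  by (induction S rule: infinite_finite_induct) (simp_all add: form_add_left form_add_right)

lemma form_orthogonal:
  assumes "x \<in> root_space G \<alpha>" "y \<in> root_space G \<beta>" "H \<in> cartan G" "\<alpha> H + \<beta> H \<noteq> 0"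
  shows "iform G x y = 0"
proof -
  have "\<alpha> H * iform G x y = iform G (brk G H x) y"
    using assms by (simp add: root_space_def form_scl_left)
  also have "\<dots> = - iform G (brk G x H) y"
    using brk_anti[of H x] form_scl_left[of "-1" "brk G x H" y] by simp
  also have "\<dots> = - (\<beta> H * iform G x y)"
    using assms by (simp add: root_space_def form_brk form_scl_right)
  finally have "(\<alpha> H + \<beta> H) * iform G x y = 0"
    by (simp add: algebra_simps)
  with assms(4) show ?thesis by simp
qed

text \<open>The Cartan subalgebra is orthogonal to all root spaces, so a degenerate element would be degenerate in \<open>\<gg>\<close>.\<close>

lemma form_nondegenerate_cartan:
  assumes t: "t \<in> cartan G" and 0: "\<And>H. H \<in> cartan G \<Longrightarrow> iform G t H = 0"
  shows "t = 0"
proof (rule form_nondegenerate)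
  fix y
  have "y \<in> {y. iform G t y = 0}"
  proof (rule span_decomposition_induct)
    show "subspace {y. iform G t y = 0}"
      by (auto simp: subspace_def form_add_right form_scl_right)
    fix \<beta> z assume \<beta>: "\<beta> \<in> roots G" and z: "z \<in> root_space G \<beta>"
    then obtain H where "H \<in> cartan G" "\<beta> H \<noteq> 0"
      using rootD(1,2) hstar_outside by (metis ext zero_fun_apply)
    moreover have "t \<in> root_space G 0" using t root_space_zero by simp
    ultimately show "z \<in> {y. iform G t y = 0}"
      using form_orthogonal[of t 0 z \<beta> H] z by simp
  qed (use 0 in auto)
  then show "iform G t y = 0" by simp
qed

lemma rep_elt_eqI:
  assumes "t \<in> cartan G" "\<And>H. H \<in> cartan G \<Longrightarrow> iform G t H = lam H"
  shows "rep_elt G lam = t"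
  unfolding rep_elt_def
proof (rule the_equality)
  fix t' assume t': "t' \<in> cartan G \<and> (\<forall>H\<in>cartan G. iform G t' H = lam H)"
  have "t' - t = 0"
    using t' assms subspace_diff[OF cartan_subspace]
    by (intro form_nondegenerate_cartan) (auto simp: form_diff_left)
  then show "t' = t" by simp
qed (use assms in auto)

text \<open>A root vector is orthogonal to all weight spaces except the opposite one.\<close>

lemma opposite_pairing:
  assumes \<alpha>: "\<alpha> \<in> roots G" and x: "x \<in> root_space G \<alpha>" "x \<noteq> 0"
  shows "\<exists>y\<in>root_space G (- \<alpha>). iform G x y \<noteq> 0"
proof (rule ccontr)
  assume "\<not> ?thesis"
  then have 0: "iform G x y = 0" if "y \<in> root_space G (- \<alpha>)" for y
    using that by auto
  have orth: "iform G x y = 0" if "y \<in> root_space G \<beta>" "\<beta> \<in> hstar G" for y \<beta>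
  proof (cases "\<beta> = - \<alpha>")
    case False
    have "\<exists>H\<in>cartan G. \<beta> H \<noteq> (- \<alpha>) H"
      using False hstar_eqI[OF that(2) hstar_uminus[OF rootD(1)[OF \<alpha>]]] by blast
    then show ?thesis
      using form_orthogonal[OF x(1) that(1)] by (auto simp: fun_Compl_def eq_neg_iff_add_eq_0 add.commute)
  qed (use that 0 in simp)
  have "x = 0"
  proof (rule form_nondegenerate)
    fix y
    have "y \<in> {y. iform G x y = 0}"
    proof (rule span_decomposition_induct)
      show "subspace {y. iform G x y = 0}"
        by (auto simp: subspace_def form_add_right form_scl_right)
    qed (use orth hstar_zero root_space_zero rootD(1) in auto)
    then show "iform G x y = 0" by simp
  qed
  with x show False by simp
qed

text \<open>The bracket of \<open>x\<close> and \<open>y\<close> lies in the Cartan subalgebra and pairs with \<open>H\<close> to \<open>(x|y) \<alpha>(H)\<close> by invariance.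
  Normalizing \<open>(x|y) = 1\<close> proves that \<open>\<alpha>\<close> is represented by an element at all.\<close>

lemma rep_root:
  assumes "\<alpha> \<in> roots G"
  shows "rep_elt G \<alpha> \<in> cartan G" "H \<in> cartan G \<Longrightarrow> iform G (rep_elt G \<alpha>) H = \<alpha> H"
    and "x \<in> root_space G \<alpha> \<Longrightarrow> y \<in> root_space G (- \<alpha>) \<Longrightarrow> brk G x y = scl G (iform G x y) (rep_elt G \<alpha>)"
proof -
  have brk: "brk G x y \<in> cartan G \<and> (\<forall>H\<in>cartan G. iform G (brk G x y) H = iform G x y * \<alpha> H)"
    if "x \<in> root_space G \<alpha>" "y \<in> root_space G (- \<alpha>)" for x y
  proof (intro conjI ballI)
    show "brk G x y \<in> cartan G"
      using root_space_brk[OF that] root_space_zero by simp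
    fix H assume H: "H \<in> cartan G"
    have "iform G (brk G x y) H = iform G x (brk G y H)" by (rule form_brk)
    also have "brk G y H = scl G (\<alpha> H) y"
      using brk_anti[of y H] that(2) H by (simp add: root_space_def)
    finally show "iform G (brk G x y) H = iform G x y * \<alpha> H"
      by (simp add: form_scl_right)
  qed
  obtain x0 where x: "x0 \<in> root_space G \<alpha>" "x0 \<noteq> 0" using rootD(3)[OF assms] by blast
  then obtain y0 where y: "y0 \<in> root_space G (- \<alpha>)" "iform G x0 y0 \<noteq> 0"
    using opposite_pairing assms by blast
  define t where "t = scl G (1 / iform G x0 y0) (brk G x0 y0)"
  have t: "t \<in> cartan G" "\<And>H. H \<in> cartan G \<Longrightarrow> iform G t H = \<alpha> H"
    using brk[OF x(1) y(1)] y(2) subspace_scale[OF cartan_subspace] by (auto simp: t_def form_scl_left)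
  then have rep: "rep_elt G \<alpha> = t" by (rule rep_elt_eqI)
  then show t1: "rep_elt G \<alpha> \<in> cartan G" and t2: "H \<in> cartan G \<Longrightarrow> iform G (rep_elt G \<alpha>) H = \<alpha> H"
    using t by simp_all
  show "x \<in> root_space G \<alpha> \<Longrightarrow> y \<in> root_space G (- \<alpha>) \<Longrightarrow> brk G x y = scl G (iform G x y) (rep_elt G \<alpha>)"
  proof -
    assume xy: "x \<in> root_space G \<alpha>" "y \<in> root_space G (- \<alpha>)"
    have "brk G x y - scl G (iform G x y) t = 0"
      using brk[OF xy] t subspace_diff[OF cartan_subspace] subspace_scale[OF cartan_subspace]
      by (intro form_nondegenerate_cartan) (auto simp: form_diff_left form_scl_left)
    with rep show ?thesis by simp
  qed
qed

lemma uminus_root: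
  assumes "\<alpha> \<in> roots G"
  shows "- \<alpha> \<in> roots G"
proof -
  obtain x where x: "x \<in> root_space G \<alpha>" "x \<noteq> 0" using rootD(3)[OF assms] by blast
  then obtain y where y: "y \<in> root_space G (- \<alpha>)" "iform G x y \<noteq> 0"
    using opposite_pairing assms by blast
  then have "y \<noteq> 0" by auto
  with y show ?thesis
    using rootI[of "- \<alpha>" y] hstar_uminus rootD[OF assms] by (auto simp: fun_eq_iff)
qed

lemma wform_root: "\<alpha> \<in> roots G \<Longrightarrow> \<beta> \<in> roots G \<Longrightarrow> wform G \<alpha> \<beta> = \<alpha> (rep_elt G \<beta>)"
  by (simp add: wform_def rep_root)

lemma wform_sym: "wform G \<alpha> \<beta> = wform G \<beta> \<alpha>"
  by (simp add: wform_def form_sym)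

lemma norm_root:
  assumes "\<alpha> \<in> roots G"
  obtains r where "wform G \<alpha> \<alpha> = of_real r" "0 < r" "r \<le> 2"
proof -
  have "wform G \<alpha> \<alpha> \<in> \<real>" "0 < Re (wform G \<alpha> \<alpha>)" "Re (wform G \<alpha> \<alpha>) \<le> 2"
    using assms datum by (auto simp: simple_lie_datum_def normalized_form_def)
  then show ?thesis
    by (intro that[of "Re (wform G \<alpha> \<alpha>)"]) (auto simp: of_real_Re)
qed

lemma norm_root_nz: "\<alpha> \<in> roots G \<Longrightarrow> wform G \<alpha> \<alpha> \<noteq> 0"
  by (erule norm_root) auto

lemma coroot_cartan: "\<alpha> \<in> roots G \<Longrightarrow> coroot G \<alpha> \<in> cartan G"
  by (simp add: coroot_def rep_root subspace_scale[OF cartan_subspace])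

lemma eval_coroot: "\<beta> \<in> hstar G \<Longrightarrow> \<alpha> \<in> roots G \<Longrightarrow> \<beta> (coroot G \<alpha>) = 2 / wform G \<alpha> \<alpha> * \<beta> (rep_elt G \<alpha>)"
  by (simp add: coroot_def hstar_homogeneous rep_root)

lemma root_coroot: "\<alpha> \<in> roots G \<Longrightarrow> \<beta> \<in> roots G \<Longrightarrow> \<beta> (coroot G \<alpha>) = 2 * wform G \<beta> \<alpha> / wform G \<alpha> \<alpha>"
  by (simp add: eval_coroot rootD(1) wform_root)

lemma root_coroot_self: "\<alpha> \<in> roots G \<Longrightarrow> \<alpha> (coroot G \<alpha>) = 2"
  by (simp add: root_coroot norm_root_nz)

lemma simple_sys: "simple_system G"
  using datum by (simp add: simple_lie_datum_def)

lemma simple_root: "i \<in> {1..rank G} \<Longrightarrow> sroot G i \<in> roots G"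
  and simple_independent: "(\<And>x. (\<Sum>i=1..rank G. c i * sroot G i x) = 0) \<Longrightarrow> i \<in> {1..rank G} \<Longrightarrow> c i = (0::complex)"
  and pos_or_neg: "\<beta> \<in> roots G \<Longrightarrow> \<beta> \<in> pos_roots G \<or> - \<beta> \<in> pos_roots G"
  using simple_sys by (auto simp: simple_system_def fun_Compl_def)

lemma pos_rootD: "\<alpha> \<in> pos_roots G \<Longrightarrow> \<alpha> \<in> roots G"
  by (simp add: pos_roots_def)

lemma simple_pos:
  assumes "i \<in> {1..rank G}"
  shows "sroot G i \<in> pos_roots G"
proof -
  have "sroot G i = (\<lambda>x. \<Sum>j=1..rank G. of_nat (if j = i then 1 else 0) * sroot G j x)"
    using assms by (simp add: if_distrib[of of_nat] if_distrib[of "\<lambda>x. x * _"] sum.delta cong: if_cong)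
  then show ?thesis
    using simple_root[OF assms] unfolding pos_roots_def mem_Collect_eq
    by (intro conjI exI[of _ "\<lambda>j. if j = i then 1 else 0"])
qed

subsection \<open>Dual bases\<close>

lemma rep_simple_sum:
  assumes H: "H \<in> cartan G"
  shows "iform G (\<Sum>i=1..rank G. scl G (c i) (rep_elt G (sroot G i))) H = (\<Sum>i=1..rank G. c i * sroot G i H)"
  unfolding form_sum_left using H simple_root by (intro sum.cong) (auto simp: form_scl_left rep_root)

lemma rep_simple_independent:
  assumes "(\<Sum>i=1..rank G. scl G (c i) (rep_elt G (sroot G i))) = 0" "i \<in> {1..rank G}"
  shows "c i = 0"
proof (rule simple_independent[OF _ assms(2)])
  fix x
  show "(\<Sum>i=1..rank G. c i * sroot G i x) = 0"
  proof (cases "x \<in> cartan G")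
    case True
    then show ?thesis using rep_simple_sum[OF True, of c] assms(1) by simp
  next
    case False
    then show ?thesis using simple_root rootD(1) hstar_outside by (intro sum.neutral) auto
  qed
qed

text \<open>There are as many independent elements here as the dimension, by definition of the rank.\<close>

lemma cartan_span_rep: "cartan G \<subseteq> span ((\<lambda>i. rep_elt G (sroot G i)) ` {1..rank G})"
proof -
  let ?t = "\<lambda>i. rep_elt G (sroot G i)"
  obtain B where B: "finite B" "independent B" "span B = UNIV" using finite_basis by blast
  interpret finite_dimensional_vector_space "scl G" B
    using B by unfold_locales auto
  have inj: "inj_on ?t {1..rank G}"
  proof (rule inj_onI, rule ccontr)
    fix i j assume ij: "i \<in> {1..rank G}" "j \<in> {1..rank G}" "?t i = ?t j" "i \<noteq> j"
    have "(\<Sum>k=1..rank G. scl G ((if k = i then 1 else 0) - (if k = j then 1 else 0)) (?t k)) = ?t i - ?t j"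
      using ij by (simp add: scale_left_diff_distrib sum_subtractf if_distrib[of "\<lambda>x. scl G x _"] cong: if_cong)
    with rep_simple_independent[OF _ ij(1)] ij show False by fastforce
  qed
  have "independent (?t ` {1..rank G})"
  proof (rule independent_if_scalars_zero)
    fix f x assume *: "(\<Sum>x\<in>?t ` {1..rank G}. scl G (f x) x) = 0" "x \<in> ?t ` {1..rank G}"
    have "(\<Sum>i=1..rank G. scl G (f (?t i)) (?t i)) = 0"
      using *(1) unfolding sum.reindex[OF inj] o_def .
    with *(2) show "f x = 0"
      using rep_simple_independent[of "\<lambda>i. f (?t i)"] by blast
  qed simp
  moreover have "card (?t ` {1..rank G}) = dim (cartan G)"
    using card_image[OF inj] by (simp add: rank_def)
  moreover have "?t ` {1..rank G} \<subseteq> cartan G"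
    using simple_root rep_root by auto
  ultimately show ?thesis
    using card_eq_dim[of "?t ` {1..rank G}" "cartan G"] by auto
qed

lemma simple_separates:
  assumes "H \<in> cartan G" "\<And>i. i \<in> {1..rank G} \<Longrightarrow> sroot G i H = 0"
  shows "H = 0"
proof (rule form_nondegenerate_cartan[OF assms(1)])
  fix H' assume "H' \<in> cartan G"
  then have "H' \<in> span ((\<lambda>i. rep_elt G (sroot G i)) ` {1..rank G})"
    using cartan_span_rep by auto
  moreover have "span ((\<lambda>i. rep_elt G (sroot G i)) ` {1..rank G}) \<subseteq> {y. iform G H y = 0}"
    using assms simple_root rep_root(2) form_sym
    by (intro span_minimal) (fastforce simp: subspace_def form_add_right form_scl_right)+
  ultimately show "iform G H H' = 0" by auto
qed

text \<open>With \<open>t\<^sub>i\<close> the element representing \<open>\<alpha>\<^sub>i\<close>, the map \<open>H \<mapsto> \<Sum>\<^sub>i (H|t\<^sub>i) t\<^sub>i\<close> of the Cartan subalgebra is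
  injective, hence surjective, and a preimage of \<open>\<Sum>\<^sub>i a\<^sub>i t\<^sub>i\<close> is the required element.\<close>

lemma exists_dual_element:
  "\<exists>H\<in>cartan G. \<forall>i\<in>{1..rank G}. sroot G i H = a i"
proof -
  let ?t = "\<lambda>i. rep_elt G (sroot G i)"
  obtain B where B: "finite B" "independent B" "span B = UNIV" using finite_basis by blast
  interpret finite_dimensional_vector_space "scl G" B
    using B by unfold_locales auto
  interpret P: finite_dimensional_vector_space_pair "scl G" B "scl G" B
    by unfold_locales
  define \<phi> where "\<phi> H = (\<Sum>i=1..rank G. scl G (iform G H (?t i)) (?t i))" for H
  have lin: "Vector_Spaces.linear (scl G) (scl G) \<phi>"
    unfolding Vector_Spaces.linear_iff \<phi>_def
    by (auto simp: form_add_left form_scl_left scale_left_distrib sum.distrib scale_sum_right vector_space_axioms)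
  have t: "?t i \<in> cartan G" if "i \<in> {1..rank G}" for i
    using that simple_root rep_root by auto
  have sub: "\<phi> ` cartan G \<subseteq> cartan G"
    using t subspace_scale[OF cartan_subspace] by (auto simp: \<phi>_def intro!: subspace_sum[OF cartan_subspace])
  have inj: "inj_on \<phi> (cartan G)"
  proof (rule inj_onI)
    fix H H' assume H: "H \<in> cartan G" "H' \<in> cartan G" "\<phi> H = \<phi> H'"
    have "(\<Sum>i=1..rank G. scl G (iform G (H - H') (?t i)) (?t i)) = 0"
      using H(3) by (simp add: \<phi>_def form_diff_left scale_left_diff_distrib sum_subtractf)
    then have "iform G (H - H') (?t i) = 0" if "i \<in> {1..rank G}" for i
      using rep_simple_independent[of "\<lambda>i. iform G (H - H') (?t i)"] that by blast
    then have "H - H' = 0"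
      using subspace_diff[OF cartan_subspace H(1,2)] simple_root rep_root(2)
      by (intro simple_separates) (auto simp: form_sym[of "H - H'"])
    then show "H = H'" by simp
  qed
  have sp: "span (cartan G) = cartan G" using cartan_subspace by (simp add: span_eq_iff)
  have "dim (\<phi> ` cartan G) = dim (cartan G)"
    using P.dim_image_eq[OF lin, of "cartan G"] inj unfolding sp by blast
  moreover have "subspace (\<phi> ` cartan G)"
    using P.linear_subspace_image[OF lin cartan_subspace] .
  ultimately have im: "\<phi> ` cartan G = cartan G"
    using sub cartan_subspace by (intro subspace_dim_equal) auto
  have "(\<Sum>i=1..rank G. scl G (a i) (?t i)) \<in> cartan G"
    using t subspace_scale[OF cartan_subspace] by (auto intro!: subspace_sum[OF cartan_subspace])
  then have "(\<Sum>i=1..rank G. scl G (a i) (?t i)) \<in> \<phi> ` cartan G"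
    unfolding im .
  then obtain H where H: "H \<in> cartan G" "\<phi> H = (\<Sum>i=1..rank G. scl G (a i) (?t i))"
    by (elim imageE) metis
  then have "(\<Sum>i=1..rank G. scl G (iform G H (?t i) - a i) (?t i)) = 0"
    by (simp add: \<phi>_def scale_left_diff_distrib sum_subtractf)
  then have "iform G H (?t i) = a i" if "i \<in> {1..rank G}" for i
    using rep_simple_independent[OF _ that] by fastforce
  with H(1) show ?thesis
    using simple_root rep_root(2) by (metis form_sym)
qed

end

lemma of_nat_neq_minus_Suc: "- of_nat (Suc k) \<noteq> (of_nat m :: complex)"
proof
  assume "- of_nat (Suc k) = (of_nat m :: complex)"
  then have "Re (- of_nat (Suc k)) = Re (of_nat m)" by (rule arg_cong)
  then show False by simp
qed

context simple_datum
begin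

lemma rep_weight:
  assumes "lam \<in> hstar G"
  shows "rep_elt G lam \<in> cartan G" "H \<in> cartan G \<Longrightarrow> iform G (rep_elt G lam) H = lam H"
proof -
  let ?t = "\<lambda>i. rep_elt G (sroot G i)"
  obtain X where X: "X \<in> cartan G" "\<And>i. i \<in> {1..rank G} \<Longrightarrow> sroot G i X = lam (?t i)"
    using exists_dual_element[of "\<lambda>i. lam (?t i)"] by blast
  have "lam 0 = 0"
    using hstar_homogeneous[OF assms subspace_0[OF cartan_subspace], of 0] by simp
  then have "subspace {y\<in>cartan G. iform G X y = lam y}"
    using assms cartan_subspace
    by (auto simp: subspace_def form_add_right form_scl_right hstar_additive hstar_homogeneous)
  moreover have "iform G X (?t i) = lam (?t i)" if "i \<in> {1..rank G}" for i
    using X that simple_root rep_root(2) form_sym by metis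
  ultimately have "span (?t ` {1..rank G}) \<subseteq> {y\<in>cartan G. iform G X y = lam y}"
    using simple_root rep_root(1) by (intro span_minimal) auto
  then have *: "iform G X H = lam H" if "H \<in> cartan G" for H
    using cartan_span_rep that by auto
  have "rep_elt G lam = X" by (rule rep_elt_eqI) (use X * in auto)
  with X(1) * show "rep_elt G lam \<in> cartan G" "H \<in> cartan G \<Longrightarrow> iform G (rep_elt G lam) H = lam H"
    by auto
qed

lemma wform_eval: "lam \<in> hstar G \<Longrightarrow> \<mu> \<in> hstar G \<Longrightarrow> wform G lam \<mu> = lam (rep_elt G \<mu>)"
  by (simp add: wform_def rep_weight)

lemma wform_add_left: "lam \<in> hstar G \<Longrightarrow> \<mu> \<in> hstar G \<Longrightarrow> \<nu> \<in> hstar G \<Longrightarrow> wform G (lam + \<mu>) \<nu> = wform G lam \<nu> + wform G \<mu> \<nu>"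
  and wform_scale_left: "lam \<in> hstar G \<Longrightarrow> \<nu> \<in> hstar G \<Longrightarrow> wform G (\<lambda>x. c * lam x) \<nu> = c * wform G lam \<nu>"
  by (simp_all add: wform_eval hstar_add hstar_scale)

lemma wform_uminus_left: "lam \<in> hstar G \<Longrightarrow> \<nu> \<in> hstar G \<Longrightarrow> wform G (- lam) \<nu> = - wform G lam \<nu>"
  by (simp add: wform_eval hstar_uminus)

lemma wform_diff_left: "lam \<in> hstar G \<Longrightarrow> \<mu> \<in> hstar G \<Longrightarrow> \<nu> \<in> hstar G \<Longrightarrow> wform G (lam - \<mu>) \<nu> = wform G lam \<nu> - wform G \<mu> \<nu>"
  by (simp add: wform_eval hstar_diff)

lemma wform_sum_left:
  assumes "\<And>i. i \<in> S \<Longrightarrow> f i \<in> hstar G" "\<nu> \<in> hstar G"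
  shows "wform G (\<lambda>x. \<Sum>i\<in>S. c i * f i x) \<nu> = (\<Sum>i\<in>S. c i * wform G (f i) \<nu>)"
  using assms by (simp add: wform_eval hstar_sum)

lemma eval_coroot_wform: "lam \<in> hstar G \<Longrightarrow> \<alpha> \<in> roots G \<Longrightarrow> lam (coroot G \<alpha>) = dnum G \<alpha> * wform G lam \<alpha>"
  by (simp add: eval_coroot wform_eval rootD(1) dnum_def)

subsection \<open>The \<open>sl\<^sub>2\<close> of a positive root\<close>

lemma root_vectors:
  assumes "\<alpha> \<in> pos_roots G"
  shows "xplus G \<alpha> \<in> root_space G \<alpha>" "xplus G \<alpha> \<noteq> 0"
    "xminus G \<alpha> \<in> root_space G (- \<alpha>)" "xminus G \<alpha> \<noteq> 0"
    "brk G (xplus G \<alpha>) (xminus G \<alpha>) = coroot G \<alpha>"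
  using datum assms by (auto simp: simple_lie_datum_def fun_Compl_def)

lemma ad_pow_space:
  assumes "y \<in> root_space G \<alpha>" "x \<in> root_space G \<beta>"
  shows "(brk G y ^^ n) x \<in> root_space G (\<beta> + (\<lambda>H. of_nat n * \<alpha> H))"
proof (induction n)
  case 0
  then show ?case using assms by (simp add: plus_fun_def)
next
  case (Suc n)
  have "\<alpha> + (\<beta> + (\<lambda>H. of_nat n * \<alpha> H)) = \<beta> + (\<lambda>H. of_nat (Suc n) * \<alpha> H)"
    by (simp add: fun_eq_iff algebra_simps)
  with root_space_brk[OF assms(1) Suc.IH] show ?case by (simp only: funpow.simps o_apply)
qed

lemma ad_pow_linear:
  "(brk G y ^^ n) (x + x') = (brk G y ^^ n) x + (brk G y ^^ n) x'"
  "(brk G y ^^ n) (scl G c x) = scl G c ((brk G y ^^ n) x)" "(brk G y ^^ n) 0 = 0"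
  by (induction n) (simp_all add: brk_add_right brk_scl_right)

lemma ad_pow_zero_mono: "(brk G y ^^ n) x = 0 \<Longrightarrow> n \<le> m \<Longrightarrow> (brk G y ^^ m) x = 0"
  by (metis ad_pow_linear(3) funpow_add le_add_diff_inverse2 o_apply)

text \<open>Otherwise \<open>\<beta> + n \<alpha>\<close> would be a weight for every \<open>n\<close>.\<close>

lemma ad_root_vector_nilpotent:
  assumes \<alpha>: "\<alpha> \<in> roots G" and y: "y \<in> root_space G \<alpha>"
  shows "\<exists>n. (brk G y ^^ n) x = 0"
proof -
  have *: "\<exists>n. (brk G y ^^ n) z = 0" if z: "z \<in> root_space G \<beta>" and \<beta>: "\<beta> \<in> hstar G" for z \<beta>
  proof (rule ccontr)
    assume "\<not> ?thesis"
    then have nz: "(brk G y ^^ n) z \<noteq> 0" for n by blast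
    let ?F = "\<lambda>n::nat. \<beta> + (\<lambda>H. of_nat n * \<alpha> H)"
    have "?F n \<in> insert 0 (roots G)" for n
      using rootI[OF _ _ ad_pow_space[OF y z, of n] nz] hstar_add[OF \<beta> hstar_scale[OF rootD(1)[OF \<alpha>]]] by blast
    then have "range ?F \<subseteq> insert 0 (roots G)" by blast
    then have "finite (range ?F)"
      using finite_roots finite_subset by blast
    moreover have "inj ?F"
    proof (rule injI)
      fix m n assume eq: "?F m = ?F n"
      obtain H where "\<alpha> H \<noteq> 0" using rootD(2)[OF \<alpha>] by (auto simp: fun_eq_iff)
      with fun_cong[OF eq, of H] show "m = n" by simp
    qed
    ultimately show False
      using range_inj_infinite by blast
  qed
  have "x \<in> {x. \<exists>n. (brk G y ^^ n) x = 0}"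
  proof (rule span_decomposition_induct)
    show "subspace {x. \<exists>n. (brk G y ^^ n) x = 0}"
    proof (rule subspaceI)
      fix u w assume "u \<in> {x. \<exists>n. (brk G y ^^ n) x = 0}" "w \<in> {x. \<exists>n. (brk G y ^^ n) x = 0}"
      then obtain m n where "(brk G y ^^ m) u = 0" "(brk G y ^^ n) w = 0" by blast
      then have "(brk G y ^^ max m n) (u + w) = 0"
        using ad_pow_zero_mono[of m y u "max m n"] ad_pow_zero_mono[of n y w "max m n"]
        by (simp add: ad_pow_linear)
      then show "u + w \<in> {x. \<exists>n. (brk G y ^^ n) x = 0}" by blast
    qed (auto simp: ad_pow_linear)
  qed (use * rootD(1) *[OF _ hstar_zero, unfolded root_space_zero] in auto)
  then show ?thesis by simp
qed

lemma sl2: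
  assumes \<alpha>: "\<alpha> \<in> pos_roots G"
  shows "sl2_weights (scl G) (brk G (xplus G \<alpha>)) (brk G (xminus G \<alpha>)) {0}
    (\<lambda>c. {x. brk G (coroot G \<alpha>) x = scl G c x})"
proof unfold_locales
  note rv = root_vectors[OF \<alpha>] and H = coroot_cartan[OF pos_rootD[OF \<alpha>]]
  have e: "brk G (coroot G \<alpha>) (xplus G \<alpha>) = scl G 2 (xplus G \<alpha>)"
    and f: "brk G (coroot G \<alpha>) (xminus G \<alpha>) = scl G (- 2) (xminus G \<alpha>)"
    using rv(1,3) H root_coroot_self[OF pos_rootD[OF \<alpha>]] by (auto simp: root_space_def)
  show "brk G (xplus G \<alpha>) u \<in> {x. brk G (coroot G \<alpha>) x = scl G (c + 2) x}"
    if "u \<in> {x. brk G (coroot G \<alpha>) x = scl G c x}" for u c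
    using that jacobi[of "coroot G \<alpha>" "xplus G \<alpha>" u]
    by (simp add: e brk_scl_left brk_scl_right scale_left_distrib add.commute)
  show "brk G (xminus G \<alpha>) u \<in> {x. brk G (coroot G \<alpha>) x = scl G (c - 2) x}"
    if "u \<in> {x. brk G (coroot G \<alpha>) x = scl G c x}" for u c
    using that jacobi[of "coroot G \<alpha>" "xminus G \<alpha>" u]
    by (simp add: f brk_minus_left brk_scl_left brk_scl_right scale_left_diff_distrib)
  show "brk G (xplus G \<alpha>) (brk G (xminus G \<alpha>) u) - brk G (xminus G \<alpha>) (brk G (xplus G \<alpha>) u) = scl G c u"
    if "u \<in> {x. brk G (coroot G \<alpha>) x = scl G c x}" for u c
    using that jacobi[of "xplus G \<alpha>" "xminus G \<alpha>" u] by (simp add: rv(5))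
qed (auto simp: brk_add_right brk_scl_right subspace_def)

lemma coroot_weight:
  assumes "\<alpha> \<in> pos_roots G" "x \<in> root_space G \<beta>"
  shows "x \<in> {x. brk G (coroot G \<alpha>) x = scl G (\<beta> (coroot G \<alpha>)) x}"
  using assms coroot_cartan pos_rootD by (auto simp: root_space_def)

lemma xplus_nilpotent: "\<alpha> \<in> pos_roots G \<Longrightarrow> \<exists>n. (brk G (xplus G \<alpha>) ^^ n) x = 0"
  and xminus_nilpotent: "\<alpha> \<in> pos_roots G \<Longrightarrow> \<exists>n. (brk G (xminus G \<alpha>) ^^ n) x = 0"
  using ad_root_vector_nilpotent pos_rootD uminus_root root_vectors by meson+

lemma cartan_integer:
  assumes \<alpha>: "\<alpha> \<in> pos_roots G" and "x \<in> root_space G \<beta>" "x \<noteq> 0"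
  obtains z :: int where "\<beta> (coroot G \<alpha>) = of_int z"
proof -
  interpret sl2_weights "scl G" "brk G (xplus G \<alpha>)" "brk G (xminus G \<alpha>)" "{0}"
    "\<lambda>c. {x. brk G (coroot G \<alpha>) x = scl G c x}" by (rule sl2[OF \<alpha>])
  obtain r where "(brk G (xplus G \<alpha>) ^^ r) x = 0" using xplus_nilpotent[OF \<alpha>] by blast
  then have "\<beta> (coroot G \<alpha>) \<in> \<int>"
    using weight_integral[OF coroot_weight[OF assms(1,2)], of r] assms(3) xminus_nilpotent[OF \<alpha>] by auto
  with that show ?thesis by (auto elim: Ints_cases)
qed

lemma root_integer:
  assumes "\<alpha> \<in> pos_roots G" "\<beta> \<in> roots G"
  obtains z :: int where "\<beta> (coroot G \<alpha>) = of_int z"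
  using rootD(3)[OF assms(2)] cartan_integer[OF assms(1)] by blast

lemma lower_nonzero:
  assumes \<alpha>: "\<alpha> \<in> pos_roots G" and x: "x \<in> root_space G \<beta>" "x \<noteq> 0"
    and c: "\<beta> (coroot G \<alpha>) = of_nat c" and n: "n \<le> c"
  shows "(brk G (xminus G \<alpha>) ^^ n) x \<noteq> 0"
proof
  interpret sl2_weights "scl G" "brk G (xplus G \<alpha>)" "brk G (xminus G \<alpha>)" "{0}"
    "\<lambda>c. {x. brk G (coroot G \<alpha>) x = scl G c x}" by (rule sl2[OF \<alpha>])
  assume "(brk G (xminus G \<alpha>) ^^ n) x = 0"
  then have "(brk G (xminus G \<alpha>) ^^ c) x = 0"
    using n by (rule ad_pow_zero_mono)
  moreover obtain r where "(brk G (xplus G \<alpha>) ^^ r) x = 0" using xplus_nilpotent[OF \<alpha>] by blast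
  ultimately show False
    using f_pow_injective[of x c r] coroot_weight[OF \<alpha> x(1)] x(2) c by simp
qed

lemma raise_nonzero:
  assumes \<alpha>: "\<alpha> \<in> pos_roots G" and x: "x \<in> root_space G \<beta>" "x \<noteq> 0"
    and c: "\<beta> (coroot G \<alpha>) = - of_nat c" and n: "n \<le> c"
  shows "(brk G (xplus G \<alpha>) ^^ n) x \<noteq> 0"
proof
  interpret s: sl2_weights "scl G" "brk G (xplus G \<alpha>)" "brk G (xminus G \<alpha>)" "{0}"
    "\<lambda>c. {x. brk G (coroot G \<alpha>) x = scl G c x}" by (rule sl2[OF \<alpha>])
  interpret sl2_weights "scl G" "brk G (xminus G \<alpha>)" "brk G (xplus G \<alpha>)" "{0}"
    "\<lambda>c. {x. brk G (coroot G \<alpha>) x = scl G (- c) x}" by (rule s.dual)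
  assume "(brk G (xplus G \<alpha>) ^^ n) x = 0"
  then have "(brk G (xplus G \<alpha>) ^^ c) x = 0"
    using n by (rule ad_pow_zero_mono)
  moreover obtain r where "(brk G (xminus G \<alpha>) ^^ r) x = 0" using xminus_nilpotent[OF \<alpha>] by blast
  ultimately show False
    using f_pow_injective[of x c r] coroot_weight[OF \<alpha> x(1)] x(2) c by simp
qed

text \<open>Subtracting a multiple of \<open>x\<^sup>+\<^sub>\<alpha>\<close> from a root vector of weight \<open>\<alpha>\<close> gives a vector killed by
  \<open>x\<^sup>-\<^sub>\<alpha>\<close>; it would be a lowest weight vector of positive weight.\<close>

lemma root_space_one_dim:
  assumes \<alpha>: "\<alpha> \<in> pos_roots G"
  shows "x \<in> root_space G \<alpha> \<Longrightarrow> \<exists>c. x = scl G c (xplus G \<alpha>)"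
    and "x \<in> root_space G (- \<alpha>) \<Longrightarrow> \<exists>c. x = scl G c (xminus G \<alpha>)"
proof -
  interpret s: sl2_weights "scl G" "brk G (xplus G \<alpha>)" "brk G (xminus G \<alpha>)" "{0}"
    "\<lambda>c. {x. brk G (coroot G \<alpha>) x = scl G c x}" by (rule sl2[OF \<alpha>])
  interpret d: sl2_weights "scl G" "brk G (xminus G \<alpha>)" "brk G (xplus G \<alpha>)" "{0}"
    "\<lambda>c. {x. brk G (coroot G \<alpha>) x = scl G (- c) x}" by (rule s.dual)
  note rv = root_vectors[OF \<alpha>] and R = pos_rootD[OF \<alpha>]
  define a where "a = iform G (xplus G \<alpha>) (xminus G \<alpha>)"
  have co: "coroot G \<alpha> = scl G a (rep_elt G \<alpha>)"
    using rep_root(3)[OF R rv(1,3)] rv(5) by (simp add: a_def)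
  have "coroot G \<alpha> \<noteq> 0"
    using root_coroot_self[OF R] hstar_homogeneous[OF rootD(1)[OF R] subspace_0[OF cartan_subspace], of 0] by auto
  then have a: "a \<noteq> 0" using co by auto
  show "\<exists>c. x = scl G c (xplus G \<alpha>)" if x: "x \<in> root_space G \<alpha>" for x
  proof -
    define c where "c = iform G x (xminus G \<alpha>) / a"
    define y where "y = x - scl G c (xplus G \<alpha>)"
    have y: "y \<in> root_space G \<alpha>"
      using x rv(1) subspace_diff subspace_scale root_space_subspace by (metis y_def)
    have "brk G y (xminus G \<alpha>) = 0"
      using rep_root(3)[OF R y rv(3)] a
      by (simp add: y_def form_diff_left form_scl_left c_def a_def[symmetric])
    then have "brk G (xminus G \<alpha>) y = 0" using brk_anti[of y] by simp
    moreover obtain n where "(brk G (xplus G \<alpha>) ^^ n) y = 0" using xplus_nilpotent[OF \<alpha>] by blast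
    ultimately have "y = 0"
      using d.highest_weight_natural[of y "- 2" n] coroot_weight[OF \<alpha> y] root_coroot_self[OF R]
        of_nat_neq_minus_Suc[of 1, THEN not_sym] by auto
    then show ?thesis by (auto simp: y_def)
  qed
  show "\<exists>c. x = scl G c (xminus G \<alpha>)" if x: "x \<in> root_space G (- \<alpha>)" for x
  proof -
    define c where "c = iform G (xplus G \<alpha>) x / a"
    define y where "y = x - scl G c (xminus G \<alpha>)"
    have y: "y \<in> root_space G (- \<alpha>)"
      using x rv(3) subspace_diff subspace_scale root_space_subspace by (metis y_def)
    have "iform G (xplus G \<alpha>) y = 0"
      using a form_diff_left[of x "scl G c (xminus G \<alpha>)" "xplus G \<alpha>"]
      by (simp add: y_def form_sym[of "xplus G \<alpha>"] form_scl_left c_def a_def)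
    then have "brk G (xplus G \<alpha>) y = 0"
      using rep_root(3)[OF R rv(1) y] by simp
    moreover obtain n where "(brk G (xminus G \<alpha>) ^^ n) y = 0" using xminus_nilpotent[OF \<alpha>] by blast
    ultimately have "y = 0"
      using s.highest_weight_natural[of y "- 2" n] coroot_weight[OF \<alpha> y] root_coroot_self[OF R]
        of_nat_neq_minus_Suc[of 1, THEN not_sym] by auto
    then show ?thesis by (auto simp: y_def)
  qed
qed

subsection \<open>Reflections and heights\<close>

definition refl :: "('g \<Rightarrow> complex) \<Rightarrow> ('g \<Rightarrow> complex) \<Rightarrow> 'g \<Rightarrow> complex" where
  "refl \<alpha> \<beta> = \<beta> - (\<lambda>x. \<beta> (coroot G \<alpha>) * \<alpha> x)"

lemma refl_hstar: "\<alpha> \<in> roots G \<Longrightarrow> \<beta> \<in> hstar G \<Longrightarrow> refl \<alpha> \<beta> \<in> hstar G"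
  unfolding refl_def by (intro hstar_diff hstar_scale) (simp_all add: rootD(1))

lemma refl_coroot: "\<alpha> \<in> roots G \<Longrightarrow> refl \<alpha> \<beta> (coroot G \<alpha>) = - \<beta> (coroot G \<alpha>)"
  by (simp add: refl_def root_coroot_self)

lemma refl_refl: "\<alpha> \<in> roots G \<Longrightarrow> refl \<alpha> (refl \<alpha> \<beta>) = \<beta>"
  by (simp add: refl_def root_coroot_self fun_eq_iff algebra_simps)

text \<open>The power of \<open>x\<^sup>-\<^sub>\<alpha>\<close> or \<open>x\<^sup>+\<^sub>\<alpha>\<close> that carries the weight \<open>\<beta>\<close> to its reflection is injective.\<close>

lemma refl_root:
  assumes \<alpha>: "\<alpha> \<in> pos_roots G" and \<beta>: "\<beta> \<in> roots G"
  shows "refl \<alpha> \<beta> \<in> roots G"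
proof -
  note R = pos_rootD[OF \<alpha>]
  obtain x where x: "x \<in> root_space G \<beta>" "x \<noteq> 0" using rootD(3)[OF \<beta>] by blast
  obtain z where z: "\<beta> (coroot G \<alpha>) = of_int z" using root_integer[OF \<alpha> \<beta>] .
  have "\<exists>y\<in>root_space G (refl \<alpha> \<beta>). y \<noteq> 0"
  proof (cases "z \<ge> 0")
    case True
    then have c: "\<beta> (coroot G \<alpha>) = of_nat (nat z)" using z by simp
    have "\<beta> + (\<lambda>H. of_nat (nat z) * (- \<alpha>) H) = refl \<alpha> \<beta>"
      unfolding refl_def c by (simp add: fun_eq_iff)
    then show ?thesis
      using lower_nonzero[OF \<alpha> x c order_refl] ad_pow_space[OF root_vectors(3)[OF \<alpha>] x(1), of "nat z"] by auto
  next
    case False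
    then have c: "\<beta> (coroot G \<alpha>) = - of_nat (nat (- z))" using z by simp
    have "\<beta> + (\<lambda>H. of_nat (nat (- z)) * \<alpha> H) = refl \<alpha> \<beta>"
      unfolding refl_def c by (simp add: fun_eq_iff)
    then show ?thesis
      using raise_nonzero[OF \<alpha> x c order_refl] ad_pow_space[OF root_vectors(1)[OF \<alpha>] x(1), of "nat (- z)"] by auto
  qed
  moreover have "refl \<alpha> \<beta> \<noteq> 0"
  proof
    assume 0: "refl \<alpha> \<beta> = 0"
    then have "\<beta> (coroot G \<alpha>) = 0"
      using refl_coroot[OF R, of \<beta>] by simp
    with 0 have "\<beta> = 0" by (simp add: refl_def fun_eq_iff)
    with rootD(2)[OF \<beta>] show False by simp
  qed
  ultimately show ?thesis
    using rootI refl_hstar[OF R rootD(1)[OF \<beta>]] by blast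
qed

lemma wform_refl:
  assumes "\<alpha> \<in> roots G" "\<beta> \<in> hstar G" "\<gamma> \<in> hstar G"
  shows "wform G (refl \<alpha> \<beta>) (refl \<alpha> \<gamma>) = wform G \<beta> \<gamma>"
proof -
  have *: "wform G (refl \<alpha> \<beta>) \<nu> = wform G \<beta> \<nu> - \<beta> (coroot G \<alpha>) * wform G \<alpha> \<nu>"
    if "\<beta> \<in> hstar G" "\<nu> \<in> hstar G" for \<beta> \<nu>
    using assms(1) that unfolding refl_def by (simp add: wform_diff_left wform_scale_left hstar_scale rootD(1))
  note h = assms(2,3) rootD(1)[OF assms(1)] refl_hstar[OF assms(1,3)]
  have "wform G (refl \<alpha> \<beta>) (refl \<alpha> \<gamma>) = wform G \<beta> (refl \<alpha> \<gamma>) - \<beta> (coroot G \<alpha>) * wform G \<alpha> (refl \<alpha> \<gamma>)"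
    by (rule *) fact+
  also have "wform G \<beta> (refl \<alpha> \<gamma>) = wform G \<gamma> \<beta> - \<gamma> (coroot G \<alpha>) * wform G \<alpha> \<beta>"
    using *[OF h(2,1)] wform_sym[of \<beta> "refl \<alpha> \<gamma>"] by metis
  also have "wform G \<alpha> (refl \<alpha> \<gamma>) = wform G \<gamma> \<alpha> - \<gamma> (coroot G \<alpha>) * wform G \<alpha> \<alpha>"
    using *[OF h(2,3)] wform_sym[of \<alpha> "refl \<alpha> \<gamma>"] by metis
  finally have "wform G (refl \<alpha> \<beta>) (refl \<alpha> \<gamma>) = wform G \<gamma> \<beta> - \<gamma> (coroot G \<alpha>) * wform G \<alpha> \<beta>
      - \<beta> (coroot G \<alpha>) * (wform G \<gamma> \<alpha> - \<gamma> (coroot G \<alpha>) * wform G \<alpha> \<alpha>)" .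
  moreover have "wform G \<gamma> \<alpha> = \<gamma> (coroot G \<alpha>) * wform G \<alpha> \<alpha> / 2" "wform G \<beta> \<alpha> = \<beta> (coroot G \<alpha>) * wform G \<alpha> \<alpha> / 2"
    using h norm_root_nz[OF assms(1)] assms(1) by (simp_all add: eval_coroot_wform dnum_def)
  ultimately show ?thesis
    unfolding wform_sym[of \<alpha> \<beta>] wform_sym[of \<beta> \<gamma>] by (simp add: algebra_simps)
qed

text \<open>Evaluating a weight at these elements reads off its coefficient at a simple root and its height, without a
  choice of an expansion into simple roots.  On the root lattice the values are real; taking real parts makes them comparable.\<close>

definition coweight :: "nat \<Rightarrow> 'g" where
  "coweight j = (SOME H. H \<in> cartan G \<and> (\<forall>i\<in>{1..rank G}. sroot G i H = (if i = j then 1 else 0)))"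

definition height_elt :: 'g where
  "height_elt = (SOME H. H \<in> cartan G \<and> (\<forall>i\<in>{1..rank G}. sroot G i H = 1))"

definition height :: "('g \<Rightarrow> complex) \<Rightarrow> real" where "height \<beta> = Re (\<beta> height_elt)"

definition coef :: "('g \<Rightarrow> complex) \<Rightarrow> nat \<Rightarrow> real" where "coef \<beta> j = Re (\<beta> (coweight j))"

lemma coweight: "coweight j \<in> cartan G" "i \<in> {1..rank G} \<Longrightarrow> sroot G i (coweight j) = (if i = j then 1 else 0)"
  using someI_ex[OF exists_dual_element[of "\<lambda>i. if i = j then 1 else 0", unfolded Bex_def]]
  by (auto simp: coweight_def)

lemma height_elt: "height_elt \<in> cartan G" "i \<in> {1..rank G} \<Longrightarrow> sroot G i height_elt = 1"
  using someI_ex[OF exists_dual_element[of "\<lambda>i. 1", unfolded Bex_def]]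
  by (auto simp: height_elt_def)

lemma height_simps [simp]: "height (\<alpha> + \<beta>) = height \<alpha> + height \<beta>" "height (\<alpha> - \<beta>) = height \<alpha> - height \<beta>"
  "height (- \<alpha>) = - height \<alpha>" "height 0 = 0"
  by (simp_all add: height_def)

lemma coef_simps [simp]: "coef (\<alpha> + \<beta>) j = coef \<alpha> j + coef \<beta> j" "coef (\<alpha> - \<beta>) j = coef \<alpha> j - coef \<beta> j"
  "coef (- \<alpha>) j = - coef \<alpha> j" "coef 0 j = 0"
  by (simp_all add: coef_def)

lemma coef_simple: "i \<in> {1..rank G} \<Longrightarrow> coef (sroot G i) j = (if i = j then 1 else 0)"
  by (simp add: coef_def coweight)

lemma height_simple: "i \<in> {1..rank G} \<Longrightarrow> height (sroot G i) = 1"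
  by (simp add: height_def height_elt)

lemma nat_comb_coef:
  assumes "\<beta> = (\<lambda>x. \<Sum>i=1..rank G. of_nat (c i) * sroot G i x)"
  shows "j \<in> {1..rank G} \<Longrightarrow> coef \<beta> j = real (c j)" "height \<beta> = real (\<Sum>i=1..rank G. c i)"
  by (simp_all add: assms coef_def height_def coweight height_elt if_distrib sum.delta cong: if_cong)

lemma pos_root_expansion:
  assumes "\<alpha> \<in> pos_roots G"
  obtains c :: "nat \<Rightarrow> nat" where "\<alpha> = (\<lambda>x. \<Sum>i=1..rank G. of_nat (c i) * sroot G i x)"
    "\<forall>j\<in>{1..rank G}. coef \<alpha> j = real (c j)" "height \<alpha> = real (\<Sum>i=1..rank G. c i)"
    "(\<Sum>i=1..rank G. c i) \<noteq> 0"
proof -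
  obtain c where c: "\<alpha> = (\<lambda>x. \<Sum>i=1..rank G. of_nat (c i) * sroot G i x)"
    using assms by (auto simp: pos_roots_def)
  have "(\<Sum>i=1..rank G. c i) \<noteq> 0"
  proof
    assume "(\<Sum>i=1..rank G. c i) = 0"
    then have "\<alpha> = 0" by (simp add: c fun_eq_iff)
    with rootD(2) pos_rootD[OF assms] show False by blast
  qed
  with that[OF c] nat_comb_coef[OF c] show ?thesis by blast
qed

lemma height_pos:
  assumes "\<alpha> \<in> pos_roots G"
  shows "height \<alpha> \<ge> 1"
proof -
  obtain c :: "nat \<Rightarrow> nat" where c: "height \<alpha> = real (\<Sum>i=1..rank G. c i)" "(\<Sum>i=1..rank G. c i) \<noteq> 0"
    using pos_root_expansion[OF assms] by metis
  then have "1 \<le> (\<Sum>i=1..rank G. c i)" by linarith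
  then show ?thesis unfolding c(1) by (rule order_trans[rotated, OF of_nat_mono]) simp
qed

lemma coef_nonneg:
  assumes "\<alpha> \<in> pos_roots G" "j \<in> {1..rank G}"
  shows "coef \<alpha> j \<ge> 0"
proof -
  obtain c :: "nat \<Rightarrow> nat" where "\<forall>j\<in>{1..rank G}. coef \<alpha> j = real (c j)"
    using pos_root_expansion[OF assms(1)] by metis
  with assms(2) show ?thesis by simp
qed

lemma pos_iff_height: "\<beta> \<in> roots G \<Longrightarrow> \<beta> \<in> pos_roots G \<longleftrightarrow> height \<beta> > 0"
  using pos_or_neg[of \<beta>] height_pos[of \<beta>] height_pos[of "- \<beta>"] by auto

lemma pos_root_add: "\<alpha> \<in> pos_roots G \<Longrightarrow> \<beta> \<in> pos_roots G \<Longrightarrow> \<alpha> + \<beta> \<in> roots G \<Longrightarrow> \<alpha> + \<beta> \<in> pos_roots G"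
  using height_pos[of \<alpha>] height_pos[of \<beta>] by (simp add: pos_iff_height)

lemma pos_if_coef: "\<beta> \<in> roots G \<Longrightarrow> j \<in> {1..rank G} \<Longrightarrow> coef \<beta> j > 0 \<Longrightarrow> \<beta> \<in> pos_roots G"
  using pos_or_neg[of \<beta>] coef_nonneg[of "- \<beta>" j] by auto

text \<open>Integrality of the pairing of \<open>\<alpha>\<close> with the coroot of \<open>n \<alpha>\<close> leaves \<open>n = 2\<close>.  For \<open>z\<close> of weight \<open>2 \<alpha>\<close> both \<open>x\<^sup>+\<^sub>\<alpha> z\<close>
  and \<open>x\<^sup>+\<^sub>\<alpha> x\<^sup>-\<^sub>\<alpha> z\<close> vanish, the first because \<open>3 \<alpha>\<close> is not a root, the second because \<open>x\<^sup>-\<^sub>\<alpha> z\<close> is a multiple of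
  \<open>x\<^sup>+\<^sub>\<alpha>\<close>.  Hence \<open>[x\<^sup>+\<^sub>\<alpha>, x\<^sup>-\<^sub>\<alpha>] z = \<alpha>\<^sup>\<or> z = 4 z\<close> vanishes.\<close>

lemma double_root:
  assumes \<alpha>: "\<alpha> \<in> pos_roots G" and n: "n \<ge> (2::nat)"
  shows "(\<lambda>x. of_nat n * \<alpha> x) \<notin> roots G"
proof
  note R = pos_rootD[OF \<alpha>]
  have mult: "n \<le> 2" if "(\<lambda>x. of_nat n * \<alpha> x) \<in> roots G" "n \<ge> 1" for n :: nat
  proof -
    let ?\<beta> = "\<lambda>x. of_nat n * \<alpha> x"
    have "height ?\<beta> > 0" using height_pos[OF \<alpha>] that(2) by (simp add: height_def)
    then have pos: "?\<beta> \<in> pos_roots G" using pos_iff_height[OF that(1)] by simp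
    obtain z where z: "\<alpha> (coroot G ?\<beta>) = of_int z" using root_integer[OF pos R] .
    have "of_nat n * \<alpha> (coroot G ?\<beta>) = 2"
      using root_coroot_self[OF that(1)] by simp
    then have "of_int (int n * z) = (of_int 2 :: complex)" using z by simp
    then have "int n * z = 2" by (simp only: of_int_eq_iff)
    then have "int n dvd 2" by (metis dvd_triv_left)
    then show ?thesis by (auto dest: zdvd_imp_le)
  qed
  assume nr: "(\<lambda>x. of_nat n * \<alpha> x) \<in> roots G"
  with mult[OF nr] n have n2: "n = 2" by simp
  let ?\<beta> = "\<lambda>x. 2 * \<alpha> x"
  have \<beta>: "?\<beta> \<in> roots G" using nr n2 by simp
  obtain z where z: "z \<in> root_space G ?\<beta>" "z \<noteq> 0" using rootD(3)[OF \<beta>] by blast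
  note rv = root_vectors[OF \<alpha>]
  have "\<alpha> + ?\<beta> = (\<lambda>x. of_nat 3 * \<alpha> x)" by (simp add: fun_eq_iff)
  moreover have "(\<lambda>x. of_nat 3 * \<alpha> x) \<notin> roots G" using mult[of 3] by auto
  moreover have "(\<lambda>x. of_nat 3 * \<alpha> x) \<noteq> 0" using rootD(2)[OF R] by (auto simp: fun_eq_iff)
  ultimately have ez: "brk G (xplus G \<alpha>) z = 0"
    using root_space_brk[OF rv(1) z(1)] not_root_imp_zero hstar_scale[OF rootD(1)[OF R]] by metis
  have "- \<alpha> + ?\<beta> = \<alpha>" by (simp add: fun_eq_iff)
  then obtain c where c: "brk G (xminus G \<alpha>) z = scl G c (xplus G \<alpha>)"
    using root_space_one_dim(1)[OF \<alpha>] root_space_brk[OF rv(3) z(1)] by metis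
  have "brk G (xplus G \<alpha>) (brk G (xminus G \<alpha>) z) = brk G (coroot G \<alpha>) z"
    using jacobi[of "xplus G \<alpha>" "xminus G \<alpha>" z] ez rv(5) by simp
  also have "\<dots> = scl G 4 z"
    using coroot_weight[OF \<alpha> z(1)] root_coroot_self[OF R] by simp
  finally show False
    using z(2) by (simp add: c brk_scl_right)
qed

lemma other_coef:
  assumes \<alpha>: "\<alpha> \<in> pos_roots G" and i: "i \<in> {1..rank G}" and ne: "\<alpha> \<noteq> sroot G i"
  obtains j where "j \<in> {1..rank G}" "j \<noteq> i" "coef \<alpha> j > 0"
proof -
  have "\<exists>j. j \<in> {1..rank G} \<and> j \<noteq> i \<and> coef \<alpha> j > 0"
  proof (rule ccontr)
  assume neg: "\<not> (\<exists>j. j \<in> {1..rank G} \<and> j \<noteq> i \<and> coef \<alpha> j > 0)"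
  obtain c where c: "\<alpha> = (\<lambda>x. \<Sum>i=1..rank G. of_nat (c i) * sroot G i x)"
    "\<forall>j\<in>{1..rank G}. coef \<alpha> j = real (c j)" "height \<alpha> = real (\<Sum>i=1..rank G. c i)"
    "(\<Sum>i=1..rank G. c i) \<noteq> 0"
    by (rule pos_root_expansion[OF \<alpha>])
  have 0: "c j = 0" if "j \<in> {1..rank G}" "j \<noteq> i" for j
    using neg c(2) that by (cases "c j = 0") auto
  have "(\<Sum>j=1..rank G. of_nat (c j) * sroot G j x) = of_nat (c i) * sroot G i x" for x
    using i 0 by (subst sum.remove[OF _ i]) auto
  then have \<alpha>i: "\<alpha> = (\<lambda>x. of_nat (c i) * sroot G i x)" using c(1) by (simp add: fun_eq_iff)
  have "(\<Sum>j=1..rank G. c j) = c i"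
    using i 0 by (subst sum.remove[OF _ i]) auto
  with c(4) have "c i \<noteq> 0" by metis
  moreover have "c i \<noteq> 1" using \<alpha>i ne by auto
  ultimately have "c i \<ge> 2" by simp
  with double_root[OF simple_pos[OF i]] \<alpha>i pos_rootD[OF \<alpha>] show False by auto
  qed
  with that show thesis by blast
qed

text \<open>The reflection leaves the coefficients at the other simple roots unchanged, and one of them is positive.\<close>

lemma refl_simple_pos:
  assumes \<alpha>: "\<alpha> \<in> pos_roots G" and i: "i \<in> {1..rank G}" and ne: "\<alpha> \<noteq> sroot G i"
  shows "refl (sroot G i) \<alpha> \<in> pos_roots G"
proof -
  obtain j where j: "j \<in> {1..rank G}" "j \<noteq> i" "coef \<alpha> j > 0" using other_coef[OF assms] .
  have "coef (refl (sroot G i) \<alpha>) j = coef \<alpha> j"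
    using j i by (simp add: refl_def coef_def coweight)
  with j show ?thesis
    using pos_if_coef[OF refl_root[OF simple_pos[OF i] pos_rootD[OF \<alpha>]], of j] by simp
qed

lemma diff_simple_pos:
  assumes \<alpha>: "\<alpha> \<in> pos_roots G" and i: "i \<in> {1..rank G}" and ne: "\<alpha> \<noteq> sroot G i" and "\<alpha> - sroot G i \<in> roots G"
  shows "\<alpha> - sroot G i \<in> pos_roots G"
proof -
  obtain j where j: "j \<in> {1..rank G}" "j \<noteq> i" "coef \<alpha> j > 0" using other_coef[OF assms(1-3)] .
  then show ?thesis
    using pos_if_coef[OF assms(4), of j] i by (simp add: coef_simple)
qed

lemma wform_real_coroot:
  assumes "\<beta> \<in> hstar G" "\<alpha> \<in> roots G"
  obtains r where "r > 0" "wform G \<beta> \<alpha> = of_real r * \<beta> (coroot G \<alpha>)"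
proof -
  obtain r where r: "wform G \<alpha> \<alpha> = of_real r" "0 < r" using norm_root[OF assms(2)] .
  with that[of "r / 2"] show ?thesis
    by (simp add: eval_coroot_wform assms dnum_def)
qed

text \<open>Expanding one argument, \<open>(\<alpha>|\<alpha>) > 0\<close> is a nonnegative combination of the \<open>(\<alpha>\<^sub>i|\<alpha>)\<close>.\<close>

lemma exists_positive_pairing:
  assumes \<alpha>: "\<alpha> \<in> pos_roots G"
  obtains i c where "i \<in> {1..rank G}" "\<alpha> (coroot G (sroot G i)) = of_nat (Suc c)"
proof -
  have "\<exists>i c. i \<in> {1..rank G} \<and> \<alpha> (coroot G (sroot G i)) = of_nat (Suc c)"
  proof (rule ccontr)
  assume neg: "\<not> (\<exists>i c. i \<in> {1..rank G} \<and> \<alpha> (coroot G (sroot G i)) = of_nat (Suc c))"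
  note R = pos_rootD[OF \<alpha>]
  obtain c where c: "\<alpha> = (\<lambda>x. \<Sum>i=1..rank G. of_nat (c i) * sroot G i x)"
    by (rule pos_root_expansion[OF \<alpha>])
  have "Re (wform G \<alpha> (sroot G i)) \<le> 0" if i: "i \<in> {1..rank G}" for i
  proof -
    obtain z where z: "\<alpha> (coroot G (sroot G i)) = of_int z"
      using root_integer[OF simple_pos[OF i] R] .
    have "z \<le> 0"
    proof (rule ccontr)
      assume "\<not> z \<le> 0"
      then have "of_int z = (of_nat (Suc (nat (z - 1))) :: complex)" by simp
      with z have "\<alpha> (coroot G (sroot G i)) = of_nat (Suc (nat (z - 1)))" by simp
      with neg that i show False by blast
    qed
    moreover obtain r where "r > 0" "wform G \<alpha> (sroot G i) = of_real r * \<alpha> (coroot G (sroot G i))"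
      using wform_real_coroot[OF rootD(1)[OF R] simple_root[OF i]] .
    ultimately show ?thesis
      using z by (simp add: mult_nonneg_nonpos)
  qed
  then have "(\<Sum>i=1..rank G. real (c i) * Re (wform G \<alpha> (sroot G i))) \<le> 0"
    by (intro sum_nonpos mult_nonneg_nonpos) auto
  moreover have "wform G \<alpha> \<alpha> = (\<Sum>i=1..rank G. of_nat (c i) * wform G (sroot G i) \<alpha>)"
    using wform_sum_left[of "{1..rank G}" "sroot G" \<alpha> "\<lambda>i. of_nat (c i)"] rootD(1) R simple_root
    unfolding c(1)[symmetric] by blast
  moreover have "Re (\<Sum>i=1..rank G. of_nat (c i) * wform G (sroot G i) \<alpha>) =
      (\<Sum>i=1..rank G. real (c i) * Re (wform G \<alpha> (sroot G i)))"
    unfolding wform_sym[of "sroot G i" \<alpha> for i] by simp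
  ultimately have "Re (wform G \<alpha> \<alpha>) \<le> 0"
    by simp
  moreover have "Re (wform G \<alpha> \<alpha>) > 0"
    by (rule norm_root[OF R]) simp
  ultimately show False by simp
  qed
  with that show thesis by blast
qed

text \<open>A positive root \<open>\<alpha>\<close> pairs positively with some simple root; reflecting there lowers the height, and gives a positive
  root unless \<open>\<alpha>\<close> is that simple root.\<close>

lemma pos_root_induct [consumes 1, case_names simple refl]:
  assumes "\<alpha> \<in> pos_roots G"
    and simple: "\<And>i. i \<in> {1..rank G} \<Longrightarrow> P (sroot G i)"
    and step: "\<And>i \<alpha> c. i \<in> {1..rank G} \<Longrightarrow> \<alpha> \<in> pos_roots G \<Longrightarrow> \<alpha> \<noteq> sroot G i \<Longrightarrow>
      \<alpha> (coroot G (sroot G i)) = of_nat (Suc c) \<Longrightarrow> refl (sroot G i) \<alpha> \<in> pos_roots G \<Longrightarrow>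
      (\<And>\<gamma>. \<gamma> \<in> pos_roots G \<Longrightarrow> height \<gamma> < height \<alpha> \<Longrightarrow> P \<gamma>) \<Longrightarrow>
      P (refl (sroot G i) \<alpha>) \<Longrightarrow> P \<alpha>"
  shows "P \<alpha>"
  using assms(1)
proof (induction "nat \<lfloor>height \<alpha>\<rfloor>" arbitrary: \<alpha> rule: less_induct)
  case less
  have IH: "P \<gamma>" if \<gamma>: "\<gamma> \<in> pos_roots G" "height \<gamma> < height \<alpha>" for \<gamma>
  proof -
    obtain m where "height \<gamma> = real m" using pos_root_expansion[OF \<gamma>(1)] by metis
    moreover obtain n where "height \<alpha> = real n" using pos_root_expansion[OF less.prems] by metis
    ultimately have "nat \<lfloor>height \<gamma>\<rfloor> < nat \<lfloor>height \<alpha>\<rfloor>" using \<gamma>(2) by simp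
    then show ?thesis using less.hyps \<gamma>(1) by blast
  qed
  obtain i c where i: "i \<in> {1..rank G}" "\<alpha> (coroot G (sroot G i)) = of_nat (Suc c)"
    using exists_positive_pairing[OF less.prems] .
  show ?case
  proof (cases "\<alpha> = sroot G i")
    case True
    then show ?thesis using simple i by simp
  next
    case False
    have r: "refl (sroot G i) \<alpha> \<in> pos_roots G"
      by (rule refl_simple_pos[OF less.prems i(1) False])
    have "height (refl (sroot G i) \<alpha>) = height \<alpha> - real (Suc c)"
      using i(2) by (simp add: refl_def height_def height_elt(2)[OF i(1)])
    then have "P (refl (sroot G i) \<alpha>)" using IH[OF r] by simp
    with step[OF i(1) less.prems False i(2) r] IH show ?thesis by blast
  qed
qed

end

lemma finite_has_maximum:
  fixes f :: "'a \<Rightarrow> 'b::linorder"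
  assumes "finite S" "S \<noteq> {}"
  shows "\<exists>x\<in>S. \<forall>y\<in>S. f y \<le> f x"
proof -
  have "Max (f ` S) \<in> f ` S" using assms by (intro Max_in) auto
  then obtain x where "x \<in> S" "Max (f ` S) = f x" by blast
  then show ?thesis using assms(1) Max_ge[of "f ` S"] by (metis finite_imageI image_eqI)
qed

context simple_datum
begin

subsection \<open>The highest root\<close>

lemma roots_nonempty: "roots G \<noteq> {}"
proof
  assume "roots G = {}"
  then have "span (cartan G) = UNIV" using root_decomposition by simp
  then have "cartan G = UNIV" using cartan_subspace span_eq_iff by metis
  then have "brk G x y = 0" for x y using cartan_commute by blast
  with datum show False by (simp add: simple_lie_datum_def simple_lie_algebra_def)
qed

lemma ideal_UNIV:
  assumes "subspace J" "\<And>x y. y \<in> J \<Longrightarrow> brk G x y \<in> J" "y \<in> J" "y \<noteq> 0"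
  shows "J = UNIV"
  using assms datum unfolding simple_lie_datum_def simple_lie_algebra_def lie_ideal_def by blast

text \<open>The weights are recorded along with the vectors because a vanishing vector does not determine one.\<close>

inductive_set lowered :: "('g \<Rightarrow> complex) \<Rightarrow> 'g \<Rightarrow> ('g \<times> ('g \<Rightarrow> complex)) set"
  for \<theta> :: "'g \<Rightarrow> complex" and x :: 'g where
  start: "(x, \<theta>) \<in> lowered \<theta> x"
| lower: "(u, \<beta>) \<in> lowered \<theta> x \<Longrightarrow> \<alpha> \<in> pos_roots G \<Longrightarrow> y \<in> root_space G (- \<alpha>) \<Longrightarrow>
    (brk G y u, \<beta> - \<alpha>) \<in> lowered \<theta> x"

lemma nat_comb_add:
  assumes "\<beta> = (\<lambda>x. \<gamma> x + (\<Sum>i=1..rank G. of_nat (c i) * sroot G i x))" "\<alpha> \<in> pos_roots G"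
  shows "\<exists>c. \<beta> = (\<lambda>x. (\<gamma> - \<alpha>) x + (\<Sum>i=1..rank G. of_nat (c i) * sroot G i x))"
proof -
  obtain d where "\<alpha> = (\<lambda>x. \<Sum>i=1..rank G. of_nat (d i) * sroot G i x)"
    using assms(2) by (auto simp: pos_roots_def)
  then show ?thesis
    using assms(1) by (intro exI[of _ "\<lambda>i. c i + d i"]) (simp add: fun_eq_iff distrib_right sum.distrib)
qed

lemma lowered_weight:
  assumes "(u, \<beta>) \<in> lowered \<theta> x" "x \<in> root_space G \<theta>" "\<theta> \<in> hstar G"
  shows "u \<in> root_space G \<beta> \<and> \<beta> \<in> hstar G \<and>
    (\<exists>c::nat \<Rightarrow> nat. \<theta> = (\<lambda>x. \<beta> x + (\<Sum>i=1..rank G. of_nat (c i) * sroot G i x)))"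
  using assms(1)
proof induction
  case start
  show ?case using assms(2,3) by (auto intro!: exI[of _ "\<lambda>_. 0"])
next
  case (lower u \<beta> \<alpha> y)
  have "brk G y u \<in> root_space G (\<beta> - \<alpha>)"
    using root_space_brk[OF lower.hyps(3), of u \<beta>] lower.IH by simp
  moreover have "\<beta> - \<alpha> \<in> hstar G"
    using lower hstar_diff rootD(1) pos_rootD by blast
  ultimately show ?case
    using nat_comb_add[OF _ lower.hyps(2)] lower.IH by blast
qed

text \<open>The vectors lowered from a vector killed by all raising operators span an ideal, and \<open>\<gg>\<close> is simple.\<close>

lemma lowered_span:
  assumes x: "x \<in> root_space G \<theta>" "\<theta> \<in> hstar G" "x \<noteq> 0"
    and hw: "\<And>\<alpha> y. \<alpha> \<in> pos_roots G \<Longrightarrow> y \<in> root_space G \<alpha> \<Longrightarrow> brk G y x = 0"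
  shows "span (fst ` lowered \<theta> x) = UNIV"
proof (rule ideal_UNIV)
  let ?S = "span (fst ` lowered \<theta> x)"
  have low: "brk G y u \<in> ?S" if "u \<in> ?S" "\<alpha> \<in> pos_roots G" "y \<in> root_space G (- \<alpha>)" for u y \<alpha>
  proof -
    have "subspace {u. brk G y u \<in> ?S}"
      by (auto simp: subspace_def brk_add_right brk_scl_right span_add span_scale span_zero)
    moreover have "fst ` lowered \<theta> x \<subseteq> {u. brk G y u \<in> ?S}"
      using lowered.lower[OF _ that(2,3)] by (force intro: span_base)
    ultimately show ?thesis using that(1) span_minimal by blast
  qed
  have cart: "brk G H u \<in> ?S" if "(u, \<beta>) \<in> lowered \<theta> x" "H \<in> cartan G" for u \<beta> H
  proof -
    have "brk G H u = scl G (\<beta> H) u"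
      using lowered_weight[OF that(1) x(1,2)] that(2) by (simp add: root_space_def)
    moreover have "u \<in> ?S" using that(1) by (force intro: span_base)
    ultimately show ?thesis by (simp add: span_scale)
  qed
  have up: "\<forall>\<alpha> z. \<alpha> \<in> pos_roots G \<longrightarrow> z \<in> root_space G \<alpha> \<longrightarrow> brk G z u \<in> ?S" if "(u, \<beta>) \<in> lowered \<theta> x" for u \<beta>
    using that
  proof induction
    case start
    then show ?case using hw by (simp add: span_zero)
  next
    case (lower u \<beta> \<gamma> y)
    show ?case
    proof (intro allI impI)
      fix \<alpha> z assume \<alpha>: "\<alpha> \<in> pos_roots G" and z: "z \<in> root_space G \<alpha>"
      have zy: "brk G z y \<in> root_space G (\<alpha> - \<gamma>)"
        using root_space_brk[OF z lower.hyps(3)] by simp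
      have uS: "u \<in> ?S" using lower.hyps(1) by (force intro: span_base)
      have "brk G (brk G z y) u \<in> ?S"
      proof (cases "brk G z y = 0")
        case False
        have "\<alpha> - \<gamma> \<in> hstar G" using \<alpha> lower.hyps(2) hstar_diff rootD(1) pos_rootD by blast
        then have "\<alpha> - \<gamma> = 0 \<or> \<alpha> - \<gamma> \<in> roots G"
          using rootI[OF _ _ zy False] by blast
        then consider "\<alpha> - \<gamma> = 0" | "\<alpha> - \<gamma> \<in> pos_roots G" | "- (\<alpha> - \<gamma>) \<in> pos_roots G"
          using pos_or_neg by blast
        then show ?thesis
        proof cases
          case 1
          then have "brk G z y \<in> cartan G" using zy root_space_zero by simp
          then show ?thesis using cart[OF lower.hyps(1)] by blast
        next
          case 2
          then show ?thesis using lower.IH zy by blast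
        next
          case 3
          then show ?thesis using low[OF uS 3] zy by simp
        qed
      qed (simp add: span_zero)
      moreover have "brk G y (brk G z u) \<in> ?S"
        using low lower.IH lower.hyps(2,3) \<alpha> z by blast
      ultimately show "brk G z (brk G y u) \<in> ?S"
        unfolding jacobi[of z y u] by (rule span_add)
    qed
  qed
  show "brk G z w \<in> ?S" if w: "w \<in> ?S" for z w
  proof -
    have gen: "brk G z u \<in> ?S" if u: "(u, \<beta>) \<in> lowered \<theta> x" for u \<beta>
    proof -
      have "z \<in> {z. brk G z u \<in> ?S}"
      proof (rule span_decomposition_induct)
        show "subspace {z. brk G z u \<in> ?S}"
          by (auto simp: subspace_def brk_add_left brk_scl_left span_add span_scale span_zero)
        fix \<gamma> y assume \<gamma>: "\<gamma> \<in> roots G" and y: "y \<in> root_space G \<gamma>"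
        have "u \<in> ?S" using u by (force intro: span_base)
        then show "y \<in> {z. brk G z u \<in> ?S}"
          using pos_or_neg[OF \<gamma>] up[OF u] low[of u "- \<gamma>" y] y by auto
      qed (use cart u in auto)
      then show ?thesis by simp
    qed
    have "subspace {w. brk G z w \<in> ?S}"
      by (auto simp: subspace_def brk_add_right brk_scl_right span_add span_scale span_zero)
    moreover have "fst ` lowered \<theta> x \<subseteq> {w. brk G z w \<in> ?S}"
      using gen by force
    ultimately show ?thesis using w span_minimal by blast
  qed
  show "x \<in> ?S" by (force intro: span_base lowered.start)
qed (use assms in \<open>auto simp: subspace_span\<close>)

text \<open>By simplicity the lowered vectors span \<open>\<gg>\<close>.  If \<open>\<beta>\<close> is not the weight of any of them, a vector of weight
  \<open>- \<beta>\<close> is orthogonal to all of \<open>\<gg>\<close>.\<close>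

lemma weight_below_highest:
  assumes x: "x \<in> root_space G \<theta>" "\<theta> \<in> hstar G" "x \<noteq> 0"
    and hw: "\<And>\<alpha> y. \<alpha> \<in> pos_roots G \<Longrightarrow> y \<in> root_space G \<alpha> \<Longrightarrow> brk G y x = 0"
    and \<beta>: "\<beta> \<in> roots G"
  shows "\<exists>c::nat \<Rightarrow> nat. \<theta> = (\<lambda>x. \<beta> x + (\<Sum>i=1..rank G. of_nat (c i) * sroot G i x))"
proof (rule ccontr)
  assume neg: "\<not> ?thesis"
  obtain z where z: "z \<in> root_space G \<beta>" "z \<noteq> 0" using rootD(3)[OF \<beta>] by blast
  obtain y where y: "y \<in> root_space G (- \<beta>)" "iform G z y \<noteq> 0" using opposite_pairing[OF \<beta> z] by blast
  have "fst ` lowered \<theta> x \<subseteq> {u. iform G u y = 0}"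
  proof clarsimp
    fix u \<gamma> assume "(u, \<gamma>) \<in> lowered \<theta> x"
    then have u: "u \<in> root_space G \<gamma>" "\<gamma> \<in> hstar G" "\<gamma> \<noteq> \<beta>"
      using lowered_weight[OF _ x(1,2)] neg by blast+
    then have "\<exists>H\<in>cartan G. \<gamma> H \<noteq> \<beta> H"
      using hstar_eqI rootD(1)[OF \<beta>] by blast
    then show "iform G u y = 0"
      using form_orthogonal[OF u(1) y(1)] by auto
  qed
  then have "span (fst ` lowered \<theta> x) \<subseteq> {u. iform G u y = 0}"
    by (rule span_minimal) (auto simp: subspace_def form_add_left form_scl_left)
  with y(2) lowered_span[OF assms(1-4)] show False by auto
qed

text \<open>A root of maximal height qualifies, because all raising operators annihilate its root vectors.  Two such
  roots are each below the other, hence equal.\<close>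

lemma highest_root:
  shows "highest_root G \<in> roots G"
    and "\<And>\<beta>. \<beta> \<in> roots G \<Longrightarrow> \<exists>c::nat \<Rightarrow> nat. highest_root G = (\<lambda>x. \<beta> x + (\<Sum>i=1..rank G. of_nat (c i) * sroot G i x))"
proof -
  let ?P = "\<lambda>\<theta>. \<theta> \<in> roots G \<and> (\<forall>\<beta>\<in>roots G. \<exists>c::nat \<Rightarrow> nat.
    \<theta> = (\<lambda>x. \<beta> x + (\<Sum>i=1..rank G. of_nat (c i) * sroot G i x)))"
  obtain \<theta> where \<theta>: "\<theta> \<in> roots G" "\<And>\<beta>. \<beta> \<in> roots G \<Longrightarrow> height \<beta> \<le> height \<theta>"
    using finite_has_maximum[OF finite_roots roots_nonempty, of height] by blast
  obtain x where x: "x \<in> root_space G \<theta>" "x \<noteq> 0" using rootD(3)[OF \<theta>(1)] by blast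
  have "brk G y x = 0" if \<alpha>: "\<alpha> \<in> pos_roots G" and y: "y \<in> root_space G \<alpha>" for \<alpha> y
  proof (rule not_root_imp_zero)
    show "\<alpha> + \<theta> \<in> hstar G" using \<alpha> \<theta>(1) hstar_add rootD(1) pos_rootD by blast
    show "brk G y x \<in> root_space G (\<alpha> + \<theta>)" by (rule root_space_brk[OF y x(1)])
    have h: "height (\<alpha> + \<theta>) > height \<theta>" using height_pos[OF \<alpha>] by simp
    then show "\<alpha> + \<theta> \<notin> roots G" using \<theta>(2)[of "\<alpha> + \<theta>"] by auto
    have "height \<theta> \<ge> 0" using \<theta>(2)[OF uminus_root[OF \<theta>(1)]] by simp
    with h show "\<alpha> + \<theta> \<noteq> 0" by force
  qed
  then have P: "?P \<theta>"
    using weight_below_highest[OF x(1) rootD(1)[OF \<theta>(1)] x(2)] \<theta>(1) by blast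
  have "highest_root G = \<theta>"
    unfolding highest_root_def
  proof (rule the_equality)
    fix \<theta>' assume P': "?P \<theta>'"
    obtain c where c: "\<theta> = (\<lambda>x. \<theta>' x + (\<Sum>i=1..rank G. of_nat (c i) * sroot G i x))" using P P' by blast
    obtain d where d: "\<theta>' = (\<lambda>x. \<theta> x + (\<Sum>i=1..rank G. of_nat (d i) * sroot G i x))" using P P' by blast
    have "height \<theta> = height \<theta>' + real (\<Sum>i=1..rank G. c i)"
      by (subst c) (simp add: height_def height_elt)
    moreover have "height \<theta>' = height \<theta> + real (\<Sum>i=1..rank G. d i)"
      by (subst d) (simp add: height_def height_elt)
    ultimately have "real (\<Sum>i=1..rank G. c i) + real (\<Sum>i=1..rank G. d i) = 0" by linarith
    then have "(\<Sum>i=1..rank G. d i) = 0" by (simp only: of_nat_add[symmetric] of_nat_eq_0_iff add_is_0)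
    then show "\<theta>' = \<theta>" by (subst d) simp
  qed (rule P)
  with P show "highest_root G \<in> roots G"
    "\<And>\<beta>. \<beta> \<in> roots G \<Longrightarrow> \<exists>c::nat \<Rightarrow> nat. highest_root G = (\<lambda>x. \<beta> x + (\<Sum>i=1..rank G. of_nat (c i) * sroot G i x))"
    by simp_all
qed

abbreviation \<theta> where "\<theta> \<equiv> highest_root G"

lemma height_le_highest: "\<beta> \<in> roots G \<Longrightarrow> height \<beta> \<le> height \<theta>"
proof -
  assume "\<beta> \<in> roots G"
  then obtain c :: "nat \<Rightarrow> nat" where c: "\<theta> = (\<lambda>x. \<beta> x + (\<Sum>i=1..rank G. of_nat (c i) * sroot G i x))"
    using highest_root(2) by blast
  have "height \<theta> = height \<beta> + real (\<Sum>i=1..rank G. c i)"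
    by (subst c) (simp add: height_def height_elt)
  then show ?thesis by (simp add: sum_nonneg)
qed

lemma highest_pos: "\<theta> \<in> pos_roots G"
proof -
  have "height \<theta> \<ge> 0"
    using height_le_highest[OF uminus_root[OF highest_root(1)]] by simp
  then show ?thesis
    using pos_or_neg[OF highest_root(1)] height_pos[of "- \<theta>"] by auto
qed

lemma highest_add_not_root: "\<alpha> \<in> pos_roots G \<Longrightarrow> \<theta> + \<alpha> \<notin> roots G" "\<alpha> \<in> pos_roots G \<Longrightarrow> \<alpha> + \<theta> \<notin> roots G"
  using height_le_highest[of "\<theta> + \<alpha>"] height_le_highest[of "\<alpha> + \<theta>"] height_pos[of \<alpha>] by auto

lemma root_dominant:
  assumes \<beta>: "\<beta> \<in> roots G" and \<alpha>: "\<alpha> \<in> pos_roots G" and nr: "height (refl \<alpha> \<beta>) \<le> height \<beta>"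
  obtains c :: nat where "\<beta> (coroot G \<alpha>) = of_nat c"
proof -
  obtain z where z: "\<beta> (coroot G \<alpha>) = of_int z" using root_integer[OF \<alpha> \<beta>] .
  have "height (refl \<alpha> \<beta>) = height \<beta> - of_int z * height \<alpha>"
    by (simp add: refl_def height_def z)
  with nr have "of_int z * height \<alpha> \<ge> 0" by simp
  then have "z \<ge> 0" using height_pos[OF \<alpha>] by (simp add: zero_le_mult_iff)
  with that[of "nat z"] z show ?thesis by simp
qed

lemma highest_dominant:
  assumes "\<alpha> \<in> pos_roots G"
  obtains c :: nat where "\<theta> (coroot G \<alpha>) = of_nat c"
  using root_dominant[OF highest_root(1) assms height_le_highest[OF refl_root[OF assms highest_root(1)]]] .

text \<open>Let \<open>\<beta>\<close> be a long root of maximal height.  Both \<open>\<beta>\<close> and \<open>\<theta>\<close> are dominant and \<open>\<theta> - \<beta>\<close> is a nonnegative combination of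
  simple roots, so \<open>(\<theta>|\<theta>) \<ge> (\<theta>|\<beta>) \<ge> (\<beta>|\<beta>) = 2\<close>.\<close>

lemma highest_norm: "wform G \<theta> \<theta> = 2"
proof -
  let ?L = "{\<beta>\<in>roots G. wform G \<beta> \<beta> = 2}"
  have "finite ?L" "?L \<noteq> {}"
    using finite_roots datum by (auto simp: simple_lie_datum_def normalized_form_def)
  then obtain \<beta> where \<beta>: "\<beta> \<in> ?L" "\<And>\<gamma>. \<gamma> \<in> ?L \<Longrightarrow> height \<gamma> \<le> height \<beta>"
    using finite_has_maximum[of ?L height] by blast
  then have R: "\<beta> \<in> roots G" "wform G \<beta> \<beta> = 2" by auto
  obtain c where c: "\<theta> = (\<lambda>x. \<beta> x + (\<Sum>i=1..rank G. of_nat (c i) * sroot G i x))"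
    using highest_root(2)[OF R(1)] by blast
  have pair: "Re (wform G \<gamma> (sroot G i)) \<ge> 0" if i: "i \<in> {1..rank G}" and g: "\<gamma> \<in> roots G"
    and n: "\<gamma> (coroot G (sroot G i)) = of_nat n" for i \<gamma> n
  proof -
    obtain r where "r > 0" "wform G \<gamma> (sroot G i) = of_real r * \<gamma> (coroot G (sroot G i))"
      using wform_real_coroot[OF rootD(1)[OF g] simple_root[OF i]] .
    then show ?thesis using n by simp
  qed
  have "Re (wform G \<beta> (sroot G i)) \<ge> 0" if i: "i \<in> {1..rank G}" for i
  proof (rule root_dominant[OF R(1) simple_pos[OF i]])
    show "height (refl (sroot G i) \<beta>) \<le> height \<beta>"
      using refl_root[OF simple_pos[OF i] R(1)] wform_refl[OF simple_root[OF i] rootD(1)[OF R(1)] rootD(1)[OF R(1)]] R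
      by (intro \<beta>(2)) simp
  qed (rule pair[OF i R(1)])
  moreover have "Re (wform G \<theta> (sroot G i)) \<ge> 0" if i: "i \<in> {1..rank G}" for i
    by (rule highest_dominant[OF simple_pos[OF i]]) (rule pair[OF i highest_root(1)])
  moreover have "wform G \<theta> \<nu> = wform G \<beta> \<nu> + (\<Sum>i=1..rank G. of_nat (c i) * wform G (sroot G i) \<nu>)"
    if "\<nu> \<in> hstar G" for \<nu>
  proof -
    have "\<theta> = \<beta> + (\<lambda>x. \<Sum>i=1..rank G. of_nat (c i) * sroot G i x)" using c by (simp add: fun_eq_iff)
    then show ?thesis
      using wform_add_left[OF rootD(1)[OF R(1)] hstar_sum that, of "{1..rank G}" "sroot G" "\<lambda>i. of_nat (c i)"]
        wform_sum_left[of "{1..rank G}" "sroot G" \<nu> "\<lambda>i. of_nat (c i)"] simple_root rootD(1) that by auto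
  qed
  ultimately have ge: "Re (wform G \<theta> \<gamma>) \<ge> Re (wform G \<beta> \<gamma>)" if "\<gamma> = \<beta> \<or> \<gamma> = \<theta>" for \<gamma>
    using that rootD(1) R(1) highest_root(1)
    by (auto simp: wform_sym[of "sroot G _"] intro!: sum_nonneg)
  have "Re (wform G \<theta> \<theta>) \<ge> 2"
    using ge[of \<theta>] ge[of \<beta>] R(2) wform_sym[of \<beta> \<theta>] by simp
  moreover obtain r where "wform G \<theta> \<theta> = of_real r" "r \<le> 2" using norm_root[OF highest_root(1)] by metis
  ultimately show ?thesis by simp
qed

text \<open>For a long root \<open>\<beta>\<close> and a root \<open>\<alpha> \<noteq> \<beta>\<close>, if \<open>(\<alpha>|\<beta>) \<ge> 2\<close> then \<open>\<alpha> - \<beta>\<close> is a root of length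
  \<open>(\<alpha>|\<alpha>) - 2(\<alpha>|\<beta>) + 2 \<le> 0\<close>.\<close>

lemma long_root_pairing:
  assumes \<beta>: "\<beta> \<in> pos_roots G" and long: "wform G \<beta> \<beta> = 2" and \<alpha>: "\<alpha> \<in> roots G" and ne: "\<alpha> \<noteq> \<beta>"
    and c: "wform G \<alpha> \<beta> = of_nat c"
  shows "c \<le> 1"
proof (rule ccontr)
  assume "\<not> c \<le> 1"
  then have c2: "c \<ge> 2" by simp
  note R = pos_rootD[OF \<beta>]
  obtain x where x: "x \<in> root_space G \<alpha>" "x \<noteq> 0" using rootD(3)[OF \<alpha>] by blast
  have "\<alpha> (coroot G \<beta>) = of_nat c" using root_coroot[OF R \<alpha>] long c by simp
  from lower_nonzero[OF \<beta> x this, of 1] c2 have "brk G (xminus G \<beta>) x \<noteq> 0" by simp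
  then have "\<alpha> - \<beta> \<in> roots G"
    using root_space_brk[OF root_vectors(3)[OF \<beta>] x(1)] ne hstar_diff[OF rootD(1)[OF \<alpha>] rootD(1)[OF R]]
    by (intro rootI[of _ "brk G (xminus G \<beta>) x"]) auto
  then obtain r where r: "wform G (\<alpha> - \<beta>) (\<alpha> - \<beta>) = of_real r" "0 < r" using norm_root by metis
  note h = rootD(1)[OF \<alpha>] rootD(1)[OF R] hstar_diff[OF rootD(1)[OF \<alpha>] rootD(1)[OF R]]
  have "wform G (\<alpha> - \<beta>) (\<alpha> - \<beta>) = wform G \<alpha> (\<alpha> - \<beta>) - wform G \<beta> (\<alpha> - \<beta>)"
    using h by (simp add: wform_diff_left)
  also have "wform G \<alpha> (\<alpha> - \<beta>) = wform G \<alpha> \<alpha> - wform G \<beta> \<alpha>"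
    using wform_diff_left[OF h(1,2,1)] wform_sym by metis
  also have "wform G \<beta> (\<alpha> - \<beta>) = wform G \<alpha> \<beta> - wform G \<beta> \<beta>"
    using wform_diff_left[OF h(1,2,2)] wform_sym by metis
  finally have "of_real r = wform G \<alpha> \<alpha> - of_nat c - (of_nat c - 2)"
    unfolding r(1) wform_sym[of \<beta> \<alpha>] c long .
  moreover obtain s where "wform G \<alpha> \<alpha> = of_real s" "s \<le> 2" using norm_root[OF \<alpha>] by metis
  ultimately have "Re (of_real r) = Re (of_real s - of_nat c - (of_nat c - 2))" "s \<le> 2" by simp_all
  then have "r \<le> 4 - 2 * real c" by simp
  with r(2) c2 show False by simp
qed

lemma highest_pairing:
  assumes "\<alpha> \<in> pos_roots G" "\<alpha> \<noteq> \<theta>"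
  shows "wform G \<theta> \<alpha> = 0 \<or> wform G \<theta> \<alpha> = 1"
proof -
  note R = pos_rootD[OF assms(1)]
  have "wform G \<alpha> \<theta> = \<alpha> (coroot G \<theta>)"
    using root_coroot[OF highest_root(1) R] highest_norm by simp
  moreover obtain z where z: "\<alpha> (coroot G \<theta>) = of_int z" using root_integer[OF highest_pos R] .
  moreover obtain c where c: "\<theta> (coroot G \<alpha>) = of_nat c" using highest_dominant[OF assms(1)] .
  moreover obtain r where r: "r > 0" "wform G \<theta> \<alpha> = of_real r * \<theta> (coroot G \<alpha>)"
    using wform_real_coroot[OF rootD(1)[OF highest_root(1)] R] .
  ultimately have "of_int z = (of_real (r * real c) :: complex)"
    by (simp add: wform_sym[of \<theta>])
  then have "Re (of_int z) = Re (of_real (r * real c))" by (rule arg_cong)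
  then have "real_of_int z = r * real c" by simp
  with r(1) have "z \<ge> 0" by (metis mult_nonneg_nonneg of_int_0_le_iff of_nat_0_le_iff less_imp_le)
  then have n: "wform G \<alpha> \<theta> = of_nat (nat z)"
    using \<open>wform G \<alpha> \<theta> = \<alpha> (coroot G \<theta>)\<close> z by simp
  then have "nat z \<le> 1"
    by (rule long_root_pairing[OF highest_pos highest_norm R assms(2)])
  then have "nat z = 0 \<or> nat z = 1" by linarith
  then show ?thesis
    using n wform_sym[of \<theta> \<alpha>] by auto
qed

end

lemma cnat_of_nat [simp]: "cnat (of_nat n) = n"
  by (simp add: cnat_def)

context simple_datum
begin

subsection \<open>Integrality of \<open>d\<^sub>\<alpha>\<close>\<close>

lemma brk_rep: "\<alpha> \<in> hstar G \<Longrightarrow> z \<in> root_space G \<gamma> \<Longrightarrow> brk G z (rep_elt G \<alpha>) = scl G (- \<gamma> (rep_elt G \<alpha>)) z"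
  using brk_anti[of z "rep_elt G \<alpha>"] rep_weight(1)[of \<alpha>] by (simp add: root_space_def)

text \<open>If no long root were non-orthogonal to \<open>\<alpha>\<close>, the roots orthogonal to all long roots would be
  orthogonal to all other roots, and their root spaces would generate a proper ideal.\<close>

lemma exists_long_nonorthogonal:
  assumes \<alpha>: "\<alpha> \<in> roots G"
  shows "\<exists>\<beta>\<in>roots G. wform G \<beta> \<beta> = 2 \<and> wform G \<alpha> \<beta> \<noteq> 0"
proof (rule ccontr)
  assume neg: "\<not> ?thesis"
  define A where "A = {a\<in>roots G. \<forall>\<beta>\<in>roots G. wform G \<beta> \<beta> = 2 \<longrightarrow> wform G a \<beta> = 0}"
  have A: "\<alpha> \<in> A" using neg \<alpha> by (auto simp: A_def)
  have AR: "a \<in> roots G" if "a \<in> A" for a using that by (simp add: A_def)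
  have orth: "wform G a \<gamma> = 0" if a: "a \<in> A" and \<gamma>: "\<gamma> \<in> roots G" "\<gamma> \<notin> A" for a \<gamma>
  proof -
    obtain \<beta> where \<beta>: "\<beta> \<in> roots G" "wform G \<beta> \<beta> = 2" "wform G \<gamma> \<beta> \<noteq> 0"
      using \<gamma> by (auto simp: A_def)
    have *: "wform G a \<delta> = 0" if \<delta>: "\<delta> \<in> pos_roots G" "\<delta> = \<gamma> \<or> \<delta> = - \<gamma>" for \<delta>
    proof -
      note R = pos_rootD[OF \<delta>(1)]
      have "wform G \<delta> \<beta> \<noteq> 0"
        using \<delta>(2) \<beta>(3) wform_uminus_left[OF rootD(1)[OF \<gamma>(1)] rootD(1)[OF \<beta>(1)]] by auto
      then have nz: "\<beta> (coroot G \<delta>) \<noteq> 0"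
        using root_coroot[OF R \<beta>(1)] norm_root_nz[OF R] wform_sym[of \<delta> \<beta>] by simp
      have "wform G (refl \<delta> \<beta>) (refl \<delta> \<beta>) = 2"
        using wform_refl[OF R rootD(1)[OF \<beta>(1)] rootD(1)[OF \<beta>(1)]] \<beta>(2) by simp
      then have "wform G a (refl \<delta> \<beta>) = 0" "wform G a \<beta> = 0"
        using a refl_root[OF \<delta>(1) \<beta>(1)] \<beta> by (auto simp: A_def)
      moreover have "wform G (refl \<delta> \<beta>) a = wform G \<beta> a - \<beta> (coroot G \<delta>) * wform G \<delta> a"
        using R rootD(1)[OF \<beta>(1)] rootD(1)[OF AR[OF a]] unfolding refl_def
        by (simp add: wform_diff_left wform_scale_left hstar_scale rootD(1))
      ultimately show ?thesis
        using nz wform_sym[of a] by simp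
    qed
    from pos_or_neg[OF \<gamma>(1)] show ?thesis
    proof
      assume "- \<gamma> \<in> pos_roots G"
      then have "wform G a (- \<gamma>) = 0" by (rule *) simp
      then show ?thesis
        using wform_uminus_left[OF rootD(1)[OF \<gamma>(1)] rootD(1)[OF AR[OF a]]] wform_sym[of a] by simp
    qed (rule *, simp_all)
  qed
  have A_add: "a + \<gamma> \<in> A" if "a \<in> A" "\<gamma> \<in> A" "a + \<gamma> \<in> roots G" for a \<gamma>
    using that by (auto simp: A_def wform_add_left rootD(1))
  have A_uminus: "- a \<in> A" if "a \<in> A" for a
    using that by (auto simp: A_def wform_uminus_left rootD(1) uminus_root)
  have mixed: "a + \<gamma> \<notin> roots G" if a: "a \<in> A" and \<gamma>: "\<gamma> \<in> roots G" "\<gamma> \<notin> A" for a \<gamma>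
  proof
    assume R: "a + \<gamma> \<in> roots G"
    note h = rootD(1)[OF AR[OF a]] rootD(1)[OF \<gamma>(1)]
    show False
    proof (cases "a + \<gamma> \<in> A")
      case True
      then have "wform G (a + \<gamma>) \<gamma> = 0" using orth \<gamma> by blast
      then show False
        using wform_add_left[OF h h(2)] orth[OF a \<gamma>] norm_root_nz[OF \<gamma>(1)] by simp
    next
      case False
      then have "wform G a (a + \<gamma>) = 0" using orth a R by blast
      then show False
        using wform_add_left[OF h h(1)] orth[OF a \<gamma>] norm_root_nz[OF AR[OF a]] wform_sym by (metis add.right_neutral)
    qed
  qed
  define J where "J = span ((\<Union>a\<in>A. root_space G a) \<union> rep_elt G ` A)"
  have gJ: "x \<in> J" if "x \<in> root_space G a" "a \<in> A" for x a
    using that by (auto simp: J_def intro: span_base)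
  have tJ: "rep_elt G a \<in> J" if "a \<in> A" for a
    using that by (auto simp: J_def intro: span_base)
  have sub: "subspace J" by (simp add: J_def subspace_span)
  have root_root: "brk G z u \<in> J" if a: "a \<in> A" and u: "u \<in> root_space G a" and \<gamma>: "\<gamma> \<in> roots G" and z: "z \<in> root_space G \<gamma>" for a u \<gamma> z
  proof (cases "brk G z u = 0")
    case False
    have zu: "brk G z u \<in> root_space G (a + \<gamma>)"
      using root_space_brk[OF z u] by (simp add: add.commute)
    have "a + \<gamma> = 0 \<or> a + \<gamma> \<in> roots G"
      using rootI[OF _ _ zu False] hstar_add rootD(1) AR[OF a] \<gamma> by blast
    then show ?thesis
    proof
      assume "a + \<gamma> = 0"
      then have g: "\<gamma> = - a" by (simp add: eq_neg_iff_add_eq_0 add.commute)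
      have "brk G z u = - brk G u z" by (rule brk_anti)
      also have "\<dots> = - scl G (iform G u z) (rep_elt G a)"
        using rep_root(3)[OF AR[OF a] u] z g by simp
      finally show ?thesis
        using tJ[OF a] sub by (simp add: subspace_neg subspace_scale)
    next
      assume R: "a + \<gamma> \<in> roots G"
      then have "\<gamma> \<in> A" using mixed a \<gamma> by blast
      then show ?thesis using gJ[OF zu] A_add a R by blast
    qed
  qed (simp add: subspace_0[OF sub])
  have gen: "brk G z u \<in> J" if u: "u \<in> (\<Union>a\<in>A. root_space G a) \<union> rep_elt G ` A" for u z
  proof -
    have "z \<in> {z. brk G z u \<in> J}"
    proof (rule span_decomposition_induct)
      show "subspace {z. brk G z u \<in> J}"
        using sub by (auto simp: subspace_def brk_add_left brk_scl_left)
      show "H \<in> {z. brk G z u \<in> J}" if H: "H \<in> cartan G" for H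
        using u
      proof
        assume "u \<in> (\<Union>a\<in>A. root_space G a)"
        then obtain a where a: "a \<in> A" "u \<in> root_space G a" by blast
        then have "brk G H u = scl G (a H) u" using H by (simp add: root_space_def)
        then show ?thesis using gJ[OF a(2,1)] sub by (simp add: subspace_scale)
      next
        assume "u \<in> rep_elt G ` A"
        then have "brk G H u = 0" using cartan_commute H rep_root(1) AR by auto
        then show ?thesis using sub by (simp add: subspace_0)
      qed
      fix \<gamma> z assume \<gamma>: "\<gamma> \<in> roots G" and z: "z \<in> root_space G \<gamma>"
      from u show "z \<in> {z. brk G z u \<in> J}"
      proof
        assume "u \<in> rep_elt G ` A"
        then obtain a where a: "a \<in> A" "u = rep_elt G a" by blast
        have br: "brk G z u = scl G (- wform G \<gamma> a) z"
          using brk_rep[OF rootD(1)[OF AR[OF a(1)]] z] wform_root[OF \<gamma> AR[OF a(1)]] a(2) by simp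
        show ?thesis
        proof (cases "\<gamma> \<in> A")
          case True
          then show ?thesis using br gJ[OF z] sub by (simp add: subspace_scale subspace_neg)
        next
          case False
          then have "wform G \<gamma> a = 0" using orth[OF a(1) \<gamma>] wform_sym by metis
          then show ?thesis using br sub by (simp add: subspace_0)
        qed
      qed (use root_root \<gamma> z in auto)
    qed
    then show ?thesis by simp
  qed
  have ideal: "brk G z u \<in> J" if "u \<in> J" for u z
  proof -
    have "subspace {u. brk G z u \<in> J}"
      using sub by (auto simp: subspace_def brk_add_right brk_scl_right)
    then have "J \<subseteq> {u. brk G z u \<in> J}"
      using gen unfolding J_def by (intro span_minimal) auto
    with that show ?thesis by blast
  qed
  obtain x where x: "x \<in> root_space G \<alpha>" "x \<noteq> 0" using rootD(3)[OF \<alpha>] by blast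
  have U: "J = UNIV" by (rule ideal_UNIV[OF sub ideal gJ[OF x(1) A] x(2)])
  obtain y where y: "y \<in> root_space G \<theta>" "y \<noteq> 0" using rootD(3)[OF highest_root(1)] by blast
  then obtain y' where y': "y' \<in> root_space G (- \<theta>)" "iform G y y' \<noteq> 0"
    using opposite_pairing highest_root(1) by blast
  have \<theta>A: "\<theta> \<notin> A" using highest_norm highest_root(1) by (auto simp: A_def)
  have "u \<in> {u. iform G u y' = 0}" if "u \<in> (\<Union>a\<in>A. root_space G a) \<union> rep_elt G ` A" for u
    using that
  proof
    assume "u \<in> (\<Union>a\<in>A. root_space G a)"
    then obtain a where a: "a \<in> A" "u \<in> root_space G a" by blast
    then have "\<exists>H\<in>cartan G. a H \<noteq> \<theta> H"
      using hstar_eqI rootD(1) AR highest_root(1) \<theta>A by metis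
    then show ?thesis using form_orthogonal[OF a(2) y'(1)] by auto
  next
    assume "u \<in> rep_elt G ` A"
    then have "u \<in> root_space G 0" using rep_root(1) AR root_space_zero by auto
    moreover have "\<exists>H\<in>cartan G. \<theta> H \<noteq> 0"
      using hstar_eqI[OF rootD(1)[OF highest_root(1)] hstar_zero] rootD(2)[OF highest_root(1)] by auto
    ultimately show ?thesis using form_orthogonal[of u 0 y' "- \<theta>"] y'(1) by auto
  qed
  then have "J \<subseteq> {u. iform G u y' = 0}"
    unfolding J_def by (intro span_minimal) (auto simp: subspace_def form_add_left form_scl_left)
  with U y'(2) show False by auto
qed

text \<open>For a long positive root \<open>\<beta>\<close> not orthogonal to \<open>\<alpha>\<close>, either \<open>\<alpha> = \<beta>\<close> or \<open>(\<alpha>|\<beta>) = \<plusminus>1\<close>; in the second case \<open>d\<^sub>\<alpha>\<close> is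
  the integer \<open>\<plusminus>\<langle>\<beta>, \<alpha>\<^sup>\<or>\<rangle>\<close>.\<close>

lemma dnum_natural:
  assumes \<alpha>: "\<alpha> \<in> pos_roots G"
  obtains d where "dnum G \<alpha> = of_nat d" "d \<ge> 1"
proof -
  note R = pos_rootD[OF \<alpha>]
  obtain \<beta>0 where \<beta>0: "\<beta>0 \<in> roots G" "wform G \<beta>0 \<beta>0 = 2" "wform G \<alpha> \<beta>0 \<noteq> 0"
    using exists_long_nonorthogonal[OF R] by blast
  have neg_norm: "wform G (- \<gamma>) (- \<gamma>) = wform G \<gamma> \<gamma>" if "\<gamma> \<in> hstar G" for \<gamma>
    using that wform_uminus_left[OF that] wform_uminus_left[OF that hstar_uminus[OF that]] wform_sym[of \<gamma> "- \<gamma>"] by simp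
  obtain \<beta> where \<beta>: "\<beta> \<in> pos_roots G" "wform G \<beta> \<beta> = 2" "wform G \<alpha> \<beta> \<noteq> 0"
  proof (cases "\<beta>0 \<in> pos_roots G")
    case True
    with \<beta>0 that show ?thesis by blast
  next
    case False
    then have "- \<beta>0 \<in> pos_roots G" using pos_or_neg \<beta>0(1) by blast
    moreover have "wform G \<alpha> (- \<beta>0) = - wform G \<alpha> \<beta>0"
      using wform_uminus_left[OF rootD(1)[OF \<beta>0(1)] rootD(1)[OF R]] wform_sym by metis
    ultimately show ?thesis using that[of "- \<beta>0"] \<beta>0 neg_norm[OF rootD(1)] by simp
  qed
  note Rb = pos_rootD[OF \<beta>(1)]
  obtain z where "\<alpha> (coroot G \<beta>) = of_int z" using root_integer[OF \<beta>(1) R] .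
  then have z: "wform G \<alpha> \<beta> = of_int z" using root_coroot[OF Rb R] \<beta>(2) by simp
  have bound: "c \<le> 1" if "\<gamma> \<in> roots G" "\<gamma> \<noteq> \<beta>" "wform G \<gamma> \<beta> = of_nat c" for \<gamma> c
    by (rule long_root_pairing[OF \<beta>(1,2) that])
  have main: "\<alpha> = \<beta> \<or> \<bar>z\<bar> = 1"
  proof (rule disjCI)
    assume *: "\<bar>z\<bar> \<noteq> 1"
    show "\<alpha> = \<beta>"
    proof (rule ccontr)
      assume ne: "\<alpha> \<noteq> \<beta>"
      have nz: "z \<noteq> 0" using z \<beta>(3) by auto
      show False
      proof (cases "z \<ge> 0")
        case True
        then have "nat z \<le> 1" using bound[OF R ne, of "nat z"] z by simp
        with True nz * show False by auto
      next
        case False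
        have "- \<alpha> \<noteq> \<beta>"
          using height_pos[OF \<alpha>] height_pos[OF \<beta>(1)] by (metis height_simps(3) neg_le_0_iff_le order_trans zero_le_one not_one_le_zero)
        moreover have "wform G (- \<alpha>) \<beta> = of_nat (nat (- z))"
          using wform_uminus_left[OF rootD(1)[OF R] rootD(1)[OF Rb]] z False by simp
        ultimately have "nat (- z) \<le> 1" using bound[OF uminus_root[OF R]] by blast
        with False * show False by auto
      qed
    qed
  qed
  obtain w where w: "\<beta> (coroot G \<alpha>) = of_int w" using root_integer[OF \<alpha> Rb] .
  have d: "dnum G \<alpha> * of_int z = of_int w"
    using eval_coroot_wform[OF rootD(1)[OF Rb] R] w z wform_sym[of \<beta> \<alpha>] by simp
  obtain r where r: "wform G \<alpha> \<alpha> = of_real r" "0 < r" using norm_root[OF R] by metis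
  have dr: "dnum G \<alpha> = of_real (2 / r)" by (simp add: dnum_def r(1))
  have "\<exists>y::int. dnum G \<alpha> = of_int y"
    using main
  proof
    assume "\<alpha> = \<beta>"
    then show ?thesis using \<beta>(2) by (intro exI[of _ 1]) (simp add: dnum_def)
  next
    assume "\<bar>z\<bar> = 1"
    then have "dnum G \<alpha> = of_int (z * w)"
      using d by (cases "z = 1") (auto simp: abs_if minus_equation_iff split: if_splits)
    then show ?thesis by blast
  qed
  then obtain y :: int where y: "dnum G \<alpha> = of_int y" by blast
  with dr have "Re (of_int y) = Re (of_real (2 / r))" by metis
  then have "real_of_int y = 2 / r" by simp
  with r(2) have "real_of_int y > 0" by simp
  then have "y > 0" by simp
  with that[of "nat y"] y show ?thesis by simp
qed

subsection \<open>Dominant weights\<close>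

lemma hstar_eq_on_coroots:
  assumes "w \<in> hstar G" "w' \<in> hstar G" "\<And>j. j \<in> {1..rank G} \<Longrightarrow> w (coroot G (sroot G j)) = w' (coroot G (sroot G j))"
  shows "w = w'"
proof -
  let ?t = "\<lambda>i. rep_elt G (sroot G i)"
  define v where "v = w - w'"
  have v: "v \<in> hstar G" using assms by (simp add: v_def hstar_diff)
  have "v (?t j) = 0" if j: "j \<in> {1..rank G}" for j
    using assms(3)[OF j] eval_coroot[OF v simple_root[OF j]] norm_root_nz[OF simple_root[OF j]] by (simp add: v_def)
  moreover have "v 0 = 0"
    using hstar_homogeneous[OF v subspace_0[OF cartan_subspace], of 0] by simp
  then have "subspace {y\<in>cartan G. v y = 0}"
    using v cartan_subspace by (auto simp: subspace_def hstar_additive hstar_homogeneous)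
  ultimately have "span (?t ` {1..rank G}) \<subseteq> {y\<in>cartan G. v y = 0}"
    using simple_root rep_root(1) by (intro span_minimal) auto
  then have "v = 0"
    using cartan_span_rep by (intro hstar_eqI[OF v hstar_zero]) auto
  then show ?thesis by (simp add: v_def)
qed

lemma fund_weight:
  assumes i: "i \<in> {1..rank G}"
  shows "fund_weight G i \<in> hstar G"
    "j \<in> {1..rank G} \<Longrightarrow> fund_weight G i (coroot G (sroot G j)) = (if j = i then 1 else 0)"
proof -
  let ?P = "\<lambda>w. w \<in> hstar G \<and> (\<forall>j\<in>{1..rank G}. w (coroot G (sroot G j)) = (if j = i then 1 else 0))"
  obtain X where X: "X \<in> cartan G" "\<And>j. j \<in> {1..rank G} \<Longrightarrow>
      sroot G j X = (if j = i then wform G (sroot G j) (sroot G j) / 2 else 0)"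
    using exists_dual_element[of "\<lambda>j. if j = i then wform G (sroot G j) (sroot G j) / 2 else 0"] by blast
  define w where "w H = (if H \<in> cartan G then iform G X H else 0)" for H
  have w: "w \<in> hstar G"
    using subspace_add[OF cartan_subspace] subspace_scale[OF cartan_subspace]
    by (auto simp: hstar_def w_def form_add_right form_scl_right)
  have "w (coroot G (sroot G j)) = (if j = i then 1 else 0)" if j: "j \<in> {1..rank G}" for j
  proof -
    have "w (rep_elt G (sroot G j)) = sroot G j X"
      using X(1) rep_root[OF simple_root[OF j]] form_sym by (metis w_def)
    then show ?thesis
      using eval_coroot[OF w simple_root[OF j]] X(2)[OF j] norm_root_nz[OF simple_root[OF j]]
      by (cases "j = i") (simp_all add: mult.commute)
  qed
  with w have "?P w" by blast
  moreover have "w' = w" if "?P w'" for w'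
    using that \<open>?P w\<close> by (intro hstar_eq_on_coroots) auto
  ultimately have "?P (fund_weight G i)"
    unfolding fund_weight_def by (rule theI)
  then show "fund_weight G i \<in> hstar G"
    "j \<in> {1..rank G} \<Longrightarrow> fund_weight G i (coroot G (sroot G j)) = (if j = i then 1 else 0)"
    by auto
qed

text \<open>The weight \<open>d\<^sub>i \<varpi>\<^sub>i\<close> pairs with \<open>\<alpha>\<^sub>i\<close> to \<open>d\<^sub>i (\<alpha>\<^sub>i|\<alpha>\<^sub>i) / 2 = 1\<close> and with the other simple roots to \<open>0\<close>.\<close>

lemma Lplus_pairing:
  assumes "lam \<in> Lplus G"
  shows "lam \<in> hstar G" "\<alpha> \<in> pos_roots G \<Longrightarrow> \<exists>p. wform G lam \<alpha> = of_nat p"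
proof -
  obtain c :: "nat \<Rightarrow> nat" where c: "lam = (\<lambda>x. \<Sum>i=1..rank G. of_nat (c i) * dnum G (sroot G i) * fund_weight G i x)"
    using assms by (auto simp: Lplus_def)
  show lam: "lam \<in> hstar G"
    unfolding c by (intro hstar_sum fund_weight(1))
  have simple: "wform G lam (sroot G j) = of_nat (c j)" if j: "j \<in> {1..rank G}" for j
  proof -
    have "lam (coroot G (sroot G j)) = of_nat (c j) * dnum G (sroot G j)"
      using j by (simp add: c fund_weight(2) if_distrib[of "\<lambda>x. _ * x"] sum.delta cong: if_cong)
    moreover have "dnum G (sroot G j) \<noteq> 0" using norm_root_nz[OF simple_root[OF j]] by (simp add: dnum_def)
    ultimately show ?thesis
      using eval_coroot_wform[OF lam simple_root[OF j]] by simp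
  qed
  show "\<exists>p. wform G lam \<alpha> = of_nat p" if \<alpha>: "\<alpha> \<in> pos_roots G"
  proof -
    obtain n :: "nat \<Rightarrow> nat" where n: "\<alpha> = (\<lambda>x. \<Sum>i=1..rank G. of_nat (n i) * sroot G i x)"
      using \<alpha> by (auto simp: pos_roots_def)
    have "wform G \<alpha> lam = (\<Sum>i=1..rank G. of_nat (n i) * wform G (sroot G i) lam)"
      unfolding n by (rule wform_sum_left) (auto simp: simple_root rootD(1) lam)
    also have "\<dots> = of_nat (\<Sum>i=1..rank G. n i * c i)"
      using simple wform_sym[of lam] by simp
    finally show ?thesis using wform_sym[of lam \<alpha>] by metis
  qed
qed

end

section \<open>Free associative algebras\<close>

definition cst :: "complex \<Rightarrow> 'a fword \<Rightarrow>\<^sub>0 complex" where "cst c = Poly_Mapping.single 0 c"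

definition word :: "'a list \<Rightarrow> 'a fword \<Rightarrow>\<^sub>0 complex" where "word ws = Poly_Mapping.single (FWord ws) 1"

lemma cst_simps [simp]: "cst 0 = 0" "cst 1 = 1"
  by (simp_all add: cst_def)

lemma cst_add: "cst (c + d) = cst c + cst d"
  and cst_mult: "cst (c * d) = cst c * cst d"
  by (simp_all add: cst_def single_add mult_single)

lemma cst_uminus: "cst (- c) = - cst c"
  using cst_add[of c "- c"] by (simp add: eq_neg_iff_add_eq_0 add.commute)

lemma cst_diff: "cst (c - d) = cst c - cst d"
  using cst_add[of c "- d"] by (simp add: cst_uminus)

lemma word_Nil: "word [] = 1"
  by (simp add: word_def zero_fword_def[symmetric])

lemma word_append: "word (us @ ws) = word us * word ws"
  by (simp add: word_def mult_single plus_fword_def)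

lemma word_Cons: "word (a # ws) = word [a] * word ws"
  using word_append[of "[a]" ws] by simp

lemma word_replicate: "word (replicate n a) = word [a] ^ n"
  by (induction n) (simp_all add: word_Nil word_Cons[of a "replicate _ _"])

lemma word_expansion: "p = (\<Sum>w\<in>Poly_Mapping.keys p. cst (Poly_Mapping.lookup p w) * word (letters w))"
proof (rule poly_mapping_eqI)
  fix k
  have "cst (Poly_Mapping.lookup p w) * word (letters w) = Poly_Mapping.single w (Poly_Mapping.lookup p w)" for w
    by (simp add: cst_def word_def mult_single)
  then show "Poly_Mapping.lookup p k =
      Poly_Mapping.lookup (\<Sum>w\<in>Poly_Mapping.keys p. cst (Poly_Mapping.lookup p w) * word (letters w)) k"
    by (simp add: lookup_sum lookup_single when_def in_keys_iff)
qed

lemma word_induct: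
  assumes "\<And>ws. P (word ws)" "\<And>c p. P p \<Longrightarrow> P (cst c * p)" "\<And>p q. P p \<Longrightarrow> P q \<Longrightarrow> P (p + q)"
  shows "P p"
proof -
  have 0: "P 0" using assms(2)[OF assms(1), of 0] by simp
  have "P (\<Sum>w\<in>S. cst (Poly_Mapping.lookup p w) * word (letters w))" for S
    using assms 0 by (induction S rule: infinite_finite_induct) auto
  then show ?thesis by (subst word_expansion)
qed

lemma cst_word_central: "cst c * word ws = word ws * cst c"
  by (simp add: cst_def word_def mult_single)

lemma cst_central: "cst c * p = p * cst c"
proof (induction p rule: word_induct)
  case (2 d p)
  have "cst c * cst d = cst d * cst c" by (simp only: cst_mult[symmetric] mult.commute)
  from arg_cong[OF this, of "\<lambda>q. q * p"] have "cst c * (cst d * p) = cst d * (cst c * p)"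
    by (simp only: mult.assoc)
  then show ?case by (simp only: 2 mult.assoc)
qed (simp_all add: cst_word_central distrib_left distrib_right)

lemma mult_cst_left: "p * (cst c * q) = cst c * (p * q)"
  by (simp only: mult.assoc[symmetric] cst_central[of c p])

lemma word_cst: "word ws * (cst c * q) = cst c * (word ws * q)"
  and cst_left_commute: "cst c * (cst d * q) = cst d * (cst c * q)"
  by (rule mult_cst_left)+

lemma vector_space_cst: "vector_space (\<lambda>c p. cst c * p)"
  by unfold_locales (simp_all add: distrib_left distrib_right cst_add cst_mult mult.assoc)

text \<open>The linear map with value \<open>\<phi> ws\<close> on each word \<open>ws\<close>.\<close>

definition lin :: "('a list \<Rightarrow> 'b fword \<Rightarrow>\<^sub>0 complex) \<Rightarrow> ('a fword \<Rightarrow>\<^sub>0 complex) \<Rightarrow> 'b fword \<Rightarrow>\<^sub>0 complex" where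
  "lin \<phi> p = (\<Sum>w\<in>Poly_Mapping.keys p. cst (Poly_Mapping.lookup p w) * \<phi> (letters w))"

lemma lin_superset:
  assumes "finite S" "Poly_Mapping.keys p \<subseteq> S"
  shows "lin \<phi> p = (\<Sum>w\<in>S. cst (Poly_Mapping.lookup p w) * \<phi> (letters w))"
  unfolding lin_def by (rule sum.mono_neutral_left) (use assms in \<open>auto simp: in_keys_iff\<close>)

lemma lin_add: "lin \<phi> (p + q) = lin \<phi> p + lin \<phi> q"
proof -
  let ?S = "Poly_Mapping.keys p \<union> Poly_Mapping.keys q \<union> Poly_Mapping.keys (p + q)"
  have "lin \<phi> r = (\<Sum>w\<in>?S. cst (Poly_Mapping.lookup r w) * \<phi> (letters w))" if "r \<in> {p, q, p + q}" for r
    using that by (intro lin_superset) auto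
  then show ?thesis
    by (simp add: lookup_add cst_add distrib_right sum.distrib)
qed

lemma lookup_cst: "Poly_Mapping.lookup (cst c * p) w = c * Poly_Mapping.lookup p w"
proof (induction p arbitrary: c rule: word_induct)
  case (1 ws)
  then show ?case by (simp add: cst_def word_def mult_single lookup_single when_def)
next
  case (2 d p)
  have "cst c * (cst d * p) = cst (c * d) * p" by (simp add: cst_mult mult.assoc)
  then show ?case by (simp only: 2 mult.assoc)
qed (simp add: lookup_add distrib_left)

lemma lin_cst: "lin \<phi> (cst c * p) = cst c * lin \<phi> p"
proof -
  let ?S = "Poly_Mapping.keys p \<union> Poly_Mapping.keys (cst c * p)"
  have "lin \<phi> r = (\<Sum>w\<in>?S. cst (Poly_Mapping.lookup r w) * \<phi> (letters w))" if "r \<in> {p, cst c * p}" for r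
    using that by (intro lin_superset) auto
  then show ?thesis
    by (simp add: lookup_cst cst_mult sum_distrib_left mult.assoc)
qed

lemma lin_word: "lin \<phi> (word ws) = \<phi> ws"
  by (simp add: lin_def word_def)

lemma lin_zero [simp]: "lin \<phi> 0 = 0"
  by (simp add: lin_def)

lemma lin_diff: "lin \<phi> (p - q) = lin \<phi> p - lin \<phi> q"
  using lin_add[of \<phi> "p - q" q] by (simp add: algebra_simps)

section \<open>Powers of root vectors on a dominant vector\<close>

context simple_datum
begin

text \<open>Structure constants of \<open>\<nn>\<^sup>-\<close> and of the action of \<open>x\<^sup>+\<^sub>i\<close> on it.  They are \<open>0\<close> when the index of the result is not a
  positive root, so that products with generators at meaningless indices disappear.\<close>

definition nconst :: "('g \<Rightarrow> complex) \<Rightarrow> ('g \<Rightarrow> complex) \<Rightarrow> complex" where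
  "nconst \<gamma> \<delta> = (if \<gamma> + \<delta> \<in> pos_roots G
     then SOME c. brk G (xminus G \<gamma>) (xminus G \<delta>) = scl G c (xminus G (\<gamma> + \<delta>)) else 0)"

definition pconst :: "nat \<Rightarrow> ('g \<Rightarrow> complex) \<Rightarrow> complex" where
  "pconst i \<gamma> = (if \<gamma> - sroot G i \<in> pos_roots G
     then SOME c. brk G (xplus G (sroot G i)) (xminus G \<gamma>) = scl G c (xminus G (\<gamma> - sroot G i)) else 0)"

lemma pos_root_hstar: "\<gamma> \<in> pos_roots G \<Longrightarrow> \<gamma> \<in> hstar G"
  using rootD(1) pos_rootD by blast

lemma pos_sum_nz: "\<gamma> \<in> pos_roots G \<Longrightarrow> \<delta> \<in> pos_roots G \<Longrightarrow> \<gamma> + \<delta> \<noteq> 0"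
proof
  assume *: "\<gamma> \<in> pos_roots G" "\<delta> \<in> pos_roots G" "\<gamma> + \<delta> = 0"
  have "height (\<gamma> + \<delta>) \<ge> 2" using height_pos[OF *(1)] height_pos[OF *(2)] by simp
  then show False using *(3) by (simp only: height_simps(4))
qed

lemma brk_xminus:
  assumes \<gamma>: "\<gamma> \<in> pos_roots G" and \<delta>: "\<delta> \<in> pos_roots G"
  shows "brk G (xminus G \<gamma>) (xminus G \<delta>) = scl G (nconst \<gamma> \<delta>) (xminus G (\<gamma> + \<delta>))"
proof -
  have "- \<gamma> + - \<delta> = - (\<gamma> + \<delta>)" by simp
  then have sp: "brk G (xminus G \<gamma>) (xminus G \<delta>) \<in> root_space G (- (\<gamma> + \<delta>))"
    using root_space_brk[OF root_vectors(3)[OF \<gamma>] root_vectors(3)[OF \<delta>]] by metis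
  show ?thesis
  proof (cases "\<gamma> + \<delta> \<in> pos_roots G")
    case True
    then have "\<exists>c. brk G (xminus G \<gamma>) (xminus G \<delta>) = scl G c (xminus G (\<gamma> + \<delta>))"
      using root_space_one_dim(2) sp by blast
    from someI_ex[OF this] True show ?thesis by (simp add: nconst_def)
  next
    case False
    then have "\<gamma> + \<delta> \<notin> roots G"
      using pos_root_add[OF \<gamma> \<delta>] by blast
    then have "- (\<gamma> + \<delta>) \<notin> roots G" using uminus_root[of "- (\<gamma> + \<delta>)"] unfolding minus_minus by blast
    then have "brk G (xminus G \<gamma>) (xminus G \<delta>) = 0"
      using sp not_root_imp_zero hstar_uminus[OF hstar_add[OF pos_root_hstar[OF \<gamma>] pos_root_hstar[OF \<delta>]]]
        pos_sum_nz[OF \<gamma> \<delta>] by (metis neg_equal_0_iff_equal)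
    with False show ?thesis by (simp add: nconst_def)
  qed
qed

lemma brk_xplus_xminus:
  assumes \<gamma>: "\<gamma> \<in> pos_roots G" and i: "i \<in> {1..rank G}" and ne: "\<gamma> \<noteq> sroot G i"
  shows "brk G (xplus G (sroot G i)) (xminus G \<gamma>) = scl G (pconst i \<gamma>) (xminus G (\<gamma> - sroot G i))"
proof -
  let ?a = "sroot G i"
  note a = simple_pos[OF i]
  have "?a + - \<gamma> = - (\<gamma> - ?a)" by simp
  then have sp: "brk G (xplus G ?a) (xminus G \<gamma>) \<in> root_space G (- (\<gamma> - ?a))"
    using root_space_brk[OF root_vectors(1)[OF a] root_vectors(3)[OF \<gamma>]] by metis
  show ?thesis
  proof (cases "\<gamma> - ?a \<in> pos_roots G")
    case True
    then have "\<exists>c. brk G (xplus G ?a) (xminus G \<gamma>) = scl G c (xminus G (\<gamma> - ?a))"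
      using root_space_one_dim(2) sp by blast
    from someI_ex[OF this] True show ?thesis by (simp add: pconst_def)
  next
    case False
    then have "\<gamma> - ?a \<notin> roots G"
      using diff_simple_pos[OF \<gamma> i ne] by blast
    then have "- (\<gamma> - ?a) \<notin> roots G" using uminus_root[of "- (\<gamma> - ?a)"] by auto
    then have "brk G (xplus G ?a) (xminus G \<gamma>) = 0"
      using sp not_root_imp_zero[of "- (\<gamma> - ?a)"] hstar_uminus[OF hstar_diff[OF pos_root_hstar[OF \<gamma>] pos_root_hstar[OF a]]] ne
      by (metis neg_equal_0_iff_equal right_minus_eq)
    with False show ?thesis by (simp add: pconst_def)
  qed
qed

lemma nconst_anti:
  assumes "\<gamma> \<in> pos_roots G" "\<delta> \<in> pos_roots G"
  shows "nconst \<gamma> \<delta> = - nconst \<delta> \<gamma>"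
proof (cases "\<gamma> + \<delta> \<in> pos_roots G")
  case True
  have "scl G (nconst \<gamma> \<delta>) (xminus G (\<gamma> + \<delta>)) = scl G (- nconst \<delta> \<gamma>) (xminus G (\<gamma> + \<delta>))"
    using brk_anti[of "xminus G \<gamma>" "xminus G \<delta>"] brk_xminus assms by (simp add: add.commute[of \<delta>])
  then show ?thesis using root_vectors(4)[OF True] by (simp only: scale_cancel_right) simp
qed (simp add: nconst_def add.commute)

text \<open>The Jacobi identity for \<open>x\<^sup>+\<^sub>i\<close>, \<open>x\<^sup>-\<^sub>\<gamma>\<close>, \<open>x\<^sup>-\<^sub>\<delta>\<close> in coordinates.  The case \<open>\<gamma> = \<alpha>\<^sub>i\<close> is separate because \<open>[x\<^sup>+\<^sub>i, x\<^sup>-\<^sub>i]\<close> is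
  the coroot and not an element of \<open>\<nn>\<^sup>-\<close>.\<close>

lemma jacobi_consts:
  assumes \<gamma>: "\<gamma> \<in> pos_roots G" and \<delta>: "\<delta> \<in> pos_roots G" and i: "i \<in> {1..rank G}"
    and ne: "\<gamma> \<noteq> sroot G i" "\<delta> \<noteq> sroot G i"
  shows "nconst \<gamma> \<delta> * pconst i (\<gamma> + \<delta>) = pconst i \<gamma> * nconst (\<gamma> - sroot G i) \<delta> + pconst i \<delta> * nconst \<gamma> (\<delta> - sroot G i)"
proof (cases "\<gamma> + \<delta> - sroot G i \<in> pos_roots G")
  case False
  have sums: "\<gamma> - sroot G i + \<delta> = \<gamma> + \<delta> - sroot G i" "\<gamma> + (\<delta> - sroot G i) = \<gamma> + \<delta> - sroot G i"
    by (simp_all add: algebra_simps)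
  show ?thesis
    unfolding pconst_def[of i "\<gamma> + \<delta>"] nconst_def[of "\<gamma> - sroot G i"] nconst_def[of \<gamma> "\<delta> - sroot G i"] sums
    using False by simp
next
  case True
  let ?a = "sroot G i" and ?x = "xminus G (\<gamma> + \<delta> - sroot G i)"
  note a = simple_pos[OF i]
  have sums: "\<gamma> - ?a + \<delta> = \<gamma> + \<delta> - ?a" "\<gamma> + (\<delta> - ?a) = \<gamma> + \<delta> - ?a"
    by (simp_all add: algebra_simps)
  have nz: "?x \<noteq> 0" by (rule root_vectors(4)[OF True])
  have h1: "height ?a = 1" by (rule height_simple[OF i])
  have l: "brk G (xplus G ?a) (brk G (xminus G \<gamma>) (xminus G \<delta>)) = scl G (nconst \<gamma> \<delta> * pconst i (\<gamma> + \<delta>)) ?x"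
  proof (cases "\<gamma> + \<delta> \<in> pos_roots G")
    case True
    have "\<gamma> + \<delta> \<noteq> ?a"
    proof
      assume "\<gamma> + \<delta> = ?a"
      then have "height (\<gamma> + \<delta>) = 1" using h1 by (simp only:)
      with height_pos[OF \<gamma>] height_pos[OF \<delta>] show False by simp
    qed
    then show ?thesis
      using brk_xminus[OF \<gamma> \<delta>] brk_xplus_xminus[OF True i] by (simp add: brk_scl_right)
  next
    case False
    then show ?thesis using brk_xminus[OF \<gamma> \<delta>] by (simp add: nconst_def)
  qed
  have r1: "brk G (brk G (xplus G ?a) (xminus G \<gamma>)) (xminus G \<delta>) = scl G (pconst i \<gamma> * nconst (\<gamma> - ?a) \<delta>) ?x"
  proof (cases "\<gamma> - ?a \<in> pos_roots G")
    case True
    then show ?thesis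
      using brk_xplus_xminus[OF \<gamma> i ne(1)] brk_xminus[OF True \<delta>] by (simp add: brk_scl_left sums)
  next
    case False
    then show ?thesis using brk_xplus_xminus[OF \<gamma> i ne(1)] by (simp add: pconst_def)
  qed
  have r2: "brk G (xminus G \<gamma>) (brk G (xplus G ?a) (xminus G \<delta>)) = scl G (pconst i \<delta> * nconst \<gamma> (\<delta> - ?a)) ?x"
  proof (cases "\<delta> - ?a \<in> pos_roots G")
    case True
    then show ?thesis
      using brk_xplus_xminus[OF \<delta> i ne(2)] brk_xminus[OF \<gamma> True] by (simp add: brk_scl_right sums)
  next
    case False
    then show ?thesis using brk_xplus_xminus[OF \<delta> i ne(2)] by (simp add: pconst_def)
  qed
  have "scl G (nconst \<gamma> \<delta> * pconst i (\<gamma> + \<delta>)) ?x =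
      scl G (pconst i \<gamma> * nconst (\<gamma> - ?a) \<delta> + pconst i \<delta> * nconst \<gamma> (\<delta> - ?a)) ?x"
    using jacobi[of "xplus G ?a" "xminus G \<gamma>" "xminus G \<delta>"] l r1 r2 by (simp add: scale_left_distrib)
  with nz show ?thesis by (simp only: scale_cancel_right) simp
qed

lemma jacobi_consts_simple:
  assumes \<delta>: "\<delta> \<in> pos_roots G" and i: "i \<in> {1..rank G}" and ne: "\<delta> \<noteq> sroot G i"
  shows "nconst (sroot G i) \<delta> * pconst i (sroot G i + \<delta>) =
    pconst i \<delta> * nconst (sroot G i) (\<delta> - sroot G i) - \<delta> (coroot G (sroot G i))"
proof -
  let ?a = "sroot G i" and ?x = "xminus G \<delta>"
  note a = simple_pos[OF i]
  have sums: "?a + (\<delta> - ?a) = \<delta>" "?a + \<delta> - ?a = \<delta>" by simp_all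
  have nz: "?x \<noteq> 0" by (rule root_vectors(4)[OF \<delta>])
  have l: "brk G (xplus G ?a) (brk G (xminus G ?a) ?x) = scl G (nconst ?a \<delta> * pconst i (?a + \<delta>)) ?x"
  proof (cases "?a + \<delta> \<in> pos_roots G")
    case True
    have "?a + \<delta> \<noteq> ?a" using rootD(2)[OF pos_rootD[OF \<delta>]] by simp
    then show ?thesis
      using brk_xminus[OF a \<delta>] brk_xplus_xminus[OF True i] unfolding sums by (simp add: brk_scl_right)
  next
    case False
    then show ?thesis using brk_xminus[OF a \<delta>] by (simp add: nconst_def)
  qed
  have r1: "brk G (brk G (xplus G ?a) (xminus G ?a)) ?x = scl G (- \<delta> (coroot G ?a)) ?x"
    using coroot_weight[OF a root_vectors(3)[OF \<delta>]] root_vectors(5)[OF a] by simp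
  have r2: "brk G (xminus G ?a) (brk G (xplus G ?a) ?x) = scl G (pconst i \<delta> * nconst ?a (\<delta> - ?a)) ?x"
  proof (cases "\<delta> - ?a \<in> pos_roots G")
    case True
    then show ?thesis
      using brk_xplus_xminus[OF \<delta> i ne] brk_xminus[OF a True] unfolding sums by (simp add: brk_scl_right)
  next
    case False
    then show ?thesis using brk_xplus_xminus[OF \<delta> i ne] by (simp add: pconst_def)
  qed
  have "scl G (nconst ?a \<delta> * pconst i (?a + \<delta>)) ?x = scl G (- \<delta> (coroot G ?a) + pconst i \<delta> * nconst ?a (\<delta> - ?a)) ?x"
    using jacobi[of "xplus G ?a" "xminus G ?a" ?x] l r1 r2 by (simp only: scale_left_distrib)
  with nz show ?thesis by (simp only: scale_cancel_right) simp
qed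

end

text \<open>The free algebra over the positive roots serves as a Verma module of highest weight \<open>\<mu>\<close>: the word
  \<open>\<gamma>\<^sub>1 \<dots> \<gamma>\<^sub>n\<close> stands for \<open>x\<^sup>-\<^bsub>\<gamma>\<^sub>1\<^esub> \<dots> x\<^sup>-\<^bsub>\<gamma>\<^sub>n\<^esub>\<close> applied to the highest weight vector, \<open>E i\<close> and \<open>H i\<close> are the actions of
  \<open>x\<^sup>+\<^sub>i\<close> and \<open>\<alpha>\<^sub>i\<^sup>\<or>\<close>, and \<open>K\<close> is the submodule of relations of the integrable quotient.\<close>

locale dominant_weight = simple_datum G
  for G :: "'g::ab_group_add lie_datum" +
  fixes \<mu> :: "'g \<Rightarrow> complex" and N :: "('g \<Rightarrow> complex) \<Rightarrow> nat"
  assumes weight: "\<mu> \<in> hstar G" and coroot_value: "\<And>\<alpha>. \<alpha> \<in> pos_roots G \<Longrightarrow> \<mu> (coroot G \<alpha>) = of_nat (N \<alpha>)"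
begin

abbreviation x :: "('g \<Rightarrow> complex) \<Rightarrow> ('g \<Rightarrow> complex) fword \<Rightarrow>\<^sub>0 complex" where "x \<gamma> \<equiv> word [\<gamma>]"

abbreviation hc :: "nat \<Rightarrow> 'g" where "hc i \<equiv> coroot G (sroot G i)"

definition hval :: "nat \<Rightarrow> ('g \<Rightarrow> complex) list \<Rightarrow> complex" where
  "hval i ws = \<mu> (hc i) - (\<Sum>\<delta>\<leftarrow>ws. \<delta> (hc i))"

text \<open>The raising operator moves to the right through the word, producing a commutator at each letter, until it
  annihilates the highest weight vector.\<close>

primrec ew :: "nat \<Rightarrow> ('g \<Rightarrow> complex) list \<Rightarrow> ('g \<Rightarrow> complex) fword \<Rightarrow>\<^sub>0 complex" where
  "ew i [] = 0"
| "ew i (\<gamma> # ws) = x \<gamma> * ew i ws + (if \<gamma> = sroot G i then cst (hval i ws) * word ws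
     else cst (pconst i \<gamma>) * (x (\<gamma> - sroot G i) * word ws))"

definition H :: "nat \<Rightarrow> (('g \<Rightarrow> complex) fword \<Rightarrow>\<^sub>0 complex) \<Rightarrow> ('g \<Rightarrow> complex) fword \<Rightarrow>\<^sub>0 complex" where
  "H i = lin (\<lambda>ws. cst (hval i ws) * word ws)"

definition E :: "nat \<Rightarrow> (('g \<Rightarrow> complex) fword \<Rightarrow>\<^sub>0 complex) \<Rightarrow> ('g \<Rightarrow> complex) fword \<Rightarrow>\<^sub>0 complex" where
  "E i = lin (ew i)"

lemma E_linear: "E i (p + q) = E i p + E i q" "E i (cst c * p) = cst c * E i p" "E i 0 = 0" "E i (p - q) = E i p - E i q"
  and H_linear: "H i (p + q) = H i p + H i q" "H i (cst c * p) = cst c * H i p" "H i 0 = 0" "H i (p - q) = H i p - H i q"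
  by (simp_all add: E_def H_def lin_add lin_cst lin_diff)

lemma E_x: "E i (x \<gamma> * p) = x \<gamma> * E i p + (if \<gamma> = sroot G i then H i p
     else cst (pconst i \<gamma>) * (x (\<gamma> - sroot G i) * p))"
proof (induction p rule: word_induct)
  case (1 ws)
  then show ?case
    by (simp add: E_def H_def lin_word flip: word_Cons)
next
  case (2 c p)
  have "E i (x \<gamma> * (cst c * p)) = cst c * E i (x \<gamma> * p)"
    by (simp only: word_cst E_linear)
  then show ?case
    using 2 by (auto simp: E_linear H_linear distrib_left word_cst cst_left_commute)
qed (auto simp: distrib_left E_linear H_linear)

lemma H_x: "H i (x \<gamma> * p) = x \<gamma> * H i p - cst (\<gamma> (hc i)) * (x \<gamma> * p)"
proof (induction p rule: word_induct)
  case (1 ws)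
  have "hval i (\<gamma> # ws) = hval i ws - \<gamma> (hc i)" by (simp add: hval_def)
  then show ?case
    by (simp add: H_def lin_word cst_diff left_diff_distrib word_cst cst_left_commute flip: word_Cons)
next
  case (2 c p)
  have "H i (x \<gamma> * (cst c * p)) = cst c * H i (x \<gamma> * p)"
    by (simp only: word_cst H_linear)
  then show ?case
    using 2 by (simp add: H_linear right_diff_distrib word_cst cst_left_commute)
qed (simp add: distrib_left H_linear algebra_simps)

lemma E_word: "E i (word ws) = ew i ws"
  by (simp add: E_def lin_word)

lemma E_one: "E i 1 = 0" and H_one: "H i 1 = cst (\<mu> (hc i))"
  using lin_word[of "ew i" "[]"] lin_word[of "\<lambda>ws. cst (hval i ws) * word ws" "[]"]
  by (simp_all add: E_def H_def hval_def word_Nil)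

definition commutator_rel :: "('g \<Rightarrow> complex) \<Rightarrow> ('g \<Rightarrow> complex) \<Rightarrow> (('g \<Rightarrow> complex) fword \<Rightarrow>\<^sub>0 complex) \<Rightarrow> ('g \<Rightarrow> complex) fword \<Rightarrow>\<^sub>0 complex" where
  "commutator_rel \<gamma> \<delta> p = x \<gamma> * (x \<delta> * p) - x \<delta> * (x \<gamma> * p) - cst (nconst \<gamma> \<delta>) * (x (\<gamma> + \<delta>) * p)"

text \<open>A left ideal.  The relations of \<open>\<nn>\<^sup>-\<close> generate a two-sided ideal, hence their arbitrary right factor \<open>p\<close> inside
  \<open>commutator_rel\<close>; the powers of the simple generators enter with left multiples only.\<close>

inductive_set K :: "(('g \<Rightarrow> complex) fword \<Rightarrow>\<^sub>0 complex) set" where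
  zero: "0 \<in> K"
| add: "p \<in> K \<Longrightarrow> q \<in> K \<Longrightarrow> p + q \<in> K"
| scale: "p \<in> K \<Longrightarrow> cst c * p \<in> K"
| left: "\<gamma> \<in> pos_roots G \<Longrightarrow> p \<in> K \<Longrightarrow> x \<gamma> * p \<in> K"
| rel: "\<gamma> \<in> pos_roots G \<Longrightarrow> \<delta> \<in> pos_roots G \<Longrightarrow> commutator_rel \<gamma> \<delta> p \<in> K"
| gen: "i \<in> {1..rank G} \<Longrightarrow> x (sroot G i) ^ Suc (N (sroot G i)) \<in> K"

lemma K_uminus: "p \<in> K \<Longrightarrow> - p \<in> K"
  using K.scale[of p "- 1"] by (simp add: cst_uminus)

lemma K_diff: "p \<in> K \<Longrightarrow> q \<in> K \<Longrightarrow> p - q \<in> K"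
  using K.add[OF _ K_uminus, of p q] by simp

lemma H_power: "H i (x \<gamma> ^ n) = cst (\<mu> (hc i) - of_nat n * \<gamma> (hc i)) * x \<gamma> ^ n"
proof (induction n)
  case 0
  then show ?case by (simp add: H_one)
next
  case (Suc n)
  have "cst (\<mu> (hc i) - of_nat (Suc n) * \<gamma> (hc i)) = cst (\<mu> (hc i) - of_nat n * \<gamma> (hc i)) - cst (\<gamma> (hc i))"
    unfolding cst_diff[symmetric] by (simp add: algebra_simps)
  moreover have "H i (x \<gamma> ^ Suc n) = (cst (\<mu> (hc i) - of_nat n * \<gamma> (hc i)) - cst (\<gamma> (hc i))) * x \<gamma> ^ Suc n"
    by (simp add: H_x Suc.IH word_cst cst_left_commute left_diff_distrib)
  ultimately show ?case by metis
qed

lemma H_commutator_rel: "H i (commutator_rel \<gamma> \<delta> p) = commutator_rel \<gamma> \<delta> (H i p) - cst ((\<gamma> + \<delta>) (hc i)) * commutator_rel \<gamma> \<delta> p"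
  unfolding commutator_rel_def H_linear H_x
  by (simp add: cst_add algebra_simps word_cst cst_left_commute)

lemma H_K: "p \<in> K \<Longrightarrow> H i p \<in> K"
proof (induction rule: K.induct)
  case (left \<gamma> p)
  then show ?case unfolding H_x by (intro K_diff K.left K.scale)
next
  case (rel \<gamma> \<delta> p)
  then show ?case unfolding H_commutator_rel by (intro K_diff K.rel K.scale)
next
  case (gen j)
  then show ?case unfolding H_power by (intro K.gen K.scale)
qed (auto simp: H_linear intro: K.intros)

text \<open>The terms of the commutator of \<open>E i\<close> with a relation are relations with a lower index, up to coefficients that
  vanish by the Jacobi identity.\<close>

lemma E_commutator_rel:
  assumes \<gamma>: "\<gamma> \<in> pos_roots G" and \<delta>: "\<delta> \<in> pos_roots G" and i: "i \<in> {1..rank G}"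
  shows "E i (commutator_rel \<gamma> \<delta> p) - commutator_rel \<gamma> \<delta> (E i p) \<in> K"
proof -
  let ?a = "sroot G i"
  note a = simple_pos[OF i]
  have sum_ne: "\<gamma> + \<delta> \<noteq> ?a" if "\<gamma> \<in> pos_roots G" "\<delta> \<in> pos_roots G" for \<gamma> \<delta>
  proof
    assume "\<gamma> + \<delta> = ?a"
    then have "height (\<gamma> + \<delta>) = 1" using height_simple[OF i] by (simp only:)
    with height_pos[OF that(1)] height_pos[OF that(2)] show False by simp
  qed
  have P_rel: "cst (pconst i \<gamma>) * commutator_rel (\<gamma> - ?a) \<delta> p \<in> K" "cst (pconst i \<gamma>) * commutator_rel \<delta> (\<gamma> - ?a) p \<in> K"
    if "\<delta> \<in> pos_roots G" for \<gamma> \<delta>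
  proof -
    have "cst (pconst i \<gamma>) * commutator_rel (\<gamma> - ?a) \<delta> p \<in> K \<and> cst (pconst i \<gamma>) * commutator_rel \<delta> (\<gamma> - ?a) p \<in> K"
    proof (cases "\<gamma> - ?a \<in> pos_roots G")
      case True
      then show ?thesis using that by (intro conjI K.scale K.rel)
    next
      case False
      then show ?thesis by (simp add: pconst_def K.zero)
    qed
    then show "cst (pconst i \<gamma>) * commutator_rel (\<gamma> - ?a) \<delta> p \<in> K" "cst (pconst i \<gamma>) * commutator_rel \<delta> (\<gamma> - ?a) p \<in> K" by auto
  qed
  have simple: "E i (commutator_rel ?a \<delta> p) - commutator_rel ?a \<delta> (E i p) \<in> K"
    if \<delta>: "\<delta> \<in> pos_roots G" "\<delta> \<noteq> ?a" for \<delta>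
  proof -
    have s: "?a + (\<delta> - ?a) = \<delta>" "?a + \<delta> - ?a = \<delta>" by simp_all
    have "E i (commutator_rel ?a \<delta> p) - commutator_rel ?a \<delta> (E i p) =
        cst (pconst i \<delta>) * commutator_rel ?a (\<delta> - ?a) p
        + (cst (pconst i \<delta> * nconst ?a (\<delta> - ?a) - \<delta> (hc i) - nconst ?a \<delta> * pconst i (?a + \<delta>)) * (x \<delta> * p))"
      using \<delta>(2) sum_ne[OF a \<delta>(1)]
      unfolding commutator_rel_def E_linear E_x H_x s
      by (simp add: cst_diff cst_add cst_mult algebra_simps word_cst cst_left_commute s)
    then show ?thesis
      using P_rel(2)[OF a, of \<delta>] jacobi_consts_simple[OF \<delta>(1) i \<delta>(2)] by simp
  qed
  have swap: "commutator_rel \<gamma> \<delta> p = - commutator_rel \<delta> \<gamma> p" for p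
    using nconst_anti[OF \<gamma> \<delta>] by (simp add: commutator_rel_def cst_uminus add.commute[of \<gamma>])
  consider "\<gamma> = ?a" "\<delta> = ?a" | "\<gamma> = ?a" "\<delta> \<noteq> ?a" | "\<gamma> \<noteq> ?a" "\<delta> = ?a" | "\<gamma> \<noteq> ?a" "\<delta> \<noteq> ?a" by blast
  then show ?thesis
  proof cases
    case 1
    have "nconst ?a ?a = 0" using nconst_anti[OF a a] by simp
    then show ?thesis using 1 by (simp add: commutator_rel_def E_linear K.zero)
  next
    case 2
    then show ?thesis using simple[OF \<delta>] by simp
  next
    case 3
    have "E i (commutator_rel \<gamma> \<delta> p) - commutator_rel \<gamma> \<delta> (E i p) = - (E i (commutator_rel \<delta> \<gamma> p) - commutator_rel \<delta> \<gamma> (E i p))"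
      unfolding swap using E_linear(4)[of i 0 "commutator_rel \<delta> \<gamma> p"] by (simp add: E_linear)
    moreover have "E i (commutator_rel \<delta> \<gamma> p) - commutator_rel \<delta> \<gamma> (E i p) \<in> K"
      using simple[OF \<gamma>] 3 by simp
    ultimately show ?thesis using K_uminus by metis
  next
    case 4
    have s: "\<gamma> - ?a + \<delta> = \<gamma> + \<delta> - ?a" "\<gamma> + (\<delta> - ?a) = \<gamma> + \<delta> - ?a" by (simp_all add: algebra_simps)
    have "E i (commutator_rel \<gamma> \<delta> p) - commutator_rel \<gamma> \<delta> (E i p) =
        cst (pconst i \<delta>) * commutator_rel \<gamma> (\<delta> - ?a) p + cst (pconst i \<gamma>) * commutator_rel (\<gamma> - ?a) \<delta> p
        + (cst (pconst i \<gamma> * nconst (\<gamma> - ?a) \<delta> + pconst i \<delta> * nconst \<gamma> (\<delta> - ?a) - nconst \<gamma> \<delta> * pconst i (\<gamma> + \<delta>)) * (x (\<gamma> + \<delta> - ?a) * p))"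
      using 4 sum_ne[OF \<gamma> \<delta>]
      unfolding commutator_rel_def E_linear E_x s
      by (simp add: cst_diff cst_add cst_mult distrib_left distrib_right right_diff_distrib left_diff_distrib mult.assoc word_cst cst_left_commute)
    then show ?thesis
      using P_rel(1)[OF \<delta>, of \<gamma>] P_rel(2)[OF \<gamma>, of \<delta>] jacobi_consts[OF \<gamma> \<delta> i 4] K.add by simp
  qed
qed

text \<open>The invariant subspace is a parameter: \<open>K\<close> is known to be invariant only after a first application with \<open>{0}\<close>.\<close>

lemma sl2_free:
  assumes i: "i \<in> {1..rank G}"
    and K': "module.subspace (\<lambda>c p. cst c * p) K'" "\<And>u. u \<in> K' \<Longrightarrow> E i u \<in> K'" "\<And>u. u \<in> K' \<Longrightarrow> x (sroot G i) * u \<in> K'"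
  shows "sl2_weights (\<lambda>c p. cst c * p) (E i) (\<lambda>p. x (sroot G i) * p) K' (\<lambda>c. {p. H i p = cst c * p})"
proof -
  interpret V: vector_space "\<lambda>c p. cst c * (p :: ('g \<Rightarrow> complex) fword \<Rightarrow>\<^sub>0 complex)" by (rule vector_space_cst)
  have two: "sroot G i (hc i) = 2" by (rule root_coroot_self[OF simple_root[OF i]])
  have HE: "H i (E i p) = E i (H i p) + cst 2 * E i p" for p
  proof -
    have "H i (ew i ws) = E i (H i (word ws)) + cst 2 * ew i ws" for ws
    proof (induction ws)
      case Nil
      then show ?case by (simp add: H_linear H_def lin_word word_Nil[symmetric]) (simp add: word_Nil E_linear E_def lin_cst lin_word flip: word_Nil)
    next
      case (Cons \<gamma> ws)
      have HW: "H i (word ws) = cst (hval i ws) * word ws" for ws by (simp add: H_def lin_word)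
      have EW: "E i (word ws) = ew i ws" for ws by (simp add: E_def lin_word)
      have hv: "cst (hval i (\<gamma> # ws)) = cst (hval i ws) - cst (\<gamma> (hc i))"
        by (simp add: hval_def cst_diff cst_add)
      have IH: "H i (ew i ws) = cst (hval i ws) * ew i ws + cst 2 * ew i ws"
        using Cons.IH by (simp add: HW E_linear EW)
      have d: "cst ((\<gamma> - sroot G i) (hc i)) = cst (\<gamma> (hc i)) - cst 2"
        using two by (simp flip: cst_diff)
      have "H i (ew i (\<gamma> # ws)) = cst (hval i (\<gamma> # ws)) * ew i (\<gamma> # ws) + cst 2 * ew i (\<gamma> # ws)"
      proof (cases "\<gamma> = sroot G i")
        case True
        then show ?thesis
          unfolding hv using two
          by (simp add: H_linear H_x HW IH distrib_left distrib_right left_diff_distrib right_diff_distrib word_cst cst_left_commute algebra_simps)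
      next
        case False
        then show ?thesis
          unfolding hv
          by (simp add: H_linear H_x HW IH d distrib_left distrib_right left_diff_distrib right_diff_distrib word_cst cst_left_commute del: minus_apply)
            (simp add: algebra_simps)
      qed
      then show ?case by (simp only: HW E_linear EW)
    qed
    then show ?thesis
      by (induction p rule: word_induct) (simp_all add: H_linear E_linear E_word distrib_left word_cst cst_left_commute)
  qed
  show ?thesis
  proof unfold_locales
    show "E i u \<in> {p. H i p = cst (c + 2) * p}" if "u \<in> {p. H i p = cst c * p}" for u c
      using that by (simp add: HE E_linear cst_add distrib_right)
    show "x (sroot G i) * u \<in> {p. H i p = cst (c - 2) * p}" if "u \<in> {p. H i p = cst c * p}" for u c
      using that by (simp add: H_x two cst_diff left_diff_distrib word_cst cst_left_commute)
    show "E i (x (sroot G i) * u) - x (sroot G i) * E i u = cst c * u" if "u \<in> {p. H i p = cst c * p}" for u c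
      using that by (simp add: E_x)
  qed (use K' in \<open>auto simp: E_linear distrib_left word_cst cst_left_commute\<close>)
qed

text \<open>These powers are singular vectors: for \<open>i = j\<close> the factor \<open>\<mu>(\<alpha>\<^sub>i\<^sup>\<or>) - n + 1\<close> vanishes at \<open>n = N + 1\<close>.\<close>

lemma E_gen:
  assumes i: "i \<in> {1..rank G}" and j: "j \<in> {1..rank G}"
  shows "E i (x (sroot G j) ^ Suc (N (sroot G j))) = 0"
proof (cases "i = j")
  case True
  interpret V: vector_space "\<lambda>c p. cst c * (p :: ('g \<Rightarrow> complex) fword \<Rightarrow>\<^sub>0 complex)" by (rule vector_space_cst)
  interpret S: sl2_weights "\<lambda>c p. cst c * p" "E i" "\<lambda>p. x (sroot G i) * p" "{0}" "\<lambda>c. {p. H i p = cst c * p}"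
    by (rule sl2_free[OF i]) (auto simp: V.subspace_def E_linear)
  have pow: "((\<lambda>p. x (sroot G i) * p) ^^ n) 1 = x (sroot G i) ^ n" for n
    by (induction n) simp_all
  have pow0: "((\<lambda>p. x (sroot G i) * p) ^^ n) 0 = 0" for n
    by (induction n) simp_all
  have "1 \<in> {p. H i p = cst (\<mu> (hc i)) * p}" by (simp add: H_one)
  from S.e_f_pow[OF this, of "Suc (N (sroot G i))"]
  have "E i (x (sroot G i) ^ Suc (N (sroot G i))) = 0"
    using coroot_value[OF simple_pos[OF i]] unfolding pow E_one pow0 by simp
  then show ?thesis using True by simp
next
  case False
  have ne: "sroot G j \<noteq> sroot G i"
    using False coweight(2)[OF i, of i] coweight(2)[OF j, of i] by auto
  have "sroot G j - sroot G i \<notin> pos_roots G"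
    using height_pos[of "sroot G j - sroot G i"] height_simple[OF i] height_simple[OF j] by auto
  then have "E i (x (sroot G j) ^ n) = 0" for n
    by (induction n) (simp_all add: E_one E_x ne pconst_def)
  then show ?thesis .
qed

lemma E_K:
  assumes i: "i \<in> {1..rank G}"
  shows "p \<in> K \<Longrightarrow> E i p \<in> K"
proof (induction rule: K.induct)
  case (left \<gamma> p)
  then show ?case
    unfolding E_x by (cases "\<gamma> - sroot G i \<in> pos_roots G") (auto simp: pconst_def intro!: K.intros(1,2,3,4) H_K)
next
  case (rel \<gamma> \<delta> p)
  then show ?case
    using K.add[OF E_commutator_rel[OF rel i, of p] K.rel[OF rel, of "E i p"]] by simp
next
  case (gen j)
  then show ?case using E_gen[OF i gen] by (simp only: K.zero)
qed (auto simp: E_linear intro: K.intros)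

lemma K_subspace: "module.subspace (\<lambda>c p. cst c * p) K"
proof -
  interpret V: vector_space "\<lambda>c p. cst c * (p :: ('g \<Rightarrow> complex) fword \<Rightarrow>\<^sub>0 complex)" by (rule vector_space_cst)
  show ?thesis by (auto simp: V.subspace_def intro: K.intros)
qed

text \<open>The weight space of weight \<open>\<mu> - \<nu>\<close>.\<close>

definition words_of :: "('g \<Rightarrow> complex) \<Rightarrow> (('g \<Rightarrow> complex) fword \<Rightarrow>\<^sub>0 complex) set" where
  "words_of \<nu> = module.span (\<lambda>c p. cst c * p) {word ws | ws. set ws \<subseteq> pos_roots G \<and> sum_list ws = \<nu>}"

lemma words_of_base: "set ws \<subseteq> pos_roots G \<Longrightarrow> sum_list ws = \<nu> \<Longrightarrow> word ws \<in> words_of \<nu>"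
proof -
  interpret V: vector_space "\<lambda>c p. cst c * (p :: ('g \<Rightarrow> complex) fword \<Rightarrow>\<^sub>0 complex)" by (rule vector_space_cst)
  assume "set ws \<subseteq> pos_roots G" "sum_list ws = \<nu>"
  then show ?thesis unfolding words_of_def by (intro V.span_base) auto
qed

lemma words_of_closed:
  "0 \<in> words_of \<nu>" "p \<in> words_of \<nu> \<Longrightarrow> q \<in> words_of \<nu> \<Longrightarrow> p + q \<in> words_of \<nu>" "p \<in> words_of \<nu> \<Longrightarrow> cst c * p \<in> words_of \<nu>"
proof -
  interpret V: vector_space "\<lambda>c p. cst c * (p :: ('g \<Rightarrow> complex) fword \<Rightarrow>\<^sub>0 complex)" by (rule vector_space_cst)
  show "0 \<in> words_of \<nu>" unfolding words_of_def by (rule V.span_zero)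
  show "p \<in> words_of \<nu> \<Longrightarrow> q \<in> words_of \<nu> \<Longrightarrow> p + q \<in> words_of \<nu>" unfolding words_of_def by (rule V.span_add)
  show "p \<in> words_of \<nu> \<Longrightarrow> cst c * p \<in> words_of \<nu>" unfolding words_of_def by (rule V.span_scale)
qed

lemma words_of_induct [consumes 1, case_names zero add word]:
  assumes "p \<in> words_of \<nu>" "P 0" "\<And>p q. P p \<Longrightarrow> P q \<Longrightarrow> P (p + q)" "\<And>c ws. set ws \<subseteq> pos_roots G \<Longrightarrow> sum_list ws = \<nu> \<Longrightarrow> P (cst c * word ws)"
  shows "P p"
proof -
  interpret V: vector_space "\<lambda>c p. cst c * (p :: ('g \<Rightarrow> complex) fword \<Rightarrow>\<^sub>0 complex)" by (rule vector_space_cst)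
  show ?thesis
    using assms(1) unfolding words_of_def
    by (induction rule: V.span_induct_alt) (use assms(2-) in blast)+
qed

lemma words_of_x:
  assumes "\<gamma> \<in> pos_roots G" "p \<in> words_of \<nu>"
  shows "x \<gamma> * p \<in> words_of (\<gamma> + \<nu>)"
  using assms(2)
proof (induction rule: words_of_induct)
  case (word c ws)
  have "word (\<gamma> # ws) \<in> words_of (\<gamma> + \<nu>)"
    by (rule words_of_base) (use word assms(1) in simp_all)
  then show ?case
    unfolding word_cst word_Cons[symmetric] by (rule words_of_closed)
qed (auto simp: distrib_left intro: words_of_closed)

lemma ew_words_of:
  assumes i: "i \<in> {1..rank G}"
  shows "set ws \<subseteq> pos_roots G \<Longrightarrow> ew i ws \<in> words_of (sum_list ws - sroot G i)"
proof (induction ws)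
  case Nil
  then show ?case by (simp add: words_of_closed)
next
  case (Cons \<gamma> ws)
  then have g: "\<gamma> \<in> pos_roots G" and ws: "set ws \<subseteq> pos_roots G" by auto
  have "\<gamma> + (sum_list ws - sroot G i) = sum_list (\<gamma> # ws) - sroot G i"
    by (simp add: algebra_simps)
  then have m1: "x \<gamma> * ew i ws \<in> words_of (sum_list (\<gamma> # ws) - sroot G i)"
    using words_of_x[OF g Cons.IH[OF ws]] by metis
  have m2: "cst c * word ws \<in> words_of (sum_list (\<gamma> # ws) - sroot G i)" if "\<gamma> = sroot G i" for c
    using words_of_closed(3)[OF words_of_base[OF ws refl]] that by simp
  have m3: "cst (pconst i \<gamma>) * (x (\<gamma> - sroot G i) * word ws) \<in> words_of (sum_list (\<gamma> # ws) - sroot G i)"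
  proof (cases "\<gamma> - sroot G i \<in> pos_roots G")
    case True
    then have "x (\<gamma> - sroot G i) * word ws \<in> words_of (\<gamma> - sroot G i + sum_list ws)"
      using words_of_x words_of_base[OF ws refl] by blast
    moreover have "\<gamma> - sroot G i + sum_list ws = sum_list (\<gamma> # ws) - sroot G i" by (simp add: algebra_simps)
    ultimately show ?thesis using words_of_closed(3) by metis
  qed (simp add: pconst_def words_of_closed)
  show ?case
  proof (cases "\<gamma> = sroot G i")
    case True
    show ?thesis unfolding ew.simps if_P[OF True] by (rule words_of_closed(2)[OF m1 m2[OF True]])
  next
    case False
    show ?thesis unfolding ew.simps if_not_P[OF False] by (rule words_of_closed(2)[OF m1 m3])
  qed
qed

lemma E_words_of:
  assumes i: "i \<in> {1..rank G}" and p: "p \<in> words_of \<nu>"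
  shows "E i p \<in> words_of (\<nu> - sroot G i)"
  using p
proof (induction rule: words_of_induct)
  case (word c ws)
  show ?case
    unfolding E_linear E_word word(2)[symmetric] by (rule words_of_closed(3)[OF ew_words_of[OF i word(1)]])
qed (auto simp: E_linear intro: words_of_closed)

lemma height_sum_list: "set ws \<subseteq> pos_roots G \<Longrightarrow> height (sum_list ws) \<ge> 0"
proof (induction ws)
  case (Cons \<gamma> ws)
  have "height (sum_list (\<gamma> # ws)) = height \<gamma> + height (sum_list ws)"
    by (simp only: sum_list.Cons height_simps)
  then show ?case using height_pos[of \<gamma>] Cons by (auto simp del: sum_list.Cons)
qed simp

lemma words_of_negative:
  assumes "p \<in> words_of \<nu>" "height \<nu> < 0"
  shows "p = 0"
  using assms(1)
proof (induction rule: words_of_induct)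
  case (word c ws)
  then show ?case using height_sum_list[of ws] assms(2) by simp
qed auto

lemma E_pow_words_of:
  assumes i: "i \<in> {1..rank G}" and p: "p \<in> words_of \<nu>"
  shows "(E i ^^ n) p \<in> words_of (\<nu> - (\<lambda>x. of_nat n * sroot G i x))"
proof (induction n)
  case 0
  have "\<nu> - (\<lambda>x. of_nat 0 * sroot G i x) = \<nu>" by (simp add: fun_eq_iff)
  then show ?case using p by simp
next
  case (Suc n)
  have "\<nu> - (\<lambda>x. of_nat n * sroot G i x) - sroot G i = \<nu> - (\<lambda>x. of_nat (Suc n) * sroot G i x)"
    by (simp add: fun_eq_iff algebra_simps)
  then show ?case using E_words_of[OF i Suc.IH] by (simp only: funpow.simps o_apply)
qed

text \<open>Repeated raising makes the height of \<open>\<nu>\<close> negative.\<close>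

lemma E_nilpotent:
  assumes i: "i \<in> {1..rank G}" and p: "p \<in> words_of \<nu>"
  shows "\<exists>n. (E i ^^ n) p = 0"
proof -
  obtain n :: nat where n: "height \<nu> < real n" using reals_Archimedean2 by blast
  have "height (\<nu> - (\<lambda>x. of_nat n * sroot G i x)) = height \<nu> - real n"
    by (simp add: height_def height_elt(2)[OF i])
  with n words_of_negative[OF E_pow_words_of[OF i p, of n]] show ?thesis by auto
qed

text \<open>Modulo \<open>K\<close>, a lowering operator \<open>f\<close> acts nilpotently on \<open>x\<^sub>\<gamma> p\<close> if it does on \<open>p\<close>:
  \<open>f x\<^sub>\<gamma> p\<close> is \<open>x\<^sub>\<gamma> f p\<close> plus a multiple of \<open>x\<^sub>\<delta> p\<close> with \<open>\<delta>\<close> higher than \<open>\<gamma>\<close>.\<close>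

lemma lowering_nilpotent_step:
  assumes a: "a \<in> pos_roots G"
  shows "\<gamma> \<in> pos_roots G \<Longrightarrow> x a ^ n * p \<in> K \<Longrightarrow> \<exists>m. x a ^ m * (x \<gamma> * p) \<in> K"
proof (induction "nat \<lfloor>height \<theta> - height \<gamma>\<rfloor>" arbitrary: \<gamma> p n rule: less_induct)
  case less
  have mono: "x a ^ m' * q \<in> K" if "x a ^ m * q \<in> K" "m \<le> m'" for m m' q
  proof -
    have "x a ^ (k + m) * q \<in> K" for k
      using that(1) K.left[OF a] by (induction k) (auto simp: mult.assoc)
    from this[of "m' - m"] that(2) show ?thesis by simp
  qed
  show ?case
    using less.prems(2)
  proof (induction n arbitrary: p)
    case 0
    then show ?case using K.left[OF less.prems(1), of p] by (intro exI[of _ 0]) simp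
  next
    case (Suc n)
    have "x a ^ n * (x a * p) \<in> K" using Suc.prems by (simp add: power_commutes mult.assoc[symmetric])
    then obtain m1 where m1: "x a ^ m1 * (x \<gamma> * (x a * p)) \<in> K" using Suc.IH by blast
    obtain m2 where m2: "x a ^ m2 * (cst (nconst a \<gamma>) * (x (a + \<gamma>) * p)) \<in> K"
    proof (cases "a + \<gamma> \<in> pos_roots G")
      case True
      have h: "height (a + \<gamma>) = height a + height \<gamma>" "height (a + \<gamma>) \<le> height \<theta>"
        using height_le_highest[OF pos_rootD[OF True]] by (simp_all only: height_simps)
      then have "nat \<lfloor>height \<theta> - height (a + \<gamma>)\<rfloor> < nat \<lfloor>height \<theta> - height \<gamma>\<rfloor>"
        using height_pos[OF a] by linarith
      from less.hyps[OF this True Suc.prems] obtain m where "x a ^ m * (x (a + \<gamma>) * p) \<in> K" by blast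
      from K.scale[OF this, of "nconst a \<gamma>"] show ?thesis
        using that[of m] by (simp add: mult_cst_left)
    next
      case False
      then show ?thesis using that[of 0] by (simp add: nconst_def K.zero)
    qed
    let ?m = "max m1 m2"
    have "x a ^ ?m * commutator_rel a \<gamma> p \<in> K"
      by (rule mono[of 0]) (use K.rel[OF a less.prems(1)] in auto)
    moreover have "x a ^ ?m * (x \<gamma> * (x a * p)) \<in> K" by (rule mono[OF m1]) simp
    moreover have "x a ^ ?m * (cst (nconst a \<gamma>) * (x (a + \<gamma>) * p)) \<in> K" by (rule mono[OF m2]) simp
    ultimately have "x a ^ ?m * commutator_rel a \<gamma> p + x a ^ ?m * (x \<gamma> * (x a * p)) + x a ^ ?m * (cst (nconst a \<gamma>) * (x (a + \<gamma>) * p)) \<in> K"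
      by (intro K.add)
    also have "x a ^ ?m * commutator_rel a \<gamma> p + x a ^ ?m * (x \<gamma> * (x a * p)) + x a ^ ?m * (cst (nconst a \<gamma>) * (x (a + \<gamma>) * p)) = x a ^ Suc ?m * (x \<gamma> * p)"
      unfolding commutator_rel_def distrib_left[symmetric] by (simp add: power_commutes mult.assoc[symmetric])
    finally show ?case by blast
  qed
qed

lemma lowering_nilpotent:
  assumes i: "i \<in> {1..rank G}"
  shows "set ws \<subseteq> pos_roots G \<Longrightarrow> \<exists>m. x (sroot G i) ^ m * word ws \<in> K"
proof (induction ws)
  case Nil
  then show ?case using K.gen[OF i] by (metis mult.right_neutral word_Nil)
next
  case (Cons \<gamma> ws)
  then obtain n where "x (sroot G i) ^ n * word ws \<in> K" by auto
  from lowering_nilpotent_step[OF simple_pos[OF i] _ this, of \<gamma>] Cons.prems show ?case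
    by (simp add: word_Cons[of \<gamma> ws])
qed

definition weights :: "('g \<Rightarrow> complex) set" where
  "weights = {\<mu> - sum_list ws | ws. set ws \<subseteq> pos_roots G \<and> word ws \<notin> K}"

lemma exists_word_notin_K:
  assumes "p \<in> words_of \<nu>" "p \<notin> K"
  shows "\<mu> - \<nu> \<in> weights"
proof (rule ccontr)
  assume neg: "\<mu> - \<nu> \<notin> weights"
  have "p \<in> K" using assms(1)
  proof (induction rule: words_of_induct)
    case (word c ws)
    then have "word ws \<in> K" using neg by (auto simp: weights_def)
    then show ?case by (rule K.scale)
  qed (auto intro: K.intros)
  with assms(2) show False by simp
qed

lemma sum_list_hstar: "set ws \<subseteq> pos_roots G \<Longrightarrow> sum_list ws \<in> hstar G"
  by (induction ws) (auto intro: hstar_add hstar_zero pos_root_hstar)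

lemma weights_hstar: "\<kappa> \<in> weights \<Longrightarrow> \<kappa> \<in> hstar G"
  using sum_list_hstar weight hstar_diff by (auto simp: weights_def)

lemma sum_list_apply: "sum_list ws y = (\<Sum>\<delta>\<leftarrow>ws. \<delta> y)" for ws :: "('g \<Rightarrow> complex) list"
  by (induction ws) simp_all

lemma sum_list_integer:
  assumes "\<alpha> \<in> pos_roots G" "set ws \<subseteq> pos_roots G"
  shows "\<exists>z::int. sum_list ws (coroot G \<alpha>) = of_int z"
  using assms(2)
proof (induction ws)
  case Nil
  then show ?case by (intro exI[of _ 0]) simp
next
  case (Cons \<gamma> ws)
  then obtain z where "sum_list ws (coroot G \<alpha>) = of_int z" by auto
  moreover obtain y where "\<gamma> (coroot G \<alpha>) = of_int y"
    using root_integer[OF assms(1) pos_rootD] Cons.prems by (metis list.set_intros(1) subsetD)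
  ultimately show ?case by (intro exI[of _ "y + z"]) simp
qed

text \<open>By injectivity of the suitable power of \<open>x\<^sup>-\<^sub>i\<close> or \<open>x\<^sup>+\<^sub>i\<close>, a vector of weight \<open>\<kappa>\<close> outside \<open>K\<close> is carried to a vector of the
  reflected weight outside \<open>K\<close>.\<close>

lemma weights_refl_simple:
  assumes i: "i \<in> {1..rank G}" and \<kappa>: "\<kappa> \<in> weights"
  shows "refl (sroot G i) \<kappa> \<in> weights"
proof -
  let ?a = "sroot G i"
  note a = simple_pos[OF i]
  interpret S: sl2_weights "\<lambda>c p. cst c * p" "E i" "\<lambda>p. x ?a * p" K "\<lambda>c. {p. H i p = cst c * p}"
    by (rule sl2_free[OF i K_subspace E_K[OF i] K.left[OF a]])
  interpret D: sl2_weights "\<lambda>c p. cst c * p" "\<lambda>p. x ?a * p" "E i" K "\<lambda>c. {p. H i p = cst (- c) * p}"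
    by (rule S.dual)
  obtain ws where ws: "set ws \<subseteq> pos_roots G" "word ws \<notin> K" "\<kappa> = \<mu> - sum_list ws"
    using \<kappa> by (auto simp: weights_def)
  have pow: "((\<lambda>p. x ?a * p) ^^ n) p = x ?a ^ n * p" for n p
    by (induction n) (simp_all add: mult.assoc)
  obtain y :: int where "sum_list ws (hc i) = of_int y" using sum_list_integer[OF a ws(1)] by blast
  then have "\<kappa> (hc i) = of_int (int (N ?a) - y)" using ws(3) coroot_value[OF a] by simp
  then obtain z :: int where z: "\<kappa> (hc i) = of_int z" by blast
  have wt: "word ws \<in> {p. H i p = cst (of_int z) * p}"
    using z ws(3) by (simp add: H_def lin_word hval_def sum_list_apply)
  have base: "word ws \<in> words_of (sum_list ws)" by (rule words_of_base[OF ws(1) refl])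
  show ?thesis
  proof (cases "z \<ge> 0")
    case True
    define n where "n = nat z"
    have zn: "of_int z = (of_nat n :: complex)" using True by (simp add: n_def)
    obtain r where "(E i ^^ r) (word ws) = 0" using E_nilpotent[OF i base] by blast
    then have "x ?a ^ n * word ws \<notin> K"
      using S.f_pow_injective[of "word ws" n r] wt ws(2) K.zero unfolding zn pow by auto
    then have nK: "word (replicate n ?a @ ws) \<notin> K" by (simp add: word_append word_replicate)
    have "sum_list (replicate n ?a) = (\<lambda>y. of_nat n * ?a y)"
      by (induction n) (simp_all add: fun_eq_iff algebra_simps)
    then have "refl ?a \<kappa> = \<mu> - sum_list (replicate n ?a @ ws)"
      unfolding refl_def z zn by (simp add: ws(3) fun_eq_iff)
    then show ?thesis using nK ws(1) a by (auto simp: weights_def intro!: exI[of _ "replicate n ?a @ ws"])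
  next
    case False
    define n where "n = nat (- z)"
    have zn: "of_int z = (- of_nat n :: complex)" using False by (simp add: n_def)
    obtain r where "x ?a ^ r * word ws \<in> K" using lowering_nilpotent[OF i ws(1)] by blast
    then have "(E i ^^ n) (word ws) \<notin> K"
      using D.f_pow_injective[of "word ws" n r] wt ws(2) unfolding zn pow by auto
    from exists_word_notin_K[OF E_pow_words_of[OF i base] this]
    have "\<mu> - (sum_list ws - (\<lambda>x. of_nat n * ?a x)) \<in> weights" .
    moreover have "\<mu> - (sum_list ws - (\<lambda>x. of_nat n * ?a x)) = refl ?a \<kappa>"
      unfolding refl_def z zn by (simp add: ws(3) fun_eq_iff)
    ultimately show ?thesis by simp
  qed
qed

lemma refl_conjugate:
  assumes a: "a \<in> roots G" and \<alpha>: "\<alpha> \<in> roots G" "refl a \<alpha> \<in> roots G" and \<kappa>: "\<kappa> \<in> hstar G"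
  shows "refl \<alpha> \<kappa> = refl a (refl (refl a \<alpha>) (refl a \<kappa>))"
proof -
  have "refl a \<kappa> (coroot G (refl a \<alpha>)) = dnum G (refl a \<alpha>) * wform G (refl a \<kappa>) (refl a \<alpha>)"
    by (rule eval_coroot_wform[OF refl_hstar[OF a \<kappa>] \<alpha>(2)])
  also have "\<dots> = dnum G \<alpha> * wform G \<kappa> \<alpha>"
    unfolding dnum_def by (simp add: wform_refl[OF a] rootD(1)[OF \<alpha>(1)] \<kappa>)
  also have "\<dots> = \<kappa> (coroot G \<alpha>)" by (rule eval_coroot_wform[OF \<kappa> \<alpha>(1), symmetric])
  finally have "refl (refl a \<alpha>) (refl a \<kappa>) = refl a \<kappa> - (\<lambda>y. \<kappa> (coroot G \<alpha>) * refl a \<alpha> y)"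
    by (simp add: refl_def[of "refl a \<alpha>"])
  moreover have "refl a (\<beta> - (\<lambda>y. c * \<gamma> y)) = refl a \<beta> - (\<lambda>y. c * refl a \<gamma> y)" for \<beta> \<gamma> c
    by (rule ext) (simp add: refl_def algebra_simps)
  ultimately show ?thesis
    by (simp only: refl_refl[OF a]) (simp only: refl_def)
qed

lemma weights_refl:
  assumes "\<alpha> \<in> pos_roots G"
  shows "\<kappa> \<in> weights \<Longrightarrow> refl \<alpha> \<kappa> \<in> weights"
  using assms
proof (induction \<alpha> arbitrary: \<kappa> rule: pos_root_induct)
  case (simple i)
  then show ?case by (rule weights_refl_simple)
next
  case (refl i \<alpha> c)
  then show ?case
    using weights_refl_simple[OF refl(1)] weights_hstar pos_rootD
      refl_conjugate[OF simple_root[OF refl(1)], of \<alpha> \<kappa>] by metis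
qed

text \<open>The weight \<open>\<mu> - (N + 1) \<alpha>\<close> of this power is the reflection of \<open>\<mu> + \<alpha>\<close>, which is not a weight.\<close>

lemma power_in_K:
  assumes \<alpha>: "\<alpha> \<in> pos_roots G"
  shows "x \<alpha> ^ Suc (N \<alpha>) \<in> K"
proof (rule ccontr)
  let ?n = "Suc (N \<alpha>)"
  assume "x \<alpha> ^ ?n \<notin> K"
  then have nK: "word (replicate ?n \<alpha>) \<notin> K" by (simp add: word_replicate del: replicate_Suc)
  have s: "sum_list (replicate n \<alpha>) = (\<lambda>y. of_nat n * \<alpha> y)" for n
    by (induction n) (simp_all add: fun_eq_iff algebra_simps)
  have "\<mu> - sum_list (replicate ?n \<alpha>) \<in> weights"
    unfolding weights_def using nK \<alpha> by (intro CollectI exI[of _ "replicate ?n \<alpha>"]) auto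
  from weights_refl[OF \<alpha> this] have "refl \<alpha> (\<mu> - sum_list (replicate ?n \<alpha>)) \<in> weights" .
  moreover have "refl \<alpha> (\<mu> - sum_list (replicate ?n \<alpha>)) = \<mu> + \<alpha>"
    unfolding s using coroot_value[OF \<alpha>] root_coroot_self[OF pos_rootD[OF \<alpha>]]
    by (simp add: refl_def fun_eq_iff algebra_simps)
  ultimately obtain ws where ws: "set ws \<subseteq> pos_roots G" "\<mu> + \<alpha> = \<mu> - sum_list ws"
    by (auto simp: weights_def)
  from arg_cong[OF ws(2), of height] have "height (sum_list ws) = - height \<alpha>" by simp
  with height_sum_list[OF ws(1)] height_pos[OF \<alpha>] show False by simp
qed

end

locale left_ideal =
  fixes A :: "'r::ring_1 set"
  assumes zero_mem: "0 \<in> A" and add_mem: "a \<in> A \<Longrightarrow> b \<in> A \<Longrightarrow> a + b \<in> A" and mult_mem: "a \<in> A \<Longrightarrow> r * a \<in> A"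
begin

lemma uminus_mem: "a \<in> A \<Longrightarrow> - a \<in> A"
  using mult_mem[of a "- 1"] by simp

lemma diff_mem: "a \<in> A \<Longrightarrow> b \<in> A \<Longrightarrow> a - b \<in> A"
  using add_mem[OF _ uminus_mem] by force

lemma power_mem_mono: "a ^ n \<in> A \<Longrightarrow> n \<le> n' \<Longrightarrow> a ^ n' \<in> A"
  using mult_mem[of "a ^ n" "a ^ (n' - n)"] by (simp add: power_add[symmetric])

lemma sum_mem: "(\<And>i. i \<in> S \<Longrightarrow> f i \<in> A) \<Longrightarrow> (\<Sum>i\<in>S. f i) \<in> A"
  by (induction S rule: infinite_finite_induct) (auto intro: zero_mem add_mem)

end

text \<open>A ring homomorphism from the complex numbers is part of the data because the endomorphism rings considered
  below have no scalar multiplication of their own.\<close>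

locale scalars =
  fixes sc :: "complex \<Rightarrow> 'r::ring_1"
  assumes sc_add: "sc (c + d) = sc c + sc d" and sc_mult: "sc (c * d) = sc c * sc d" and sc_one: "sc 1 = 1"
begin

lemma sc_zero: "sc 0 = 0"
  using sc_add[of 0 0] by simp

lemma sc_uminus: "sc (- c) = - sc c"
  using sc_add[of c "- c"] by (simp add: sc_zero eq_neg_iff_add_eq_0 add.commute)

lemma sc_of_nat: "sc (of_nat n) = of_nat n"
  by (induction n) (simp_all add: sc_zero sc_add sc_one)

lemma sc_inverse: "c \<noteq> 0 \<Longrightarrow> sc (inverse c) * sc c = 1" "c \<noteq> 0 \<Longrightarrow> sc (inverse c) * (sc c * a) = a"
  by (simp_all add: sc_mult[symmetric] sc_one mult.assoc[symmetric])

end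

text \<open>Elements that satisfy the commutation relations of \<open>\<nn>\<^sup>-\<close> define a homomorphism from the free algebra, which
  maps \<open>K\<close> into \<open>A\<close>.\<close>

lemma (in dominant_weight) power_of_root_vector_in_left_ideal:
  fixes Y :: "('g \<Rightarrow> complex) \<Rightarrow> 'r::ring_1" and sc :: "complex \<Rightarrow> 'r" and A :: "'r set"
  assumes "left_ideal A" "scalars sc"
    and central: "\<And>c \<gamma>. \<gamma> \<in> pos_roots G \<Longrightarrow> Y \<gamma> * sc c = sc c * Y \<gamma>"
    and comm: "\<And>\<gamma> \<delta>. \<gamma> \<in> pos_roots G \<Longrightarrow> \<delta> \<in> pos_roots G \<Longrightarrow> Y \<gamma> * Y \<delta> - Y \<delta> * Y \<gamma> = sc (nconst \<gamma> \<delta>) * Y (\<gamma> + \<delta>)"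
    and gens: "\<And>i. i \<in> {1..rank G} \<Longrightarrow> Y (sroot G i) ^ Suc (N (sroot G i)) \<in> A"
    and \<alpha>: "\<alpha> \<in> pos_roots G"
  shows "Y \<alpha> ^ Suc (N \<alpha>) \<in> A"
proof -
  interpret left_ideal A by fact
  interpret scalars sc by fact
  define ev where "ev p = (\<Sum>w\<in>Poly_Mapping.keys p. sc (Poly_Mapping.lookup p w) * prod_list (map Y (letters w)))" for p
  have sup: "ev p = (\<Sum>w\<in>S. sc (Poly_Mapping.lookup p w) * prod_list (map Y (letters w)))"
    if "finite S" "Poly_Mapping.keys p \<subseteq> S" for S p
    unfolding ev_def by (rule sum.mono_neutral_left) (use that sc_zero in \<open>auto simp: in_keys_iff\<close>)
  have add: "ev (p + q) = ev p + ev q" for p q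
  proof -
    let ?S = "Poly_Mapping.keys p \<union> Poly_Mapping.keys q \<union> Poly_Mapping.keys (p + q)"
    have "ev r = (\<Sum>w\<in>?S. sc (Poly_Mapping.lookup r w) * prod_list (map Y (letters w)))" if "r \<in> {p, q, p + q}" for r
      using that by (intro sup) auto
    then show ?thesis by (simp add: lookup_add sc_add distrib_right sum.distrib)
  qed
  have ev0: "ev 0 = 0" by (simp add: ev_def)
  have scale: "ev (cst c * p) = sc c * ev p" for c p
  proof -
    let ?S = "Poly_Mapping.keys p \<union> Poly_Mapping.keys (cst c * p)"
    have "ev r = (\<Sum>w\<in>?S. sc (Poly_Mapping.lookup r w) * prod_list (map Y (letters w)))" if "r \<in> {p, cst c * p}" for r
      using that by (intro sup) auto
    then show ?thesis by (simp add: lookup_cst sc_mult sum_distrib_left mult.assoc)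
  qed
  have word: "ev (word ws) = prod_list (map Y ws)" for ws
    by (simp add: ev_def word_def sc_one)
  have diff: "ev (p - q) = ev p - ev q" for p q
    using add[of "p - q" q] by (simp add: algebra_simps)
  have x: "ev (x \<gamma> * p) = Y \<gamma> * ev p" if \<gamma>: "\<gamma> \<in> pos_roots G" for \<gamma> p
  proof (induction p rule: word_induct)
    case (1 ws)
    then show ?case by (simp add: word flip: word_Cons)
  next
    case (2 c p)
    have "ev (x \<gamma> * (cst c * p)) = sc c * (Y \<gamma> * ev p)"
      by (simp only: word_cst scale 2)
    also have "\<dots> = Y \<gamma> * (sc c * ev p)"
      by (simp only: mult.assoc[symmetric] central[OF \<gamma>])
    finally show ?case by (simp only: scale)
  qed (simp add: distrib_left add)
  have K: "ev p \<in> A" if "p \<in> K" for p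
    using that
  proof (induction rule: K.induct)
    case (rel \<gamma> \<delta> p)
    have "ev (commutator_rel \<gamma> \<delta> p) = (Y \<gamma> * Y \<delta> - Y \<delta> * Y \<gamma> - sc (nconst \<gamma> \<delta>) * Y (\<gamma> + \<delta>)) * ev p"
    proof (cases "nconst \<gamma> \<delta> = 0")
      case True
      then show ?thesis using rel by (simp add: commutator_rel_def diff x sc_zero mult.assoc left_diff_distrib)
    next
      case False
      then have "\<gamma> + \<delta> \<in> pos_roots G" by (auto simp: nconst_def split: if_splits)
      then have "ev (x (\<gamma> + \<delta>) * p) = Y (\<gamma> + \<delta>) * ev p" by (rule x)
      then show ?thesis using rel by (simp add: commutator_rel_def diff scale x mult.assoc left_diff_distrib)
    qed
    then show ?case using comm[OF rel] zero_mem by simp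
  next
    case (gen i)
    have "ev (x (sroot G i) ^ n) = Y (sroot G i) ^ n" for n
      using x[of "sroot G i"] simple_pos[OF gen] word[of "[]"] by (induction n) (simp_all add: word_Nil)
    then show ?case using gens[OF gen] by (simp only:)
  qed (auto simp: ev0 add scale x intro: zero_mem add_mem mult_mem)
  have "ev (x \<alpha> ^ n) = Y \<alpha> ^ n" for n
    using x[of \<alpha>] \<alpha> word[of "[]"] by (induction n) (simp_all add: word_Nil)
  with K[OF power_in_K[OF \<alpha>]] show ?thesis by (simp only:)
qed

section \<open>Garland's identity and the divided power sums\<close>

lemma seqs_iff:
  assumes "\<And>p. p > n \<Longrightarrow> b p = 0"
  shows "b \<in> seqs r s \<longleftrightarrow> (\<Sum>p\<le>n. b p) = r \<and> (\<Sum>p\<le>n. p * b p) = s"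
proof -
  have sub: "{p. b p \<noteq> 0} \<subseteq> {..n}" using assms linorder_not_less by blast
  then have "finite {p. b p \<noteq> 0}" using finite_subset by blast
  moreover have "(\<Sum>p | b p \<noteq> 0. b p) = (\<Sum>p\<le>n. b p)" "(\<Sum>p | b p \<noteq> 0. p * b p) = (\<Sum>p\<le>n. p * b p)"
    by (rule sum.mono_neutral_left; use sub in auto)+
  ultimately show ?thesis by (simp add: seqs_def)
qed

lemma seqsD:
  assumes "b \<in> seqs r s"
  shows "s \<le> n \<Longrightarrow> (\<Sum>p\<le>n. b p) = r" "s \<le> n \<Longrightarrow> (\<Sum>p\<le>n. p * b p) = s" "p > s \<Longrightarrow> b p = 0"
  using seqs_iff[of n b r s] seqs_bounds(2)[OF assms] assms by auto

lemma sum_upd: "j \<le> (n::nat) \<Longrightarrow> (\<Sum>p\<le>n. f p * (b(j := Suc (b j))) p) = (\<Sum>p\<le>n. f p * b p) + (f j :: nat)"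
proof -
  assume j: "j \<le> n"
  have "(\<Sum>p\<le>n. f p * (b(j := Suc (b j))) p) = (\<Sum>p\<le>n. f p * b p + (if p = j then f j else 0))"
    by (rule sum.cong) auto
  also have "\<dots> = (\<Sum>p\<le>n. f p * b p) + f j" using j by (simp add: sum.distrib)
  finally show ?thesis .
qed

text \<open>Adding one part of size \<open>j\<close>.\<close>

lemma seqs_add_bij:
  assumes j: "j \<le> s"
  shows "bij_betw (\<lambda>b. b(j := Suc (b j))) (seqs r (s - j)) {b \<in> seqs (Suc r) s. b j > 0}"
proof (rule bij_betw_byWitness[where f' = "\<lambda>b. b(j := b j - 1)"])
  show "(\<lambda>b. b(j := Suc (b j))) ` seqs r (s - j) \<subseteq> {b \<in> seqs (Suc r) s. b j > 0}"
  proof clarsimp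
    fix b assume b: "b \<in> seqs r (s - j)"
    have z: "(b(j := Suc (b j))) p = 0" if "p > s" for p
      using seqsD(3)[OF b, of p] that j by auto
    have "(\<Sum>p\<le>s. (b(j := Suc (b j))) p) = Suc r \<and> (\<Sum>p\<le>s. p * (b(j := Suc (b j))) p) = s"
      using seqsD(1,2)[OF b, of s] j sum_upd[OF j, of "\<lambda>_. 1" b] sum_upd[OF j, of "\<lambda>p. p" b] by simp
    with seqs_iff[of s "b(j := Suc (b j))" "Suc r" s, OF z] show "b(j := Suc (b j)) \<in> seqs (Suc r) s"
      by blast
  qed
  show "(\<lambda>b. b(j := b j - 1)) ` {b \<in> seqs (Suc r) s. b j > 0} \<subseteq> seqs r (s - j)"
  proof clarsimp
    fix b assume b: "b \<in> seqs (Suc r) s" "b j > 0"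
    define b' where "b' = b(j := b j - 1)"
    have bb: "b = b'(j := Suc (b' j))" using b(2) by (simp add: b'_def)
    have z: "b' p = 0" if "p > s" for p
      using seqsD(3)[OF b(1), of p] that j by (auto simp: b'_def)
    have "(\<Sum>p\<le>s. b' p) + 1 = Suc r" "(\<Sum>p\<le>s. p * b' p) + j = s"
      using seqsD(1,2)[OF b(1), of s] sum_upd[OF j, of "\<lambda>_. 1" b'] sum_upd[OF j, of "\<lambda>p. p" b'] bb by simp_all
    then have "(\<Sum>p\<le>s. b' p) = r \<and> (\<Sum>p\<le>s. p * b' p) = s - j" by linarith
    with seqs_iff[of s b' r "s - j", OF z] show "b(j := b j - Suc 0) \<in> seqs r (s - j)"
      by (simp add: b'_def)
  qed
qed auto

lemma sum_triangle_swap: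
  fixes f :: "nat \<Rightarrow> nat \<Rightarrow> 'a::comm_monoid_add"
  shows "(\<Sum>j\<le>s. \<Sum>l\<le>s - j. f j l) = (\<Sum>l\<le>s. \<Sum>j\<le>s - l. f j l)"
proof -
  have "(\<Sum>j\<le>s. \<Sum>l\<le>s - j. f j l) = (\<Sum>(j, l)\<in>Sigma {..s} (\<lambda>j. {..s - j}). f j l)"
    by (rule sum.Sigma) auto
  also have "\<dots> = (\<Sum>(l, j)\<in>Sigma {..s} (\<lambda>l. {..s - l}). f j l)"
    by (rule sum.reindex_bij_witness[of _ "\<lambda>(l, j). (j, l)" "\<lambda>(j, l). (l, j)"]) auto
  also have "\<dots> = (\<Sum>l\<le>s. \<Sum>j\<le>s - l. f j l)"
    by (rule sum.Sigma[symmetric]) auto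
  finally show ?thesis .
qed

lemma sum_triangle_diagonal:
  fixes f :: "nat \<Rightarrow> 'a::semiring_1"
  shows "(\<Sum>j\<le>s. \<Sum>l\<le>s - j. f (j + l)) = (\<Sum>q\<le>s. of_nat (Suc q) * f q)"
proof -
  have "(\<Sum>j\<le>s. \<Sum>l\<le>s - j. f (j + l)) = (\<Sum>(j, l)\<in>Sigma {..s} (\<lambda>j. {..s - j}). f (j + l))"
    by (rule sum.Sigma) auto
  also have "\<dots> = (\<Sum>(q, j)\<in>Sigma {..s} (\<lambda>q. {..q}). f q)"
    by (rule sum.reindex_bij_witness[of _ "\<lambda>(q, j). (j, q - j)" "\<lambda>(j, l). (j + l, j)"]) auto
  also have "\<dots> = (\<Sum>q\<le>s. \<Sum>j\<le>q. f q)"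
    by (rule sum.Sigma[symmetric]) auto
  finally show ?thesis by (simp only: sum_constant card_atMost)
qed

lemma commute_mult:
  fixes a :: "'a::semigroup_mult"
  assumes "a * b = b * a" "a * c = c * a"
  shows "a * (b * c) = b * c * a"
  using assms by (metis mult.assoc)

lemma of_nat_left_commute: "a * (of_nat n * b) = of_nat n * (a * b :: 'a::semiring_1)"
  by (metis mult.assoc mult_of_nat_commute)

locale divided_powers = scalars sc for sc :: "complex \<Rightarrow> 'r::ring_1" +
  fixes x :: "nat \<Rightarrow> 'r"
  assumes x_commute: "x i * x j = x j * x i" and x_sc: "x i * sc c = sc c * x i"
begin

definition divided :: "nat \<Rightarrow> nat \<Rightarrow> 'r" where "divided i b = sc (1 / fact b) * x i ^ b"

definition monomial :: "nat \<Rightarrow> (nat \<Rightarrow> nat) \<Rightarrow> 'r" where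
  "monomial m b = prod_list (map (\<lambda>p. divided p (b p)) [0..<m])"

definition xb :: "nat \<Rightarrow> nat \<Rightarrow> 'r" where "xb r s = (\<Sum>b\<in>seqs r s. monomial (s + 1) b)"

lemma x_power_commute: "x i * x j ^ n = x j ^ n * x i" "x i ^ m * x j ^ n = x j ^ n * x i ^ m"
proof -
  show *: "x i * x j ^ n = x j ^ n * x i" for i j n
    by (rule power_commuting_commutes[OF x_commute, symmetric])
  show "x i ^ m * x j ^ n = x j ^ n * x i ^ m"
    by (rule power_commuting_commutes[OF *])
qed

lemma x_power_sc: "x i ^ n * sc c = sc c * x i ^ n"
  by (rule power_commuting_commutes[OF x_sc])

lemma x_power_sc_left: "x i ^ n * (sc c * a) = sc c * (x i ^ n * a)"
  by (simp only: mult.assoc[symmetric] x_power_sc)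

lemma sc_commute: "sc c * sc d = sc d * sc c"
  by (simp add: sc_mult[symmetric] mult.commute)

lemma x_divided: "x i * divided j b = divided j b * x i"
  unfolding divided_def by (rule commute_mult[OF x_sc x_power_commute(1)])

lemma x_divided_same: "x i * divided i b = of_nat (Suc b) * divided i (Suc b)"
proof -
  have "(of_nat (Suc b) :: complex) * (1 / fact (Suc b)) = 1 / fact b"
    by (simp only: fact_Suc) (simp del: of_nat_Suc)
  then have "of_nat (Suc b) * sc (1 / fact (Suc b)) = sc (1 / fact b)"
    by (metis sc_mult sc_of_nat)
  then have "sc (1 / fact b) * (x i * x i ^ b) = of_nat (Suc b) * (sc (1 / fact (Suc b)) * x i ^ Suc b)"
    by (simp only: mult.assoc[symmetric] power_Suc)
  moreover have "x i * (sc (1 / fact b) * x i ^ b) = sc (1 / fact b) * (x i * x i ^ b)"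
    by (simp only: mult.assoc[symmetric] x_sc)
  ultimately show ?thesis
    by (simp only: divided_def)
qed

lemma divided_divided: "divided i a * divided j b = divided j b * divided i a"
proof -
  have "divided i a * divided j b = sc (1 / fact a) * sc (1 / fact b) * (x i ^ a * x j ^ b)" for i j a b
    by (simp only: divided_def mult.assoc x_power_sc_left)
  then show ?thesis by (metis x_power_commute(2) sc_commute)
qed

lemma monomial_Suc: "monomial (Suc m) b = monomial m b * divided m (b m)"
  by (simp add: monomial_def)

lemma x_monomial: "x i * monomial m b = monomial m b * x i"
proof (induction m)
  case (Suc m)
  show ?case unfolding monomial_Suc by (rule commute_mult[OF Suc x_divided])
qed (simp add: monomial_def)

lemma monomial_cong: "(\<And>p. p < m \<Longrightarrow> b p = b' p) \<Longrightarrow> monomial m b = monomial m b'"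
  unfolding monomial_def by (intro arg_cong[of _ _ prod_list] map_cong) auto

lemma monomial_upd:
  assumes "j < m"
  shows "x j * monomial m b = of_nat (Suc (b j)) * monomial m (b(j := Suc (b j)))"
  using assms
proof (induction m)
  case (Suc m)
  show ?case
  proof (cases "j = m")
    case True
    have "monomial m (b(m := Suc (b m))) = monomial m b" by (rule monomial_cong) auto
    moreover have "x m * (monomial m b * divided m (b m)) = monomial m b * (x m * divided m (b m))"
      by (simp only: mult.assoc[symmetric] x_monomial)
    ultimately show ?thesis
      unfolding True monomial_Suc x_divided_same by (simp add: of_nat_left_commute del: of_nat_Suc)
  next
    case False
    with Suc.prems have "j < m" by simp
    then have "x j * monomial m b = of_nat (Suc (b j)) * monomial m (b(j := Suc (b j)))"
      by (rule Suc.IH)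
    then have "x j * monomial m b * divided m (b m) = of_nat (Suc (b j)) * monomial m (b(j := Suc (b j))) * divided m (b m)"
      by (rule arg_cong)
    then show ?thesis
      using False by (simp only: monomial_Suc mult.assoc fun_upd_other not_sym)
  qed
qed simp

lemma monomial_extend:
  assumes "\<And>p. p \<ge> m \<Longrightarrow> b p = 0" "m \<le> n"
  shows "monomial n b = monomial m b"
  using assms(2)
proof (induction n rule: dec_induct)
  case (step n)
  then show ?case using assms(1)[of n] by (simp add: monomial_Suc divided_def sc_one)
qed simp

lemma monomial_split:
  assumes "q < m \<or> b q = 0"
  shows "monomial m b = monomial m (b(q := 0)) * divided q (b q)"
  using assms
proof (induction m)
  case 0
  then show ?case by (auto simp: monomial_def divided_def sc_one)
next
  case (Suc m)
  show ?case
  proof (cases "q = m")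
    case True
    have "monomial m (b(m := 0)) = monomial m b" by (rule monomial_cong) auto
    then show ?thesis
      unfolding True monomial_Suc fun_upd_same by (simp only: divided_def[of m 0] power_0 fact_0 div_by_1 sc_one mult_1_right)
  next
    case False
    with Suc.prems have "q < m \<or> b q = 0" by auto
    then have IH: "monomial m b = monomial m (b(q := 0)) * divided q (b q)" by (rule Suc.IH)
    have "monomial (Suc m) b = monomial m (b(q := 0)) * divided q (b q) * divided m (b m)"
      unfolding monomial_Suc by (subst IH) simp
    then show ?thesis
      using False by (simp only: monomial_Suc mult.assoc divided_divided[of q] fun_upd_other not_sym)
  qed
qed

text \<open>Multiplying the monomial of \<open>b\<close> by \<open>x j\<close> gives \<open>b j + 1\<close> times the monomial with one more part \<open>j\<close>, as the powers are
  divided.  The weights \<open>\<phi> = 1\<close> and \<open>\<phi> j = j\<close> yield the two recursions for \<open>xb\<close> below.\<close>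

lemma xb_weighted:
  "(\<Sum>j\<le>s. of_nat (\<phi> j) * (x j * xb r (s - j))) = (\<Sum>b\<in>seqs (Suc r) s. of_nat (\<Sum>j\<le>s. \<phi> j * b j) * monomial (s + 1) b)"
proof -
  have "of_nat (\<phi> j) * (x j * xb r (s - j)) = (\<Sum>b\<in>seqs (Suc r) s. of_nat (\<phi> j * b j) * monomial (s + 1) b)"
    if j: "j \<le> s" for j
  proof -
    have "x j * xb r (s - j) = (\<Sum>b\<in>seqs r (s - j). x j * monomial (s + 1) b)"
      unfolding xb_def sum_distrib_left
    proof (rule sum.cong[OF refl])
      fix b assume b: "b \<in> seqs r (s - j)"
      have "monomial (s + 1) b = monomial (s - j + 1) b"
        by (rule monomial_extend) (use seqsD(3)[OF b] in auto)
      then show "x j * monomial (s - j + 1) b = x j * monomial (s + 1) b" by simp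
    qed
    also have "\<dots> = (\<Sum>b\<in>seqs r (s - j). of_nat ((b(j := Suc (b j))) j) * monomial (s + 1) (b(j := Suc (b j))))"
      using j by (intro sum.cong refl) (simp add: monomial_upd del: of_nat_Suc)
    also have "\<dots> = (\<Sum>b | b \<in> seqs (Suc r) s \<and> b j > 0. of_nat (b j) * monomial (s + 1) b)"
      by (rule sum.reindex_bij_betw[OF seqs_add_bij[OF j], of "\<lambda>b. of_nat (b j) * monomial (s + 1) b"])
    also have "\<dots> = (\<Sum>b\<in>seqs (Suc r) s. of_nat (b j) * monomial (s + 1) b)"
      by (rule sum.mono_neutral_left) (auto simp: finite_seqs)
    finally show ?thesis by (simp add: sum_distrib_left mult.assoc)
  qed
  then have "(\<Sum>j\<le>s. of_nat (\<phi> j) * (x j * xb r (s - j))) = (\<Sum>j\<le>s. \<Sum>b\<in>seqs (Suc r) s. of_nat (\<phi> j * b j) * monomial (s + 1) b)"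
    by (intro sum.cong) auto
  also have "\<dots> = (\<Sum>b\<in>seqs (Suc r) s. \<Sum>j\<le>s. of_nat (\<phi> j * b j) * monomial (s + 1) b)"
    by (rule sum.swap)
  finally show ?thesis by (simp only: sum_distrib_right of_nat_sum)
qed

lemma xb_Suc: "(\<Sum>j\<le>s. x j * xb r (s - j)) = of_nat (Suc r) * xb (Suc r) s"
proof -
  have "(\<Sum>j\<le>s. of_nat 1 * (x j * xb r (s - j))) = (\<Sum>b\<in>seqs (Suc r) s. of_nat (Suc r) * monomial (s + 1) b)"
    unfolding xb_weighted by (intro sum.cong refl) (simp add: seqsD(1))
  also have "\<dots> = of_nat (Suc r) * xb (Suc r) s" by (simp only: xb_def sum_distrib_left)
  finally show ?thesis by (simp only: of_nat_1 mult_1_left)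
qed

lemma xb_deriv: "(\<Sum>j\<le>s. of_nat j * (x j * xb r (s - j))) = of_nat s * xb (Suc r) s"
proof -
  have "(\<Sum>j\<le>s. of_nat j * (x j * xb r (s - j))) = (\<Sum>b\<in>seqs (Suc r) s. of_nat s * monomial (s + 1) b)"
    unfolding xb_weighted by (intro sum.cong refl) (simp add: seqsD(2))
  also have "\<dots> = of_nat s * xb (Suc r) s" by (simp only: xb_def sum_distrib_left)
  finally show ?thesis .
qed

lemma seqs_0: "seqs 0 s = (if s = 0 then {\<lambda>_. 0} else {})"
proof -
  have "b \<in> seqs 0 s \<longleftrightarrow> s = 0 \<and> b = (\<lambda>_. 0)" for b
  proof
    assume b: "b \<in> seqs 0 s"
    then have "b p = 0" for p using seqs_bounds(1)[OF b, of p] by simp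
    then show "s = 0 \<and> b = (\<lambda>_. 0)" using b by (auto simp: seqs_def)
  qed (auto simp: seqs_def)
  then show ?thesis by auto
qed

lemma xb_0: "xb 0 s = (if s = 0 then 1 else 0)"
  by (simp add: xb_def seqs_0 monomial_def divided_def sc_one)

lemma xb_1: "xb 1 s = x s"
proof -
  have "xb 1 s = (\<Sum>j\<le>s. x j * xb 0 (s - j))" using xb_Suc[where r = 0, of s] by simp
  also have "\<dots> = (\<Sum>j\<le>s. if j = s then x s else 0)" by (intro sum.cong) (auto simp: xb_0)
  finally show ?thesis by simp
qed

lemma seqs_s0: "seqs r 0 = {\<lambda>p. if p = 0 then r else 0}"
proof -
  have "b \<in> seqs r 0 \<longleftrightarrow> b = (\<lambda>p. if p = 0 then r else 0)" for b
  proof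
    assume b: "b \<in> seqs r 0"
    show "b = (\<lambda>p. if p = 0 then r else 0)"
      using seqsD(1)[OF b, of 0] seqsD(3)[OF b] by (intro ext) auto
  qed (auto simp: seqs_iff[of 0])
  then show ?thesis by auto
qed

lemma xb_s0: "xb r 0 = divided 0 r"
  by (simp add: xb_def seqs_s0 monomial_def)

end

text \<open>\<open>A\<close> plays the annihilator of a vector \<open>v\<close>; \<open>x j\<close>, \<open>h j\<close>, \<open>e\<close> play \<open>x\<^sup>-\<^sub>\<alpha> \<otimes> t\<^sup>j\<close>, \<open>\<alpha>\<^sup>\<or> \<otimes> t\<^sup>j\<close> and \<open>x\<^sup>+\<^sub>\<alpha> \<otimes> t\<close>.\<close>

locale garland = divided_powers sc x + left_ideal A
  for sc :: "complex \<Rightarrow> 'r::ring_1" and x :: "nat \<Rightarrow> 'r" and A :: "'r set" +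
  fixes h :: "nat \<Rightarrow> 'r" and e :: 'r and N :: nat
  assumes e_mem: "e \<in> A" and h_mem: "i \<ge> 1 \<Longrightarrow> h i \<in> A"
    and e_x: "e * x j = x j * e + h (Suc j)" and h_x: "h i * x j = x j * h i - 2 * x (i + j)"
    and x0_mem: "x 0 ^ Suc N \<in> A"
begin

lemma divide_mem:
  assumes "of_nat n * a \<in> A" "n > 0"
  shows "a \<in> A"
proof -
  have "sc (inverse (of_nat n)) * (of_nat n * a) = a"
    using sc_inverse(2)[of "of_nat n" a] assms(2) by (simp add: sc_of_nat)
  with mult_mem[OF assms(1)] show ?thesis by metis
qed

lemma h_xb: "i \<ge> 1 \<Longrightarrow> h i * xb (Suc r) s + 2 * (\<Sum>j\<le>s. x (i + j) * xb r (s - j)) \<in> A"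
proof (induction r arbitrary: s)
  case 0
  have "h i * xb 1 s + 2 * (\<Sum>j\<le>s. x (i + j) * xb 0 (s - j)) = x s * h i"
  proof -
    have "(\<Sum>j\<le>s. x (i + j) * xb 0 (s - j)) = (\<Sum>j\<le>s. if j = s then x (i + s) else 0)"
      by (intro sum.cong) (auto simp: xb_0)
    then show ?thesis by (simp add: xb_1[unfolded One_nat_def] h_x)
  qed
  then show ?case using mult_mem[OF h_mem[OF 0]] by simp
next
  case (Suc r)
  let ?Q = "\<lambda>r s. (\<Sum>j\<le>s. x (i + j) * xb r (s - j))"
  have "(\<Sum>j\<le>s. x j * (h i * xb (Suc r) (s - j) + 2 * ?Q r (s - j))) \<in> A"
    by (intro sum_mem mult_mem Suc.IH Suc.prems)
  also have "(\<Sum>j\<le>s. x j * (h i * xb (Suc r) (s - j) + 2 * ?Q r (s - j))) =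
      (\<Sum>j\<le>s. x j * (h i * xb (Suc r) (s - j))) + 2 * (\<Sum>j\<le>s. x j * ?Q r (s - j))"
    by (simp add: distrib_left sum.distrib sum_distrib_left) (simp add: mult_2 mult_2_right distrib_left sum.distrib)
  also have "(\<Sum>j\<le>s. x j * ?Q r (s - j)) = (\<Sum>j\<le>s. \<Sum>l\<le>s - j. x (i + l) * (x j * xb r (s - j - l)))"
    unfolding sum_distrib_left by (intro sum.cong refl) (simp only: mult.assoc[symmetric] x_commute[of _ "i + _"])
  also have "\<dots> = (\<Sum>l\<le>s. \<Sum>j\<le>s - l. x (i + l) * (x j * xb r (s - j - l)))"
    by (rule sum_triangle_swap)
  also have "\<dots> = (\<Sum>l\<le>s. x (i + l) * (of_nat (Suc r) * xb (Suc r) (s - l)))"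
    unfolding xb_Suc[symmetric] sum_distrib_left by (intro sum.cong refl) (simp add: add.commute)
  also have "\<dots> = of_nat (Suc r) * ?Q (Suc r) s"
    unfolding sum_distrib_left by (intro sum.cong refl) (rule of_nat_left_commute)
  also have "(\<Sum>j\<le>s. x j * (h i * xb (Suc r) (s - j))) = (\<Sum>j\<le>s. h i * (x j * xb (Suc r) (s - j)) + 2 * (x (i + j) * xb (Suc r) (s - j)))"
    by (intro sum.cong refl) (simp add: mult.assoc[symmetric] h_x left_diff_distrib)
  also have "\<dots> = h i * (of_nat (Suc (Suc r)) * xb (Suc (Suc r)) s) + 2 * ?Q (Suc r) s"
    by (simp only: sum.distrib sum_distrib_left[symmetric] xb_Suc)
  also have "h i * (of_nat (Suc (Suc r)) * xb (Suc (Suc r)) s) = of_nat (Suc (Suc r)) * (h i * xb (Suc (Suc r)) s)"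
    by (rule of_nat_left_commute)
  also have "of_nat (Suc (Suc r)) * (h i * xb (Suc (Suc r)) s) + 2 * ?Q (Suc r) s + 2 * (of_nat (Suc r) * ?Q (Suc r) s) =
      of_nat (Suc (Suc r)) * (h i * xb (Suc (Suc r)) s + 2 * ?Q (Suc r) s)"
    by (simp add: algebra_simps mult_2 mult_2_right)
  finally show ?case by (rule divide_mem) simp
qed

lemma sum_h_xb: "(\<Sum>j\<le>s. h (Suc j) * xb (Suc r) (s - j)) + 2 * (of_nat (Suc s) * xb (Suc r) (Suc s)) \<in> A"
proof -
  have "(\<Sum>j\<le>s. h (Suc j) * xb (Suc r) (s - j) + 2 * (\<Sum>l\<le>s - j. x (Suc j + l) * xb r (s - j - l))) \<in> A"
    by (intro sum_mem h_xb) simp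
  moreover have "(\<Sum>j\<le>s. \<Sum>l\<le>s - j. x (Suc j + l) * xb r (s - j - l)) = (\<Sum>j\<le>s. \<Sum>l\<le>s - j. x (Suc (j + l)) * xb r (s - (j + l)))"
    by simp
  moreover have "\<dots> = (\<Sum>q\<le>s. of_nat (Suc q) * (x (Suc q) * xb r (s - q)))"
    using sum_triangle_diagonal[of "\<lambda>q. x (Suc q) * xb r (s - q)" s] by simp
  moreover have "\<dots> = (\<Sum>q\<le>Suc s. of_nat q * (x q * xb r (Suc s - q)))"
    by (simp only: sum.atMost_Suc_shift) simp
  ultimately show ?thesis
    by (simp add: xb_deriv sum.distrib sum_distrib_left[symmetric])
qed

text \<open>Garland's identity, for one raising operator.  The induction step expands \<open>(r + 2) xb (r + 2) s\<close> as
  \<open>\<Sum>\<^sub>j x j * xb (r + 1) (s - j)\<close>; moving \<open>e\<close> past \<open>x j\<close> leaves the terms \<open>h (j + 1)\<close> collected in the preceding lemma.\<close>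

lemma e_xb: "e * xb (Suc r) s + of_nat (Suc s) * xb r (Suc s) \<in> A"
proof (induction r arbitrary: s)
  case 0
  have "e * xb 1 s = x s * e + h (Suc s)" by (simp only: xb_1 e_x)
  then show ?case using mult_mem[OF e_mem, of "x s"] h_mem[of "Suc s"] add_mem by (simp add: xb_0)
next
  case (Suc r)
  have *: "(\<Sum>j\<le>s. of_nat (Suc (s - j)) * (x j * xb r (Suc (s - j)))) + of_nat (Suc s) * xb (Suc r) (Suc s) = of_nat (Suc s * Suc r) * xb (Suc r) (Suc s)"
  proof -
    have "(\<Sum>j\<le>s. of_nat (Suc (s - j)) * (x j * xb r (Suc (s - j)))) = (\<Sum>j\<le>s. of_nat (Suc s - j) * (x j * xb r (Suc s - j)))"
      by (intro sum.cong) (auto simp: Suc_diff_le)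
    also have "\<dots> = (\<Sum>j\<le>Suc s. of_nat (Suc s - j) * (x j * xb r (Suc s - j)))" by simp
    finally have "(\<Sum>j\<le>s. of_nat (Suc (s - j)) * (x j * xb r (Suc (s - j)))) + of_nat (Suc s) * xb (Suc r) (Suc s) =
      (\<Sum>j\<le>Suc s. of_nat (Suc s - j) * (x j * xb r (Suc s - j))) + (\<Sum>j\<le>Suc s. of_nat j * (x j * xb r (Suc s - j)))"
      by (simp only: xb_deriv)
    also have "\<dots> = (\<Sum>j\<le>Suc s. of_nat (Suc s) * (x j * xb r (Suc s - j)))"
      unfolding sum.distrib[symmetric] distrib_right[symmetric] of_nat_add[symmetric] by (intro sum.cong) auto
    also have "\<dots> = of_nat (Suc s) * (of_nat (Suc r) * xb (Suc r) (Suc s))"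
      by (simp only: sum_distrib_left[symmetric] xb_Suc)
    finally show ?thesis by (simp only: of_nat_mult mult.assoc)
  qed
  have "(\<Sum>j\<le>s. x j * (e * xb (Suc r) (s - j) + of_nat (Suc (s - j)) * xb r (Suc (s - j)))) \<in> A"
    using Suc by (intro sum_mem mult_mem)
  moreover have "(\<Sum>j\<le>s. x j * (e * xb (Suc r) (s - j) + of_nat (Suc (s - j)) * xb r (Suc (s - j)))) =
     (\<Sum>j\<le>s. x j * (e * xb (Suc r) (s - j))) + (\<Sum>j\<le>s. of_nat (Suc (s - j)) * (x j * xb r (Suc (s - j))))"
    by (simp only: sum.distrib distrib_left of_nat_left_commute)
  ultimately have 1: "(\<Sum>j\<le>s. x j * (e * xb (Suc r) (s - j))) + (of_nat (Suc s * Suc r) * xb (Suc r) (Suc s) - of_nat (Suc s) * xb (Suc r) (Suc s)) \<in> A"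
    using * by (simp add: algebra_simps)
  have 2: "(\<Sum>j\<le>s. h (Suc j) * xb (Suc r) (s - j)) + 2 * (of_nat (Suc s) * xb (Suc r) (Suc s)) \<in> A"
    by (rule sum_h_xb)
  have "(\<Sum>j\<le>s. x j * (e * xb (Suc r) (s - j))) + (\<Sum>j\<le>s. h (Suc j) * xb (Suc r) (s - j)) = (\<Sum>j\<le>s. e * (x j * xb (Suc r) (s - j)))"
    unfolding sum.distrib[symmetric] by (intro sum.cong refl) (simp add: mult.assoc[symmetric] e_x distrib_right)
  also have "\<dots> = e * (of_nat (Suc (Suc r)) * xb (Suc (Suc r)) s)"
    by (simp only: sum_distrib_left[symmetric] xb_Suc)
  also have "\<dots> = of_nat (Suc (Suc r)) * (e * xb (Suc (Suc r)) s)"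
    by (rule of_nat_left_commute)
  finally have 3: "(\<Sum>j\<le>s. x j * (e * xb (Suc r) (s - j))) + (\<Sum>j\<le>s. h (Suc j) * xb (Suc r) (s - j)) = of_nat (Suc (Suc r)) * (e * xb (Suc (Suc r)) s)" .
  let ?X = "of_nat (Suc s) * xb (Suc r) (Suc s)"
  have "of_nat (Suc s * Suc r) * xb (Suc r) (Suc s) = of_nat (Suc r) * ?X"
    by (simp only: of_nat_mult mult.assoc[symmetric] mult_of_nat_commute[of "Suc s" "of_nat (Suc r)"])
  then have one: "(\<Sum>j\<le>s. x j * (e * xb (Suc r) (s - j))) + (of_nat (Suc r) * ?X - ?X) \<in> A"
    using 1 by simp
  have "of_nat (Suc (Suc r)) * (e * xb (Suc (Suc r)) s) + (of_nat (Suc r) * ?X - ?X + 2 * ?X) \<in> A"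
    using add_mem[OF one 2] unfolding 3[symmetric] by (simp only: ac_simps)
  moreover have "of_nat (Suc r) * ?X - ?X + 2 * ?X = of_nat (Suc (Suc r)) * ?X"
    by (simp only: of_nat_Suc[of "Suc r"] distrib_right mult_1_left mult_2) simp
  ultimately have "of_nat (Suc (Suc r)) * (e * xb (Suc (Suc r)) s + ?X) \<in> A"
    by (simp only: distrib_left)
  then show ?case by (rule divide_mem) simp
qed

text \<open>Starting from \<open>xb r 0 = x\<^sub>0\<^sup>r / r!\<close>, each application of \<open>e\<close> trades one unit of \<open>r\<close> for one of \<open>s\<close>.\<close>

lemma xb_mem: "r + s \<ge> Suc N \<Longrightarrow> xb r s \<in> A"
proof (induction s arbitrary: r)
  case 0
  then have "x 0 ^ r = x 0 ^ (r - Suc N) * x 0 ^ Suc N" by (simp add: power_add[symmetric] del: power_Suc)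
  then have "x 0 ^ r \<in> A" using mult_mem[OF x0_mem] by metis
  then show ?case by (simp add: xb_s0 divided_def mult_mem)
next
  case (Suc s)
  have "xb (Suc r) s \<in> A" using Suc by simp
  then have "of_nat (Suc s) * xb r (Suc s) \<in> A"
    using diff_mem[OF e_xb[of r s] mult_mem[of "xb (Suc r) s" e]] by simp
  then show ?case by (rule divide_mem) simp
qed

lemma monomial_split2:
  assumes "q \<noteq> q'" "q < m \<or> b q = 0" "q' < m \<or> b q' = 0"
  shows "monomial m b = monomial m (b(q := 0, q' := 0)) * (divided q' (b q') * divided q (b q))"
proof -
  have "monomial m (b(q := 0)) = monomial m (b(q := 0, q' := 0)) * divided q' (b q')"
    using monomial_split[of q' m "b(q := 0)"] assms by simp
  then show ?thesis using monomial_split[of q m b] assms(2) by (simp add: mult.assoc)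
qed

lemma monomial_mem1:
  assumes "q < m \<or> b q = 0" "x q ^ n \<in> A" "n \<le> b q"
  shows "monomial m b \<in> A"
  using monomial_split[of q m b] assms(1) power_mem_mono[OF assms(2,3)] by (simp add: divided_def mult_mem)

lemma monomial_mem2:
  assumes "q \<noteq> q'" "q < m \<or> b q = 0" "q' < m \<or> b q' = 0" "x q ^ b q * x q' ^ b q' \<in> A"
  shows "monomial m b \<in> A"
proof -
  have "divided q' (b q') * divided q (b q) = sc (1 / fact (b q')) * (sc (1 / fact (b q)) * (x q ^ b q * x q' ^ b q'))"
    unfolding divided_def by (simp only: mult.assoc x_power_sc_left x_power_commute(2)[of q'])
  then show ?thesis
    using monomial_split2[OF assms(1-3)] assms(4) by (simp add: mult_mem)
qed

text \<open>The relations for the partition \<open>(L\<^sup>p, m', m'')\<close> in terms of single monomials.\<close>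

definition relations_at :: "nat \<Rightarrow> nat \<Rightarrow> nat \<Rightarrow> bool" where
  "relations_at p m' m'' \<longleftrightarrow> (\<forall>j\<ge>p + 2. x j \<in> A) \<and> x (p + 1) ^ (m'' + 1) \<in> A \<and>
     (\<forall>b a. b + 2 * a \<ge> m' + m'' + 1 \<longrightarrow> x p ^ b * x (p + 1) ^ a \<in> A)"

text \<open>The combinations \<open>s + r - r p\<close> and \<open>s - r p\<close> weight \<open>b j\<close> by \<open>j + 1 - p\<close> and \<open>j - p\<close>, which is positive only at
  \<open>p\<close> and \<open>p + 1\<close> when there are no larger parts.\<close>

lemma seqs_shifted_sum:
  assumes b: "b \<in> seqs r s" and top: "\<And>j. j \<ge> p + 2 \<Longrightarrow> b j = 0"
  shows "int s + int r - int r * int p \<le> int (b p) + 2 * int (b (p + 1))"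
    and "int s - int r * int p \<le> int (b (p + 1))"
proof -
  let ?n = "max s (p + 2)"
  have r: "(\<Sum>j\<le>?n. int (b j)) = int r" and s: "(\<Sum>j\<le>?n. int j * int (b j)) = int s"
    using seqsD(1,2)[OF b, of ?n] by (simp_all add: of_nat_sum[symmetric] of_nat_mult[symmetric] del: of_nat_sum of_nat_mult)
  have sums: "(\<Sum>j\<le>?n. if j = p then int (b p) else 0) = int (b p)"
    "(\<Sum>j\<le>?n. if j = p + 1 then c * int (b (p + 1)) else 0) = c * int (b (p + 1))" for c
    by auto
  have "int s + int r - int r * int p = (\<Sum>j\<le>?n. (int j + 1 - int p) * int (b j))"
    unfolding r[symmetric] s[symmetric] by (simp add: algebra_simps sum.distrib sum_subtractf sum_distrib_left)
  also have "\<dots> \<le> (\<Sum>j\<le>?n. (if j = p then int (b p) else 0) + (if j = p + 1 then 2 * int (b (p + 1)) else 0))"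
  proof (rule sum_mono)
    fix j
    consider "j < p" | "j = p" | "j = p + 1" | "j \<ge> p + 2" by linarith
    then show "(int j + 1 - int p) * int (b j) \<le> (if j = p then int (b p) else 0) + (if j = p + 1 then 2 * int (b (p + 1)) else 0)"
      by cases (auto simp: top mult_nonpos_nonneg)
  qed
  finally show "int s + int r - int r * int p \<le> int (b p) + 2 * int (b (p + 1))"
    unfolding sum.distrib sums .
  have "int s - int r * int p = (\<Sum>j\<le>?n. (int j - int p) * int (b j))"
    unfolding r[symmetric] s[symmetric] by (simp add: algebra_simps sum_subtractf sum_distrib_left)
  also have "\<dots> \<le> (\<Sum>j\<le>?n. (if j = p + 1 then 1 * int (b (p + 1)) else 0))"
  proof (rule sum_mono)
    fix j
    consider "j \<le> p" | "j = p + 1" | "j \<ge> p + 2" by linarith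
    then show "(int j - int p) * int (b j) \<le> (if j = p + 1 then 1 * int (b (p + 1)) else 0)"
      by cases (auto simp: top mult_nonpos_nonneg)
  qed
  finally show "int s - int r * int p \<le> int (b (p + 1))" unfolding sums by simp
qed

lemma seqs_lt:
  assumes "b \<in> seqs r s"
  shows "q < s + 1 \<or> b q = 0"
  using seqsD(3)[OF assms, of q] by (cases "q \<le> s") auto

text \<open>For \<open>K \<ge> p\<close> the bound on \<open>r + s\<close> forces every monomial of \<open>xb r s\<close> to contain one of the given ones.  For \<open>K < p\<close> and
  \<open>r \<le> L\<close> the bound implies the one for \<open>K = p\<close>; for \<open>r \<ge> L\<close> it gives \<open>r + s > N\<close>, where Garland's identity applies.\<close>

lemma relations_imp_xb:
  assumes rel: "relations_at p m' m''" and N: "N = p * L + m' + m''" and r: "r \<ge> 1"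
    and sr: "s + r \<ge> 1 + r * K + ((p - K) * L + (if K \<le> p then m' else 0) + (if K \<le> p + 1 then m'' else 0))"
  shows "xb r s \<in> A"
proof -
  note lt = seqs_lt
  have big: "monomial (s + 1) b \<in> A" if b: "b \<in> seqs r s" and j: "j \<ge> p + 2" "b j \<noteq> 0" for b j s
    by (rule monomial_mem1[of j "s + 1" b 1, OF lt[OF b]]) (use rel j in \<open>auto simp: relations_at_def\<close>)
  have at_p: "xb r s \<in> A" if "s + r \<ge> 1 + r * p + m' + m''" for s
  proof (unfold xb_def, rule sum_mem)
    fix b assume b: "b \<in> seqs r s"
    note lt = seqs_lt[OF b]
    show "monomial (s + 1) b \<in> A"
    proof (cases "\<exists>j\<ge>p + 2. b j \<noteq> 0")
      case True
      then show ?thesis using big[OF b] by blast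
    next
      case False
      then have "int s + int r - int r * int p \<le> int (b p) + 2 * int (b (p + 1))"
        by (intro seqs_shifted_sum(1)[OF b]) auto
      moreover have "int (s + r) \<ge> int (1 + r * p + m' + m'')" using that by (simp only: of_nat_le_iff)
      ultimately have "b p + 2 * b (p + 1) \<ge> m' + m'' + 1" by simp
      then have "x p ^ b p * x (p + 1) ^ b (p + 1) \<in> A"
        using rel unfolding relations_at_def by blast
      then show ?thesis by (rule monomial_mem2[OF _ lt lt, rotated]) simp
    qed
  qed
  consider "K \<ge> p + 2" | "K = p + 1" | "K \<le> p" by linarith
  then show ?thesis
  proof cases
    case 1
    have "r * (p + 2) \<le> r * K" using 1 by (intro mult_le_mono) auto
    with sr have s: "s \<ge> 1 + r * p + r" by simp
    show ?thesis
    proof (unfold xb_def, rule sum_mem)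
      fix b assume b: "b \<in> seqs r s"
      have "\<exists>j\<ge>p + 2. b j \<noteq> 0"
      proof (rule ccontr)
        assume "\<not> ?thesis"
        then have "int s - int r * int p \<le> int (b (p + 1))"
          by (intro seqs_shifted_sum(2)[OF b]) auto
        moreover have "b (p + 1) \<le> r" by (rule seqs_bounds(1)[OF b])
        moreover have "int s \<ge> int (1 + r * p + r)" using s by (simp only: of_nat_le_iff)
        ultimately show False by simp
      qed
      then show "monomial (s + 1) b \<in> A" using big[OF b] by blast
    qed
  next
    case 2
    then have s: "s \<ge> 1 + r * p + m''" using sr by (simp add: algebra_simps)
    show ?thesis
    proof (unfold xb_def, rule sum_mem)
      fix b assume b: "b \<in> seqs r s"
      show "monomial (s + 1) b \<in> A"
      proof (cases "\<exists>j\<ge>p + 2. b j \<noteq> 0")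
        case True
        then show ?thesis using big[OF b] by blast
      next
        case False
        then have "int s - int r * int p \<le> int (b (p + 1))"
          by (intro seqs_shifted_sum(2)[OF b]) auto
        moreover have "int s \<ge> int (1 + r * p + m'')" using s by (simp only: of_nat_le_iff)
        ultimately have "m'' + 1 \<le> b (p + 1)" by simp
        then show ?thesis
          using monomial_mem1[of "p + 1" "s + 1" b "m'' + 1", OF lt[OF b]] rel by (auto simp: relations_at_def)
      qed
    qed
  next
    case 3
    show ?thesis
    proof (cases "r \<ge> L")
      case True
      have "L * K + (p - K) * L = p * L" using 3 by (simp add: algebra_simps flip: distrib_right)
      moreover have "L * K \<le> r * K" using True by (rule mult_le_mono1)
      moreover have "1 + r * K + ((p - K) * L + m' + m'') \<le> s + r" using sr 3 by simp
      ultimately have "r + s \<ge> Suc N" using N by linarith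
      then show ?thesis by (rule xb_mem)
    next
      case False
      have "(p - K) * r \<le> (p - K) * L" using False by simp
      moreover have "r * K + (p - K) * r = r * p" using 3 by (metis add_diff_inverse_nat distrib_left leD mult.commute)
      moreover have "1 + r * K + ((p - K) * L + m' + m'') \<le> s + r" using sr 3 by simp
      ultimately have "s + r \<ge> 1 + r * p + m' + m''" by linarith
      then show ?thesis by (rule at_p)
    qed
  qed
qed

text \<open>For a monomial \<open>x\<^sub>p\<^sup>c x\<^bsub>p+1\<^esub>\<^sup>a\<close> consider the sum \<open>xb r s\<close> in which it occurs.  Every other monomial in that sum has a part
  above \<open>p + 1\<close> or more than \<open>a\<close> parts \<open>p + 1\<close>, so descending induction on \<open>a\<close> isolates the given one.\<close>

lemma xb_imp_relations:
  assumes le: "m'' \<le> m'" and N: "N = p * L + m' + m''"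
    and xb: "\<And>r s K. r \<ge> 1 \<Longrightarrow> s \<ge> 1 \<Longrightarrow> K \<ge> 1 \<Longrightarrow>
      s + r \<ge> 1 + r * K + ((p - K) * L + (if K \<le> p then m' else 0) + (if K \<le> p + 1 then m'' else 0)) \<Longrightarrow> xb r s \<in> A"
  shows "relations_at p m' m''"
proof -
  have i: "x j \<in> A" if "j \<ge> p + 2" for j
    using xb[of 1 j "p + 2"] that by (simp add: xb_1[unfolded One_nat_def])
  have big: "monomial (s + 1) b \<in> A" if b: "b \<in> seqs r s" and j: "j \<ge> p + 2" "b j \<noteq> 0" for b j r s
    using monomial_mem1[of j "s + 1" b 1] seqs_lt[OF b, of j] i j by auto
  have isolate: "x q ^ b0 q * x q' ^ b0 q' \<in> A"
    if b0: "b0 \<in> seqs r s" "b0(q := 0, q' := 0) = (\<lambda>_. 0)" and q: "q \<noteq> q'" and m: "xb r s \<in> A"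
      and others: "\<And>b. b \<in> seqs r s \<Longrightarrow> b \<noteq> b0 \<Longrightarrow> monomial (s + 1) b \<in> A" for b0 r s q q'
  proof -
    have "xb r s = monomial (s + 1) b0 + (\<Sum>b\<in>seqs r s - {b0}. monomial (s + 1) b)"
      unfolding xb_def by (rule sum.remove[OF finite_seqs b0(1)])
    moreover have "(\<Sum>b\<in>seqs r s - {b0}. monomial (s + 1) b) \<in> A"
      using others by (intro sum_mem) auto
    ultimately have mb: "monomial (s + 1) b0 \<in> A"
      using diff_mem[OF m] by (metis add_diff_cancel_right')
    have one: "monomial n (\<lambda>_. 0) = 1" for n
      by (induction n) (simp_all add: monomial_Suc divided_def sc_one monomial_def)
    have "monomial (s + 1) b0 = divided q' (b0 q') * divided q (b0 q)"
      using monomial_split2[of q q' "s + 1" b0] seqsD(3)[OF b0(1)] q b0(2) one by (metis Suc_eq_plus1 mult_1_left not_less_eq)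
    also have "\<dots> = sc (1 / fact (b0 q')) * (sc (1 / fact (b0 q)) * (x q ^ b0 q * x q' ^ b0 q'))"
      unfolding divided_def by (simp only: mult.assoc x_power_sc_left x_power_commute(2)[of q'])
    finally have "sc (1 / fact (b0 q')) * (sc (1 / fact (b0 q)) * (x q ^ b0 q * x q' ^ b0 q')) \<in> A" using mb by simp
    from mult_mem[OF mult_mem[OF this, of "sc (fact (b0 q'))"], of "sc (fact (b0 q))"] show ?thesis
      by (simp add: mult.assoc[symmetric] sc_mult[symmetric] sc_one del: sc_mult)
  qed
  have ii: "x (p + 1) ^ (m'' + 1) \<in> A"
  proof -
    define r where "r = m'' + 1"
    define s where "s = r * (p + 1)"
    define b0 where "b0 = (\<lambda>j. if j = p + 1 then r else 0 :: nat)"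
    have b0: "b0 \<in> seqs r s"
      using seqs_iff[of "p + 1" b0 r s] by (simp add: b0_def s_def if_distrib[of "\<lambda>x. _ * x"] cong: if_cong)
    have m: "xb r s \<in> A"
      by (rule xb[of r s "p + 1"]) (simp_all add: r_def s_def)
    have "x (p + 1) ^ b0 (p + 1) * x p ^ b0 p \<in> A"
    proof (rule isolate[OF b0 _ _ m])
      fix b assume b: "b \<in> seqs r s" "b \<noteq> b0"
      show "monomial (s + 1) b \<in> A"
      proof (cases "\<exists>j\<ge>p + 2. b j \<noteq> 0")
        case True
        then show ?thesis using big[OF b(1)] by blast
      next
        case False
        then have "int s - int r * int p \<le> int (b (p + 1))" by (intro seqs_shifted_sum(2)[OF b(1)]) auto
        then have "r \<le> b (p + 1)" by (simp add: s_def algebra_simps)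
        then have "b (p + 1) = r" using seqs_bounds(1)[OF b(1), of "p + 1"] by simp
        then have "b j = 0" if "j \<noteq> p + 1" for j
        proof -
          let ?n = "max s (max (p + 1) j)"
          have "b (p + 1) + b j = (\<Sum>i\<in>{p + 1, j}. b i)" using that by simp
          also have "\<dots> \<le> (\<Sum>i\<le>?n. b i)" by (rule sum_mono2) auto
          also have "\<dots> = r" by (rule seqsD(1)[OF b(1)]) simp
          finally show ?thesis using \<open>b (p + 1) = r\<close> by simp
        qed
        then have "b = b0" using \<open>b (p + 1) = r\<close> by (auto simp: b0_def)
        with b(2) show ?thesis by simp
      qed
    qed (auto simp: b0_def)
    then show ?thesis by (simp add: b0_def r_def)
  qed
  have iii: "\<forall>b. b + 2 * a \<ge> m' + m'' + 1 \<longrightarrow> x p ^ b * x (p + 1) ^ a \<in> A" for a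
  proof (induction "m'' + 1 - a" arbitrary: a rule: less_induct)
    case less
    show ?case
    proof (cases "a \<ge> m'' + 1")
      case True
      then show ?thesis using power_mem_mono[OF ii] mult_mem by blast
    next
      case False
      then have a: "a \<le> m''" by simp
      have IH: "x p ^ b * x (p + 1) ^ a' \<in> A" if "a' > a" "b + 2 * a' \<ge> m' + m'' + 1" for a' b
        using less[of a'] that a by auto
      define c where "c = m' + m'' + 1 - 2 * a"
      have c: "c + 2 * a = m' + m'' + 1" "c \<ge> 1" using a le by (auto simp: c_def)
      define r where "r = c + a"
      define s where "s = r * p + a"
      define b0 where "b0 = (\<lambda>j. if j = p then c else if j = p + 1 then a else 0 :: nat)"
      have b0: "b0 \<in> seqs r s"
      proof -
        have "(\<Sum>j\<le>p + 1. b0 j) = (\<Sum>j\<le>p + 1. (if j = p then c else 0) + (if j = p + 1 then a else 0))"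
          by (rule sum.cong) (auto simp: b0_def)
        then have "(\<Sum>j\<le>p + 1. b0 j) = c + a" by (simp add: sum.distrib)
        moreover have "(\<Sum>j\<le>p + 1. j * b0 j) = p * c + (p + 1) * a"
        proof -
          have "(\<Sum>j\<le>p + 1. j * b0 j) = (\<Sum>j\<le>p + 1. (if j = p then p * c else 0) + (if j = p + 1 then (p + 1) * a else 0))"
            by (rule sum.cong) (auto simp: b0_def)
          then show ?thesis by (simp add: sum.distrib)
        qed
        ultimately show ?thesis
          using seqs_iff[of "p + 1" b0 r s] by (simp add: b0_def r_def s_def algebra_simps)
      qed
      \<comment> \<open>The relation for \<open>K = p\<close> requires \<open>p \<ge> 1\<close>; for \<open>p = 0\<close> one has \<open>r + s > N\<close> instead.\<close>
      have m: "xb r s \<in> A"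
      proof (cases "p = 0")
        case True
        have "r + s \<ge> Suc N" using True c by (simp add: N r_def s_def)
        then show ?thesis by (rule xb_mem)
      next
        case False
        then have "1 * 1 \<le> (c + a) * p" using c(2) by (intro mult_le_mono) auto
        then have s1: "1 \<le> s" unfolding s_def r_def by linarith
        show ?thesis
        proof (rule xb[of r s p])
          show "1 + r * p + ((p - p) * L + (if p \<le> p then m' else 0) + (if p \<le> p + 1 then m'' else 0)) \<le> s + r"
            using c(1) by (simp add: s_def r_def)
        qed (use False c s1 in \<open>auto simp: r_def\<close>)
      qed
      have "x p ^ b0 p * x (p + 1) ^ b0 (p + 1) \<in> A"
      proof (rule isolate[OF b0 _ _ m])
        fix b assume b: "b \<in> seqs r s" "b \<noteq> b0"
        show "monomial (s + 1) b \<in> A"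
        proof (cases "\<exists>j\<ge>p + 2. b j \<noteq> 0")
          case True
          then show ?thesis using big[OF b(1)] by blast
        next
          case False
          then have top: "\<And>j. j \<ge> p + 2 \<Longrightarrow> b j = 0" by auto
          have "int s + int r - int r * int p \<le> int (b p) + 2 * int (b (p + 1))"
            by (rule seqs_shifted_sum(1)[OF b(1) top])
          then have e1: "b p + 2 * b (p + 1) \<ge> m' + m'' + 1"
            using c(1) unfolding s_def r_def by simp
          have "int s - int r * int p \<le> int (b (p + 1))"
            by (rule seqs_shifted_sum(2)[OF b(1) top])
          then have e2: "a \<le> b (p + 1)" unfolding s_def by simp
          have "b (p + 1) \<noteq> a"
          proof
            assume eq: "b (p + 1) = a"
            with e1 c have "b p \<ge> c" by simp
            have rest: "b p + b (p + 1) + b j \<le> r" if "j \<noteq> p" "j \<noteq> p + 1" for j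
            proof -
              let ?n = "max s (max (p + 1) j)"
              have "b p + b (p + 1) + b j = (\<Sum>i\<in>{p, p + 1, j}. b i)" using that by simp
              also have "\<dots> \<le> (\<Sum>i\<le>?n. b i)" by (rule sum_mono2) auto
              also have "\<dots> = r" by (rule seqsD(1)[OF b(1)]) simp
              finally show ?thesis .
            qed
            have "b p + b (p + 1) \<le> r" using rest[of "p + 2"] by simp
            then have "b p = c" using \<open>b p \<ge> c\<close> eq by (simp add: r_def)
            then have "b j = b0 j" for j
              using rest[of j] eq by (auto simp: b0_def r_def)
            then show False using b(2) by auto
          qed
          with e2 have "x p ^ b p * x (p + 1) ^ b (p + 1) \<in> A"
            by (intro IH e1) simp
          then show ?thesis
            by (rule monomial_mem2[OF _ seqs_lt[OF b(1)] seqs_lt[OF b(1)], rotated]) simp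
        qed
      qed (auto simp: b0_def)
      then have base: "x p ^ c * x (p + 1) ^ a \<in> A" by (simp add: b0_def)
      show ?thesis
      proof (intro allI impI)
        fix b assume "m' + m'' + 1 \<le> b + 2 * a"
        then have "x p ^ b = x p ^ (b - c) * x p ^ c" using c(1) by (simp add: power_add[symmetric])
        then show "x p ^ b * x (p + 1) ^ a \<in> A" using mult_mem[OF base, of "x p ^ (b - c)"] by (simp add: mult.assoc)
      qed
    qed
  qed
  show ?thesis using i ii iii by (auto simp: relations_at_def)
qed

end

section \<open>Operators representing the current algebra\<close>

text \<open>Additive endomorphisms.  They turn the action on a quotient into identities in a ring and a left ideal of that
  ring.  Their \<open>0\<close> and \<open>1\<close> differ only on a nontrivial group, which the class \<open>ring_1\<close> of the carrier provides.\<close>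

typedef (overloaded) ('v::ab_group_add) endo = "{f :: 'v \<Rightarrow> 'v. \<forall>u w. f (u + w) = f u + f w}"
  morphisms app Endo
  by (intro exI[of _ "\<lambda>u. u"]) simp

setup_lifting type_definition_endo

lemma app_add: "app f (u + w) = app f u + app f w"
  using app[of f] by simp

lemma app_zero [simp]: "app f 0 = 0"
  using app_add[of f 0 0] by simp

instantiation endo :: (ring_1) ring_1
begin

lift_definition zero_endo :: "'a endo" is "\<lambda>_. 0" by simp
lift_definition one_endo :: "'a endo" is "\<lambda>u. u" by simp
lift_definition plus_endo :: "'a endo \<Rightarrow> 'a endo \<Rightarrow> 'a endo" is "\<lambda>f g u. f u + g u" by (simp add: algebra_simps)
lift_definition minus_endo :: "'a endo \<Rightarrow> 'a endo \<Rightarrow> 'a endo" is "\<lambda>f g u. f u - g u" by (simp add: algebra_simps)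
lift_definition uminus_endo :: "'a endo \<Rightarrow> 'a endo" is "\<lambda>f u. - f u" by simp
lift_definition times_endo :: "'a endo \<Rightarrow> 'a endo \<Rightarrow> 'a endo" is "\<lambda>f g u. f (g u)" by simp

instance
proof
  show "(0 :: 'a endo) \<noteq> 1"
    by transfer (metis zero_neq_one)
qed (transfer; simp add: algebra_simps fun_eq_iff)+

end

lemma app_simps: "app (f + g) u = app f u + app g u" "app (f - g) u = app f u - app g u"
  "app (f * g) u = app f (app g u)" "app 0 u = 0" "app 1 u = u"
  by (transfer; simp)+

lemma endo_eqI: "(\<And>u. app f u = app g u) \<Longrightarrow> f = g"
  by transfer (simp add: fun_eq_iff)

lemma (in vector_space) exists_projection:
  assumes "subspace I"
  obtains \<pi> where "\<And>u w. \<pi> (u + w) = \<pi> u + \<pi> w" "\<And>c u. \<pi> (scale c u) = scale c (\<pi> u)"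
    "\<And>u. u \<in> I \<Longrightarrow> \<pi> u = 0" "\<And>u. u - \<pi> u \<in> I"
proof -
  interpret P: vector_space_pair scale scale by unfold_locales
  obtain B where B: "B \<subseteq> I" "independent B" "I \<subseteq> span B"
    using maximal_independent_subset[of I] by metis
  define C where "C = extend_basis B"
  have C: "independent C" "B \<subseteq> C" "span C = UNIV"
    using independent_extend_basis[OF B(2)] extend_basis_superset[OF B(2)] span_extend_basis[OF B(2)] by (simp_all add: C_def)
  define \<pi> where "\<pi> = P.construct C (\<lambda>b. if b \<in> B then 0 else b)"
  have lin: "Vector_Spaces.linear scale scale \<pi>"
    unfolding \<pi>_def by (rule P.linear_construct[OF C(1)])
  have add: "\<pi> (u + w) = \<pi> u + \<pi> w" and scl: "\<pi> (scale c u) = scale c (\<pi> u)" for u w c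
    using lin by (auto simp: Vector_Spaces.linear_iff)
  have basis: "\<pi> b = (if b \<in> B then 0 else b)" if "b \<in> C" for b
    unfolding \<pi>_def by (rule P.construct_basis[OF C(1) that])
  have p0: "\<pi> 0 = 0" using scl[of 0 0] by simp
  have "subspace {u. \<pi> u = 0}" by (auto simp: subspace_def add scl p0)
  moreover have "B \<subseteq> {u. \<pi> u = 0}" using basis C(2) by auto
  ultimately have "span B \<subseteq> {u. \<pi> u = 0}" by (intro span_minimal)
  then have z: "\<pi> u = 0" if "u \<in> I" for u using that B(3) by auto
  have "subspace {u. u - \<pi> u \<in> I}"
  proof (rule subspaceI)
    show "u + w \<in> {u. u - \<pi> u \<in> I}" if "u \<in> {u. u - \<pi> u \<in> I}" "w \<in> {u. u - \<pi> u \<in> I}" for u w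
    proof -
      have "u + w - \<pi> (u + w) = (u - \<pi> u) + (w - \<pi> w)" by (simp add: add)
      then show ?thesis
        using that subspace_add[OF assms, of "u - \<pi> u" "w - \<pi> w"] by (simp only: mem_Collect_eq)
    qed
    show "scale c u \<in> {u. u - \<pi> u \<in> I}" if "u \<in> {u. u - \<pi> u \<in> I}" for c u
      using that subspace_scale[OF assms] by (simp add: scl flip: scale_right_diff_distrib)
  qed (simp add: p0 subspace_0[OF assms])
  moreover have "C \<subseteq> {u. u - \<pi> u \<in> I}"
    using basis B(1) subspace_0[OF assms] by auto
  ultimately have "span C \<subseteq> {u. u - \<pi> u \<in> I}" by (intro span_minimal)
  then show ?thesis using that[OF add scl z] C(3) by auto
qed

text \<open>A representation \<open>T\<close> of \<open>\<gg>[t]\<close> in a ring, with a left ideal that plays the annihilator of a vector.\<close>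

locale current_representation = scalars sc + left_ideal A
  for G :: "'g::ab_group_add lie_datum" and sc :: "complex \<Rightarrow> 'r::ring_1" and A :: "'r set" +
  fixes T :: "'g poly \<Rightarrow> 'r"
  assumes T_add: "T (a + b) = T a + T b" and T_scl: "T (cur_scl G c a) = sc c * T a"
    and T_brk: "T a * T b - T b * T a = T (cur_brk G a b)" and T_sc: "T a * sc c = sc c * T a"

text \<open>\<open>represents a X\<close>: multiplication by \<open>a\<close> on the quotient of the free algebra by \<open>rel_ideal G S\<close>
  is the operator \<open>X\<close>; the quotient is realized as the image of a projection along \<open>rel_ideal G S\<close>.\<close>

locale quotient_action =
  fixes G :: "'g::ab_group_add lie_datum" and S :: "'g free_alg set" and \<pi> :: "'g free_alg \<Rightarrow> 'g free_alg"
  assumes \<pi>_add: "\<pi> (u + w) = \<pi> u + \<pi> w" and \<pi>_const: "\<pi> (const c * u) = const c * \<pi> u"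
    and \<pi>_zero: "u \<in> rel_ideal G S \<Longrightarrow> \<pi> u = 0" and \<pi>_diff_mem: "u - \<pi> u \<in> rel_ideal G S"
begin

definition op :: "'g poly \<Rightarrow> 'g free_alg endo" where "op a = Endo (\<lambda>u. \<pi> (gen a * u))"

definition sop :: "complex \<Rightarrow> 'g free_alg endo" where "sop c = Endo (\<lambda>u. const c * u)"

definition annihilator :: "'g free_alg endo set" where "annihilator = {X. app X (\<pi> 1) = 0}"

definition represents :: "'g free_alg \<Rightarrow> 'g free_alg endo \<Rightarrow> bool" where
  "represents a X \<longleftrightarrow> (\<forall>u. \<pi> (a * u) = app X (\<pi> u))"

lemma app_op: "app (op a) u = \<pi> (gen a * u)"
  unfolding op_def by (subst Endo_inverse) (simp_all add: distrib_left \<pi>_add)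

lemma app_sop: "app (sop c) u = const c * u"
  unfolding sop_def by (subst Endo_inverse) (simp_all add: distrib_left)

lemma \<pi>_minus: "\<pi> (u - w) = \<pi> u - \<pi> w"
  using \<pi>_add[of "u - w" w] by (simp add: algebra_simps)

lemma \<pi>_mult: "\<pi> (a * \<pi> u) = \<pi> (a * u)"
proof -
  have "\<pi> (a * (u - \<pi> u)) = 0" by (intro \<pi>_zero rel_ideal.left \<pi>_diff_mem)
  then show ?thesis by (simp add: right_diff_distrib \<pi>_minus)
qed

lemma \<pi>_eq_0_iff: "\<pi> a = 0 \<longleftrightarrow> a \<in> rel_ideal G S"
  using \<pi>_diff_mem[of a] \<pi>_zero by auto

lemma represents_mem: "represents a X \<Longrightarrow> a \<in> rel_ideal G S \<longleftrightarrow> X \<in> annihilator"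
  using \<pi>_eq_0_iff[of a] by (auto simp: represents_def annihilator_def dest: spec[of _ 1])

lemma represents_gen: "represents (gen a) (op a)"
  by (simp add: represents_def app_op \<pi>_mult)

lemma represents_const: "represents (const c) (sop c)"
  by (simp add: represents_def app_sop \<pi>_const)

lemma represents_mult: "represents a X \<Longrightarrow> represents b Y \<Longrightarrow> represents (a * b) (X * Y)"
  by (simp add: represents_def app_simps mult.assoc)

lemma represents_add: "represents a X \<Longrightarrow> represents b Y \<Longrightarrow> represents (a + b) (X + Y)"
  by (simp add: represents_def app_simps distrib_right \<pi>_add)

lemma represents_one: "represents 1 1"
  by (simp add: represents_def app_simps)

lemma represents_power: "represents a X \<Longrightarrow> represents (a ^ n) (X ^ n)"
  by (induction n) (auto intro: represents_one represents_mult)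

lemma represents_sum: "finite F \<Longrightarrow> (\<And>i. i \<in> F \<Longrightarrow> represents (f i) (g i)) \<Longrightarrow> represents (\<Sum>i\<in>F. f i) (\<Sum>i\<in>F. g i)"
proof (induction F rule: finite_induct)
  case empty
  have "\<pi> 0 = 0" by (intro \<pi>_zero rel_ideal.zero)
  then show ?case by (simp add: represents_def app_simps)
qed (auto intro: represents_add)

lemma represents_prod_list: "(\<And>i. i \<in> set is \<Longrightarrow> represents (f i) (g i)) \<Longrightarrow> represents (prod_list (map f is)) (prod_list (map g is))"
  by (induction "is") (auto intro: represents_one represents_mult)

lemma const_cst: "const c = cst c"
  by (simp add: const_def cst_def)

lemma current_representation: "current_representation G sop annihilator op"
proof
  show "sop (c + d) = sop c + sop d" "sop (c * d) = sop c * sop d" "sop 1 = 1" for c d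
    by (auto intro!: endo_eqI simp: app_simps app_sop const_cst cst_add cst_mult distrib_right mult.assoc)
  show "0 \<in> annihilator" "a \<in> annihilator \<Longrightarrow> b \<in> annihilator \<Longrightarrow> a + b \<in> annihilator"
    "a \<in> annihilator \<Longrightarrow> r * a \<in> annihilator" for a b r
    by (auto simp: annihilator_def app_simps)
  have env: "\<pi> (r * u) = 0" if "r \<in> env_relators G" for r u
    using that by (intro \<pi>_zero rel_ideal.env)
  show "op (a + b) = op a + op b" for a b
  proof (rule endo_eqI)
    fix u
    have "gen (a + b) - gen a - gen b \<in> env_relators G" by (auto simp: env_relators_def)
    from env[OF this, of u] show "app (op (a + b)) u = app (op a + op b) u"
      by (simp add: app_simps app_op left_diff_distrib \<pi>_minus diff_eq_eq add.commute)
  qed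
  show "op (cur_scl G c a) = sop c * op a" for c a
  proof (rule endo_eqI)
    fix u
    have "gen (cur_scl G c a) - const c * gen a \<in> env_relators G" by (auto simp: env_relators_def)
    from env[OF this, of u] show "app (op (cur_scl G c a)) u = app (sop c * op a) u"
      by (simp add: app_simps app_op app_sop left_diff_distrib \<pi>_minus mult.assoc \<pi>_const)
  qed
  show "op a * op b - op b * op a = op (cur_brk G a b)" for a b
  proof (rule endo_eqI)
    fix u
    have "gen a * gen b - gen b * gen a - gen (cur_brk G a b) \<in> env_relators G" by (auto simp: env_relators_def)
    from env[OF this, of u] show "app (op a * op b - op b * op a) u = app (op (cur_brk G a b)) u"
      by (simp add: app_simps app_op left_diff_distrib \<pi>_minus mult.assoc \<pi>_mult)
  qed
  show "op a * sop c = sop c * op a" for a c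
    by (rule endo_eqI) (simp add: app_simps app_op app_sop \<pi>_const[symmetric], simp add: const_cst mult_cst_left)
qed

end

lemma exists_quotient_action: "\<exists>\<pi>. quotient_action G S \<pi>"
proof -
  interpret V: vector_space "\<lambda>c p. cst c * (p :: ('a poly) fword \<Rightarrow>\<^sub>0 complex)" by (rule vector_space_cst)
  have "V.subspace (rel_ideal G S)"
    by (auto simp: V.subspace_def intro: rel_ideal.intros)
  from V.exists_projection[OF this] obtain \<pi> where
    "\<And>u w. \<pi> (u + w) = \<pi> u + \<pi> w" "\<And>c u. \<pi> (cst c * u) = cst c * \<pi> u"
    "\<And>u. u \<in> rel_ideal G S \<Longrightarrow> \<pi> u = 0" "\<And>u. u - \<pi> u \<in> rel_ideal G S" by metis
  then have "quotient_action G S \<pi>"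
    by unfold_locales (simp_all add: const_def cst_def)
  then show ?thesis by blast
qed

lemma rel_ideal_subset:
  assumes "\<And>r. r \<in> S \<Longrightarrow> r \<in> rel_ideal G S'"
  shows "rel_ideal G S \<subseteq> rel_ideal G S'"
proof
  fix a assume "a \<in> rel_ideal G S"
  then show "a \<in> rel_ideal G S'"
    by induction (use assms in \<open>auto intro: rel_ideal.intros\<close>)
qed

text \<open>The quotients are not only isomorphic but equal, so the identity is an isomorphism.\<close>

lemma cyclic_module_isomorphic:
  assumes "rel_ideal G S = rel_ideal G S'"
  shows "cur_module_isomorphic (cyclic_module G S) (cyclic_module G S')"
proof -
  have "cls G S = cls G S'" using assms by (simp add: cls_def fun_eq_iff)
  then have "cyclic_module G S = cyclic_module G S'" by (simp add: cyclic_module_def)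
  then have "cur_module_iso (cyclic_module G S) (cyclic_module G S') (\<lambda>u. u)"
    by (simp add: cur_module_iso_def bij_betw_def)
  then show ?thesis unfolding cur_module_isomorphic_def by blast
qed

section \<open>Comparison of the relations\<close>

lemma cur_brk_monom:
  assumes "\<And>y. brk G 0 y = 0" "\<And>y. brk G y 0 = 0"
  shows "cur_brk G (monom y a) (monom z b) = monom (brk G y z) (a + b)"
proof (cases "y = 0 \<or> z = 0")
  case True
  then show ?thesis by (auto simp: cur_brk_def assms)
next
  case False
  have "cur_brk G (monom y a) (monom z b) = (\<Sum>i\<le>a. \<Sum>j\<le>b. monom (brk G (if a = i then y else 0) (if b = j then z else 0)) (i + j))"
    using False by (simp add: cur_brk_def degree_monom_eq)
  also have "\<dots> = (\<Sum>i\<le>a. \<Sum>j\<le>b. if i = a then if j = b then monom (brk G y z) (a + b) else 0 else 0)"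
    by (intro sum.cong refl) (auto simp: assms)
  also have "\<dots> = (\<Sum>i\<le>a. if i = a then \<Sum>j\<le>b. if j = b then monom (brk G y z) (a + b) else 0 else 0)"
    by (intro sum.cong refl) simp
  also have "\<dots> = monom (brk G y z) (a + b)" by simp
  finally show ?thesis .
qed

lemma cur_scl_monom:
  assumes "scl G c 0 = 0"
  shows "cur_scl G c (monom y a) = monom (scl G c y) a"
  using assms by (simp add: cur_scl_def map_poly_monom)

lemma sum_list_drop_replicate:
  "sum_list (drop K (replicate p L)) = (p - K) * L"
  by (simp add: drop_replicate sum_list_replicate)

lemma sum_list_drop_replicate1:
  "sum_list (drop K (replicate p L @ [m'])) = (p - K) * L + (if K \<le> p then m' else 0)"
proof (cases "K \<le> p")
  case False
  then have "drop (K - p) [m'] = []" by simp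
  then show ?thesis using False by (simp add: drop_replicate sum_list_replicate)
qed (simp add: drop_replicate sum_list_replicate)

lemma sum_list_drop_replicate2:
  "sum_list (drop K (replicate p L @ [m', m''])) = (p - K) * L + (if K \<le> p then m' else 0) + (if K \<le> p + 1 then m'' else 0)"
proof -
  consider "K \<le> p" | "K = p + 1" | "K \<ge> p + 2" by linarith
  then show ?thesis
    by cases (simp_all add: drop_replicate sum_list_replicate)
qed

locale root_operators = simple_datum G + current_representation G sc A T
  for G :: "'g::ab_group_add lie_datum" and sc :: "complex \<Rightarrow> 'r::ring_1" and A :: "'r set" and T :: "'g poly \<Rightarrow> 'r"
begin

definition Tm :: "'g \<Rightarrow> nat \<Rightarrow> 'r" where "Tm y s = T (monom y s)"

lemma Tm_add: "Tm (y + z) s = Tm y s + Tm z s"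
  by (simp add: Tm_def T_add flip: add_monom)

lemma Tm_scl: "Tm (scl G c y) s = sc c * Tm y s"
  by (simp add: Tm_def T_scl flip: cur_scl_monom)

lemma Tm_zero: "Tm 0 s = 0"
  using Tm_scl[of 0 0 s] by (simp add: sc_zero)

lemma Tm_brk: "Tm y a * Tm z b - Tm z b * Tm y a = Tm (brk G y z) (a + b)"
  by (simp add: Tm_def T_brk cur_brk_monom)

lemma Tm_brk': "Tm y a * Tm z b = Tm z b * Tm y a + Tm (brk G y z) (a + b)"
  using Tm_brk[of y a z b] by (simp add: algebra_simps)

lemma Tm_sc: "Tm y s * sc c = sc c * Tm y s"
  by (simp add: Tm_def T_sc)

abbreviation X :: "('g \<Rightarrow> complex) \<Rightarrow> nat \<Rightarrow> 'r" where "X \<gamma> j \<equiv> Tm (xminus G \<gamma>) j"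

lemma sc_mem_cancel: "sc c * a \<in> A \<Longrightarrow> c \<noteq> 0 \<Longrightarrow> a \<in> A"
  using mult_mem[of "sc c * a" "sc (inverse c)"] sc_inverse(2)[of c a] by simp

lemma X_commute: "X \<gamma> i * X \<gamma> j = X \<gamma> j * X \<gamma> i"
  using Tm_brk'[of "xminus G \<gamma>" i "xminus G \<gamma>" j] by (simp add: Tm_zero)

lemma X_brk: "\<gamma> \<in> pos_roots G \<Longrightarrow> \<delta> \<in> pos_roots G \<Longrightarrow> X \<gamma> a * X \<delta> b - X \<delta> b * X \<gamma> a = sc (nconst \<gamma> \<delta>) * X (\<gamma> + \<delta>) (a + b)"
  by (simp add: Tm_brk brk_xminus Tm_scl)

end

text \<open>A vector of highest weight \<open>\<mu>\<close> in an integrable module, annihilated by \<open>\<hh> \<otimes> t\<complex>[t]\<close>.\<close>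

locale highest_weight_vector = root_operators G sc A T + dominant_weight G \<mu> N
  for G :: "'g::ab_group_add lie_datum" and sc :: "complex \<Rightarrow> 'r::ring_1" and A :: "'r set" and T :: "'g poly \<Rightarrow> 'r"
    and \<mu> :: "'g \<Rightarrow> complex" and N :: "('g \<Rightarrow> complex) \<Rightarrow> nat" +
  assumes simple_plus_mem: "i \<in> {1..rank G} \<Longrightarrow> Tm (xplus G (sroot G i)) s \<in> A"
    and simple_coroot_mem: "i \<in> {1..rank G} \<Longrightarrow> s \<ge> 1 \<Longrightarrow> Tm (coroot G (sroot G i)) s \<in> A"
    and simple_minus_mem: "i \<in> {1..rank G} \<Longrightarrow> X (sroot G i) 0 ^ Suc (N (sroot G i)) \<in> A"
begin

text \<open>\<open>x\<^sup>+\<^sub>\<alpha>\<close> is a nonzero multiple of \<open>[x\<^sup>+\<^sub>i, [x\<^sup>-\<^sub>i, x\<^sup>+\<^sub>\<alpha>]]\<close> when \<open>\<langle>\<alpha>, \<alpha>\<^sub>i\<^sup>\<or>\<rangle> > 0\<close>.\<close>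

lemma root_plus_mem:
  assumes "\<alpha> \<in> pos_roots G"
  shows "y \<in> root_space G \<alpha> \<Longrightarrow> Tm y s \<in> A"
  using assms
proof (induction \<alpha> arbitrary: y s rule: pos_root_induct)
  case (simple i)
  obtain c where "y = scl G c (xplus G (sroot G i))"
    using root_space_one_dim(1)[OF simple_pos[OF simple(1)] simple(2)] by blast
  then show ?case using simple_plus_mem[OF simple(1)] by (simp add: Tm_scl mult_mem)
next
  case (refl i \<alpha> c)
  let ?a = "sroot G i"
  note a = simple_pos[OF refl(1)]
  interpret S: sl2_weights "scl G" "brk G (xplus G ?a)" "brk G (xminus G ?a)" "{0}"
    "\<lambda>c. {x. brk G (coroot G ?a) x = scl G c x}" by (rule sl2[OF a])
  have 0: "y = 0 \<Longrightarrow> ?case" by (simp add: Tm_zero zero_mem)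
  show ?case
  proof (cases "y = 0")
    case False
    define u where "u = brk G (xminus G ?a) y"
    have u: "u \<in> root_space G (\<alpha> - ?a)"
      using root_space_brk[OF root_vectors(3)[OF a] refl.prems] by (simp add: u_def)
    have nz: "(brk G (xminus G ?a) ^^ n) y \<noteq> 0" if "n \<le> Suc c" for n
      by (rule lower_nonzero[OF a refl.prems False refl(4) that])
    have unz: "u \<noteq> 0" using nz[of 1] by (simp add: u_def)
    have "\<alpha> - ?a \<in> roots G"
      using rootI[OF _ _ u unz] hstar_diff[OF pos_root_hstar[OF refl(2)] pos_root_hstar[OF a]] refl(3) by simp
    then have pos: "\<alpha> - ?a \<in> pos_roots G" by (rule diff_simple_pos[OF refl(2,1,3)])
    have h: "height (\<alpha> - ?a) < height \<alpha>" using height_simple[OF refl(1)] by simp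
    have um: "Tm u s' \<in> A" for s' by (rule refl(6)[OF pos h u])
    obtain k where k: "brk G (xplus G ?a) u = scl G k y"
    proof -
      have "?a + (\<alpha> - ?a) = \<alpha>" by simp
      then have "brk G (xplus G ?a) u \<in> root_space G \<alpha>"
        using root_space_brk[OF root_vectors(1)[OF a] u] by metis
      then obtain k1 where k1: "brk G (xplus G ?a) u = scl G k1 (xplus G \<alpha>)"
        using root_space_one_dim(1)[OF refl(2)] by blast
      obtain k2 where k2: "y = scl G k2 (xplus G \<alpha>)" using root_space_one_dim(1)[OF refl(2) refl.prems] by blast
      then have "k2 \<noteq> 0" using False by auto
      then show ?thesis using that[of "k1 / k2"] k1 k2 by simp
    qed
    have "k \<noteq> 0"
    proof
      assume "k = 0"
      then have "brk G (xplus G ?a) u = 0" using k by simp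
      moreover obtain n where "(brk G (xminus G ?a) ^^ n) u = 0" using xminus_nilpotent[OF a] by blast
      moreover have "u \<in> {x. brk G (coroot G ?a) x = scl G (of_nat (Suc c) - 2) x}"
        using coroot_weight[OF a u] refl(4) root_coroot_self[OF pos_rootD[OF a]] by simp
      ultimately obtain m where m: "of_nat (Suc c) - 2 = (of_nat m :: complex)" "(brk G (xminus G ?a) ^^ Suc m) u = 0"
        using S.highest_weight_natural[of u "of_nat (Suc c) - 2" n] unz by auto
      then have "of_nat (Suc c) = (of_nat (m + 2) :: complex)" by (simp add: algebra_simps)
      then have "Suc c = m + 2" by (simp only: of_nat_eq_iff)
      moreover have "(brk G (xminus G ?a) ^^ (m + 2)) y = 0"
        using m(2) by (simp add: u_def funpow_swap1)
      ultimately show False using nz[of "m + 2"] by simp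
    qed
    have "Tm (xplus G ?a) 0 * Tm u s - Tm u s * Tm (xplus G ?a) 0 \<in> A"
      using um simple_plus_mem[OF refl(1)] by (intro diff_mem mult_mem)
    then have "sc k * Tm y s \<in> A" by (simp add: Tm_brk k Tm_scl)
    then show ?thesis using \<open>k \<noteq> 0\<close> by (rule sc_mem_cancel)
  qed (rule 0)
qed

lemma cartan_mem:
  assumes "s \<ge> 1" "y \<in> cartan G"
  shows "Tm y s \<in> A"
proof -
  have "subspace {y. Tm y s \<in> A}"
    by (auto simp: subspace_def Tm_zero Tm_add Tm_scl zero_mem add_mem mult_mem)
  moreover have "rep_elt G (sroot G i) \<in> {y. Tm y s \<in> A}" if i: "i \<in> {1..rank G}" for i
  proof -
    have "rep_elt G (sroot G i) = scl G (wform G (sroot G i) (sroot G i) / 2) (coroot G (sroot G i))"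
      using norm_root_nz[OF simple_root[OF i]] by (simp add: coroot_def)
    then show ?thesis using simple_coroot_mem[OF i assms(1)] by (simp add: Tm_scl mult_mem)
  qed
  ultimately have "span ((\<lambda>i. rep_elt G (sroot G i)) ` {1..rank G}) \<subseteq> {y. Tm y s \<in> A}"
    by (intro span_minimal) auto
  then show ?thesis using cartan_span_rep assms(2) by auto
qed

lemma root_minus_mem:
  assumes "\<alpha> \<in> pos_roots G"
  shows "X \<alpha> 0 ^ Suc (N \<alpha>) \<in> A"
proof (rule power_of_root_vector_in_left_ideal[where Y = "\<lambda>\<gamma>. X \<gamma> 0" and sc = sc])
  show "left_ideal A" "scalars sc" by unfold_locales
  show "X \<gamma> 0 * X \<delta> 0 - X \<delta> 0 * X \<gamma> 0 = sc (nconst \<gamma> \<delta>) * X (\<gamma> + \<delta>) 0"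
    if "\<gamma> \<in> pos_roots G" "\<delta> \<in> pos_roots G" for \<gamma> \<delta>
    using X_brk[OF that, of 0 0] by simp
qed (use assms simple_minus_mem Tm_sc in auto)

lemma root_garland:
  assumes \<alpha>: "\<alpha> \<in> pos_roots G"
  shows "garland sc (X \<alpha>) A (\<lambda>j. Tm (coroot G \<alpha>) j) (Tm (xplus G \<alpha>) 1) (N \<alpha>)"
proof
  show "X \<alpha> i * X \<alpha> j = X \<alpha> j * X \<alpha> i" for i j by (rule X_commute)
  show "X \<alpha> i * sc c = sc c * X \<alpha> i" for i c by (rule Tm_sc)
  show "Tm (xplus G \<alpha>) 1 \<in> A" by (rule root_plus_mem[OF \<alpha> root_vectors(1)[OF \<alpha>]])
  show "Tm (coroot G \<alpha>) i \<in> A" if "1 \<le> i" for i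
    by (rule cartan_mem[OF that coroot_cartan[OF pos_rootD[OF \<alpha>]]])
  show "Tm (xplus G \<alpha>) 1 * X \<alpha> j = X \<alpha> j * Tm (xplus G \<alpha>) 1 + Tm (coroot G \<alpha>) (Suc j)" for j
    using Tm_brk'[of "xplus G \<alpha>" 1 "xminus G \<alpha>" j] root_vectors(5)[OF \<alpha>] by simp
  show "Tm (coroot G \<alpha>) i * X \<alpha> j = X \<alpha> j * Tm (coroot G \<alpha>) i - 2 * X \<alpha> (i + j)" for i j
  proof -
    have "brk G (coroot G \<alpha>) (xminus G \<alpha>) = scl G (- 2) (xminus G \<alpha>)"
      using coroot_weight[OF \<alpha> root_vectors(3)[OF \<alpha>]] root_coroot_self[OF pos_rootD[OF \<alpha>]] by simp
    then have "Tm (brk G (coroot G \<alpha>) (xminus G \<alpha>)) (i + j) = sc (- 2) * X \<alpha> (i + j)"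
      by (simp only: Tm_scl)
    also have "sc (- 2) = - 2" using sc_of_nat[of 2] by (simp add: sc_uminus)
    finally show ?thesis using Tm_brk'[of "coroot G \<alpha>" i "xminus G \<alpha>" j] by simp
  qed
  show "X \<alpha> 0 ^ Suc (N \<alpha>) \<in> A" by (rule root_minus_mem[OF \<alpha>])
qed

text \<open>The commutator with \<open>\<alpha>\<^sup>\<or> \<otimes> t\<close> multiplies \<open>x\<^sup>-\<^sub>\<alpha> \<otimes> t\<^sup>j\<close> by \<open>t\<close>, up to the factor \<open>- 2\<close>.\<close>

lemma X_mem_mono:
  assumes \<alpha>: "\<alpha> \<in> pos_roots G" and "X \<alpha> q \<in> A" "q \<le> q'"
  shows "X \<alpha> q' \<in> A"
proof -
  interpret g: garland sc "X \<alpha>" A "\<lambda>j. Tm (coroot G \<alpha>) j" "Tm (xplus G \<alpha>) 1" "N \<alpha>"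
    by (rule root_garland[OF \<alpha>])
  show ?thesis using assms(3)
  proof (induction q' rule: dec_induct)
    case (step n)
    have "X \<alpha> n * Tm (coroot G \<alpha>) 1 - Tm (coroot G \<alpha>) 1 * X \<alpha> n \<in> A"
      using step.IH g.h_mem[of 1] by (intro diff_mem mult_mem) auto
    moreover have "X \<alpha> n * Tm (coroot G \<alpha>) 1 - Tm (coroot G \<alpha>) 1 * X \<alpha> n = of_nat 2 * X \<alpha> (Suc n)"
      using g.h_x[of 1 n] by simp
    ultimately show ?case using g.divide_mem[of 2 "X \<alpha> (Suc n)"] by simp
  qed (rule assms(2))
qed

end

locale level_datum = simple_datum G
  for G :: "'g::ab_group_add lie_datum" +
  fixes lam :: "'g \<Rightarrow> complex" and l m k :: nat
  assumes lam: "lam \<in> Lplus G"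
begin

text \<open>The numbers \<open>(\<lambda>|\<alpha>)\<close>, \<open>d\<^sub>\<alpha>\<close> and \<open>(\<theta>|\<alpha>)\<close>, which are natural for positive \<open>\<alpha>\<close>.\<close>

definition pn :: "('g \<Rightarrow> complex) \<Rightarrow> nat" where "pn \<alpha> = cnat (wform G lam \<alpha>)"
definition dn :: "('g \<Rightarrow> complex) \<Rightarrow> nat" where "dn \<alpha> = cnat (dnum G \<alpha>)"
definition tn :: "('g \<Rightarrow> complex) \<Rightarrow> nat" where "tn \<alpha> = cnat (wform G \<theta> \<alpha>)"

lemma lam_hstar: "lam \<in> hstar G" and theta_hstar: "\<theta> \<in> hstar G"
  using Lplus_pairing(1)[OF lam] rootD(1)[OF highest_root(1)] by auto

lemma pn: "\<alpha> \<in> pos_roots G \<Longrightarrow> wform G lam \<alpha> = of_nat (pn \<alpha>)"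
  using Lplus_pairing(2)[OF lam, of \<alpha>] by (auto simp: pn_def)

lemma dn: "\<alpha> \<in> pos_roots G \<Longrightarrow> dnum G \<alpha> = of_nat (dn \<alpha>)" "\<alpha> \<in> pos_roots G \<Longrightarrow> dn \<alpha> \<ge> 1"
  by (rule dnum_natural; simp add: dn_def)+

lemma tn: "\<alpha> \<in> pos_roots G \<Longrightarrow> wform G \<theta> \<alpha> = of_nat (tn \<alpha>)"
  "\<alpha> \<in> pos_roots G \<Longrightarrow> \<alpha> \<noteq> \<theta> \<Longrightarrow> tn \<alpha> = 0 \<or> tn \<alpha> = 1" "tn \<theta> = 2" "dn \<theta> = 1"
proof -
  have 01: "cnat 0 = 0" "cnat 1 = 1" "cnat 2 = 2"
    using cnat_of_nat[of 0] cnat_of_nat[of 1] cnat_of_nat[of 2] by simp_all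
  show "tn \<theta> = 2" "dn \<theta> = 1" by (simp_all add: tn_def dn_def dnum_def highest_norm 01)
  show "wform G \<theta> \<alpha> = of_nat (tn \<alpha>)" if "\<alpha> \<in> pos_roots G"
    using highest_pairing[OF that] highest_norm by (cases "\<alpha> = \<theta>") (auto simp: tn_def 01)
  show "tn \<alpha> = 0 \<or> tn \<alpha> = 1" if "\<alpha> \<in> pos_roots G" "\<alpha> \<noteq> \<theta>"
    using highest_pairing[OF that] by (auto simp: tn_def 01)
qed

lemma pn_add: "\<gamma> \<in> pos_roots G \<Longrightarrow> \<delta> \<in> pos_roots G \<Longrightarrow> \<gamma> + \<delta> \<in> pos_roots G \<Longrightarrow> pn (\<gamma> + \<delta>) = pn \<gamma> + pn \<delta>"
proof -
  assume *: "\<gamma> \<in> pos_roots G" "\<delta> \<in> pos_roots G" "\<gamma> + \<delta> \<in> pos_roots G"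
  have "wform G (\<gamma> + \<delta>) lam = wform G \<gamma> lam + wform G \<delta> lam"
    using * by (intro wform_add_left pos_root_hstar lam_hstar)
  then have "(of_nat (pn (\<gamma> + \<delta>)) :: complex) = of_nat (pn \<gamma> + pn \<delta>)"
    using pn[OF *(1)] pn[OF *(2)] pn[OF *(3)] wform_sym[of lam] by simp
  then show ?thesis by (simp only: of_nat_eq_iff)
qed

lemma pn_multiple:
  assumes "\<gamma> \<in> pos_roots G" "\<alpha> \<in> pos_roots G" "\<delta> \<in> pos_roots G" "\<delta> = \<gamma> + (\<lambda>y. of_nat q * \<alpha> y)"
  shows "pn \<delta> = pn \<gamma> + q * pn \<alpha>"
proof -
  have "wform G \<delta> lam = wform G \<gamma> lam + of_nat q * wform G \<alpha> lam"
    unfolding assms(4) using assms(1,2) lam_hstar by (simp add: wform_add_left wform_scale_left hstar_scale pos_root_hstar)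
  then have "(of_nat (pn \<delta>) :: complex) = of_nat (pn \<gamma> + q * pn \<alpha>)"
    using pn[OF assms(1)] pn[OF assms(2)] pn[OF assms(3)] wform_sym[of lam] by simp
  then show ?thesis by (simp only: of_nat_eq_iff)
qed

lemma theta_coroot: "\<alpha> \<in> pos_roots G \<Longrightarrow> \<theta> (coroot G \<alpha>) = of_nat (dn \<alpha> * tn \<alpha>)"
  using eval_coroot_wform[OF theta_hstar pos_rootD] dn(1) tn(1) by simp

definition N :: "('g \<Rightarrow> complex) \<Rightarrow> nat" where "N \<alpha> = l * (dn \<alpha> * pn \<alpha>) + k * (dn \<alpha> * tn \<alpha>)"

lemma lkweight_hstar: "lkweight G l lam k \<in> hstar G"
  using hstar_add[OF hstar_scale[OF lam_hstar, of "of_nat l"] hstar_scale[OF theta_hstar, of "of_nat k"]]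
  by (simp add: lkweight_def plus_fun_def)

lemma lkweight_coroot: "\<alpha> \<in> pos_roots G \<Longrightarrow> lkweight G l lam k (coroot G \<alpha>) = of_nat (N \<alpha>)"
  using eval_coroot_wform[OF lam_hstar pos_rootD, of \<alpha>] theta_coroot[of \<alpha>] dn(1)[of \<alpha>] pn[of \<alpha>]
  by (simp add: lkweight_def N_def)

sublocale lk: dominant_weight G "lkweight G l lam k" N
  by unfold_locales (auto simp: lkweight_hstar lkweight_coroot)

text \<open>The partition attached to a root is \<open>(part_L\<^sup>p, part_1, part_2)\<close>.\<close>

definition part_L :: "('g \<Rightarrow> complex) \<Rightarrow> nat" where "part_L \<alpha> = (if \<alpha> = \<theta> then l else dn \<alpha> * l)"
definition part_1 :: "('g \<Rightarrow> complex) \<Rightarrow> nat" where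
  "part_1 \<alpha> = (if \<alpha> = \<theta> then if m \<le> 2 * k then m else 2 * k else if tn \<alpha> = 0 then 0 else dn \<alpha> * k)"
definition part_2 :: "('g \<Rightarrow> complex) \<Rightarrow> nat" where
  "part_2 \<alpha> = (if \<alpha> = \<theta> \<and> m \<le> 2 * k then 2 * k - m else 0)"

lemma N_partition: "\<alpha> \<in> pos_roots G \<Longrightarrow> N \<alpha> = pn \<alpha> * part_L \<alpha> + part_1 \<alpha> + part_2 \<alpha>"
  using tn(2)[of \<alpha>] tn(3,4) by (auto simp: N_def part_L_def part_1_def part_2_def)

lemma xi_tail:
  assumes "\<alpha> \<in> pos_roots G"
  shows "sum_list (drop K (xi_tuple G l lam m k \<alpha>)) =
    (pn \<alpha> - K) * part_L \<alpha> + (if K \<le> pn \<alpha> then part_1 \<alpha> else 0) + (if K \<le> pn \<alpha> + 1 then part_2 \<alpha> else 0)"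
proof -
  have "wform G \<theta> \<alpha> = 0 \<longleftrightarrow> tn \<alpha> = 0" using tn(1)[OF assms] by simp
  then show ?thesis
    unfolding xi_tuple_def Let_def pn_def[symmetric] dn_def[symmetric]
    by (simp add: sum_list_drop_replicate sum_list_drop_replicate1 sum_list_drop_replicate2 part_L_def part_1_def part_2_def
        del: drop_append drop_replicate)
qed

end

text \<open>\<open>CV_rel\<close> and \<open>bold_rel\<close> are the relations of the two presentations in addition to the highest weight relations,
  imposed on a vector with annihilator \<open>A\<close>.\<close>

locale relation_comparison = level_datum G lam l m k + highest_weight_vector G sc A T "lkweight G l lam k" "level_datum.N G lam l k"
  for G :: "'g::ab_group_add lie_datum" and lam :: "'g \<Rightarrow> complex" and l m k :: nat
    and sc :: "complex \<Rightarrow> 'r::ring_1" and A :: "'r set" and T :: "'g poly \<Rightarrow> 'r" +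
  assumes mk: "k \<le> m"
begin

definition CV_rel :: bool where
  "CV_rel \<longleftrightarrow> (\<forall>\<alpha> r s. \<alpha> \<in> pos_roots G \<and> r \<ge> 1 \<and> s \<ge> 1 \<and>
     (\<exists>K\<ge>1. s + r \<ge> 1 + r * K + sum_list (drop K (xi_tuple G l lam m k \<alpha>))) \<longrightarrow> divided_powers.xb sc (X \<alpha>) r s \<in> A)"

definition bold_rel :: bool where
  "bold_rel \<longleftrightarrow> (\<forall>\<alpha>\<in>pos_roots G. X \<alpha> (pn \<alpha> + tn \<alpha>) \<in> A) \<and>
     (\<forall>\<alpha>\<in>pos_roots G. \<forall>i\<le>k. X \<alpha> (pn \<alpha>) ^ ((k - i) * (dn \<alpha> * tn \<alpha>) + 1) * X \<theta> (pn \<theta> + 1) ^ i \<in> A) \<and>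
     (m \<le> 2 * k \<longrightarrow> X \<theta> (pn \<theta> + 1) ^ (2 * k - m + 1) \<in> A) \<and>
     (m \<ge> 2 * k \<longrightarrow> X \<theta> (pn \<theta> + 1) \<in> A)"

definition root_rel :: "('g \<Rightarrow> complex) \<Rightarrow> bool" where
  "root_rel \<alpha> \<longleftrightarrow> garland.relations_at (X \<alpha>) A (pn \<alpha>) (part_1 \<alpha>) (part_2 \<alpha>)"

lemma root_rel_iff:
  assumes "\<alpha> \<in> pos_roots G"
  shows "root_rel \<alpha> \<longleftrightarrow> (\<forall>j\<ge>pn \<alpha> + 2. X \<alpha> j \<in> A) \<and> X \<alpha> (pn \<alpha> + 1) ^ (part_2 \<alpha> + 1) \<in> A \<and>
     (\<forall>b a. b + 2 * a \<ge> part_1 \<alpha> + part_2 \<alpha> + 1 \<longrightarrow> X \<alpha> (pn \<alpha>) ^ b * X \<alpha> (pn \<alpha> + 1) ^ a \<in> A)"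
  unfolding root_rel_def by (rule garland.relations_at_def[OF root_garland[OF assms]])

lemma CV_rel_iff: "CV_rel \<longleftrightarrow> (\<forall>\<alpha>\<in>pos_roots G. root_rel \<alpha>)"
proof
  assume CV: CV_rel
  show "\<forall>\<alpha>\<in>pos_roots G. root_rel \<alpha>"
  proof
    fix \<alpha> assume \<alpha>: "\<alpha> \<in> pos_roots G"
    interpret g: garland sc "X \<alpha>" A "\<lambda>j. Tm (coroot G \<alpha>) j" "Tm (xplus G \<alpha>) 1" "N \<alpha>"
      by (rule root_garland[OF \<alpha>])
    show "root_rel \<alpha>"
      unfolding root_rel_def
    proof (rule g.xb_imp_relations[where L = "part_L \<alpha>"])
      show "part_2 \<alpha> \<le> part_1 \<alpha>" using mk by (auto simp: part_1_def part_2_def)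
      show "N \<alpha> = pn \<alpha> * part_L \<alpha> + part_1 \<alpha> + part_2 \<alpha>" by (rule N_partition[OF \<alpha>])
      show "g.xb r s \<in> A" if "1 \<le> r" "1 \<le> s" "1 \<le> K"
        "1 + r * K + ((pn \<alpha> - K) * part_L \<alpha> + (if K \<le> pn \<alpha> then part_1 \<alpha> else 0) + (if K \<le> pn \<alpha> + 1 then part_2 \<alpha> else 0)) \<le> s + r" for r s K
        using CV that \<alpha> unfolding CV_rel_def xi_tail[OF \<alpha>, symmetric] by blast
    qed
  qed
next
  assume rel: "\<forall>\<alpha>\<in>pos_roots G. root_rel \<alpha>"
  show CV_rel
    unfolding CV_rel_def
  proof (intro allI impI, elim conjE exE)
    fix \<alpha> r s K assume \<alpha>: "\<alpha> \<in> pos_roots G" and r: "1 \<le> r" and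
      sr: "1 + r * K + sum_list (drop K (xi_tuple G l lam m k \<alpha>)) \<le> s + r"
    interpret g: garland sc "X \<alpha>" A "\<lambda>j. Tm (coroot G \<alpha>) j" "Tm (xplus G \<alpha>) 1" "N \<alpha>"
      by (rule root_garland[OF \<alpha>])
    have "g.relations_at (pn \<alpha>) (part_1 \<alpha>) (part_2 \<alpha>)" using rel \<alpha> by (simp add: root_rel_def)
    then show "g.xb r s \<in> A"
      by (rule g.relations_imp_xb[OF _ N_partition[OF \<alpha>] r sr[unfolded xi_tail[OF \<alpha>]]])
  qed
qed

text \<open>At \<open>\<theta>\<close>, the monomials with \<open>b + 2 a > 2 k\<close> come from the third family with \<open>i = a\<close> when \<open>a \<le> k\<close>, and from the last
  two relations when \<open>a > k\<close>; the latter suffice because \<open>2 k - m \<le> k\<close>.\<close>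

lemma bold_imp_root_rel:
  assumes b: bold_rel and \<alpha>: "\<alpha> \<in> pos_roots G"
  shows "root_rel \<alpha>"
proof -
  have b1: "X \<alpha> (pn \<alpha> + tn \<alpha>) \<in> A" using b \<alpha> by (simp add: bold_rel_def)
  have b2: "X \<alpha> (pn \<alpha>) ^ ((k - i) * (dn \<alpha> * tn \<alpha>) + 1) * X \<theta> (pn \<theta> + 1) ^ i \<in> A" if "i \<le> k" for i
    using b \<alpha> that by (simp add: bold_rel_def)
  let ?p = "pn \<alpha>"
  consider "\<alpha> \<noteq> \<theta>" "tn \<alpha> = 0" | "\<alpha> \<noteq> \<theta>" "tn \<alpha> = 1" | "\<alpha> = \<theta>" using tn(2)[OF \<alpha>] by metis
  then show ?thesis
  proof cases
    case 1
    have mem: "X \<alpha> j \<in> A" if "j \<ge> ?p" for j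
      using X_mem_mono[OF \<alpha>, of ?p j] b1 1 that by simp
    have "X \<alpha> ?p ^ b * X \<alpha> (?p + 1) ^ a \<in> A" if "1 \<le> b + 2 * a" for a b
    proof (cases "a \<ge> 1")
      case True
      then show ?thesis using power_mem_mono[of "X \<alpha> (?p + 1)" 1 a] mem[of "?p + 1"] by (intro mult_mem) simp
    next
      case False
      then have "a = 0" by simp
      then show ?thesis using that power_mem_mono[of "X \<alpha> ?p" 1 b] mem[of ?p] by simp
    qed
    then show ?thesis
      using mem 1 by (simp add: root_rel_iff[OF \<alpha>] part_1_def part_2_def)
  next
    case 2
    have mem: "X \<alpha> j \<in> A" if "j \<ge> ?p + 1" for j
      using X_mem_mono[OF \<alpha>, of "?p + 1" j] b1 2 that by simp
    have "X \<alpha> ?p ^ b * X \<alpha> (?p + 1) ^ a \<in> A" if "dn \<alpha> * k + 1 \<le> b + 2 * a" for a b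
    proof (cases "a \<ge> 1")
      case True
      then show ?thesis using power_mem_mono[of "X \<alpha> (?p + 1)" 1 a] mem[of "?p + 1"] by (intro mult_mem) simp
    next
      case False
      then have "a = 0" by simp
      then show ?thesis using that power_mem_mono[of "X \<alpha> ?p" "dn \<alpha> * k + 1" b] b2[of 0] 2 by (simp add: mult.commute)
    qed
    then show ?thesis
      using mem 2 by (simp add: root_rel_iff[OF \<alpha>] part_1_def part_2_def)
  next
    case 3
    have mem: "X \<theta> j \<in> A" if "j \<ge> pn \<theta> + 2" for j
      using X_mem_mono[OF highest_pos, of "pn \<theta> + 2" j] b1 that unfolding 3 tn(3) by simp
    have top: "X \<theta> (pn \<theta> + 1) ^ (part_2 \<theta> + 1) \<in> A"
      using b by (cases "m \<le> 2 * k") (auto simp: bold_rel_def part_2_def)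
    have sum: "part_1 \<theta> + part_2 \<theta> = 2 * k" by (simp add: part_1_def part_2_def)
    have p2: "part_2 \<theta> \<le> k" using mk by (auto simp: part_2_def)
    have "X \<theta> (pn \<theta>) ^ b * X \<theta> (pn \<theta> + 1) ^ a \<in> A" if "2 * k + 1 \<le> b + 2 * a" for a b
    proof (cases "a \<le> k")
      case True
      have "(k - a) * 2 + 1 \<le> b" using that True by linarith
      then have "X \<theta> (pn \<theta>) ^ b = X \<theta> (pn \<theta>) ^ (b - ((k - a) * 2 + 1)) * X \<theta> (pn \<theta>) ^ ((k - a) * 2 + 1)"
        by (simp only: power_add[symmetric] le_add_diff_inverse2)
      moreover have "X \<theta> (pn \<theta>) ^ ((k - a) * 2 + 1) * X \<theta> (pn \<theta> + 1) ^ a \<in> A"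
        using b2[OF True] unfolding 3 tn(3,4) by simp
      ultimately show ?thesis by (simp only: mult.assoc mult_mem)
    next
      case False
      then show ?thesis using power_mem_mono[OF top, of a] p2 by (intro mult_mem) simp
    qed
    then show ?thesis
      unfolding 3 root_rel_iff[OF highest_pos] sum using mem top by blast
  qed
qed

text \<open>Only \<open>i = 0\<close> of the third family comes from the root itself.  For a simple root \<open>\<alpha>\<^sub>j\<close> with
  \<open>d = \<langle>\<theta>, \<alpha>\<^sub>j\<^sup>\<or>\<rangle>\<close> the root vector of \<open>\<gamma> = \<theta> - d \<alpha>\<^sub>j\<close>, taken with one more \<open>t\<close>, converts \<open>d\<close>
  factors \<open>x\<^sup>-\<^sub>j\<close> into one factor \<open>x\<^sup>-\<^sub>\<theta>\<close>.\<close>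

lemma simple_exchange:
  assumes b1: "\<And>\<alpha>. \<alpha> \<in> pos_roots G \<Longrightarrow> X \<alpha> (pn \<alpha> + tn \<alpha>) \<in> A"
    and j: "j \<in> {1..rank G}" and ne: "sroot G j \<noteq> \<theta>"
    and n: "dn (sroot G j) * tn (sroot G j) \<le> n"
    and mem: "X (sroot G j) (pn (sroot G j)) ^ n * X \<theta> (pn \<theta> + 1) ^ i \<in> A"
  shows "X (sroot G j) (pn (sroot G j)) ^ (n - dn (sroot G j) * tn (sroot G j)) * X \<theta> (pn \<theta> + 1) ^ Suc i \<in> A"
proof -
  let ?a = "sroot G j"
  note a = simple_pos[OF j]
  define d where "d = dn ?a * tn ?a"
  define \<gamma> where "\<gamma> = refl ?a \<theta>"
  define y where "y = X ?a (pn ?a)"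
  define Z where "Z = X \<theta> (pn \<theta> + 1)"
  have \<gamma>: "\<gamma> \<in> pos_roots G"
    unfolding \<gamma>_def using refl_simple_pos[OF highest_pos j] ne by auto
  have td: "\<theta> (coroot G ?a) = of_nat d" unfolding d_def by (rule theta_coroot[OF a])
  have \<gamma>d: "\<gamma> = \<theta> - (\<lambda>y. of_nat d * ?a y)" by (simp add: \<gamma>_def refl_def td)
  have gd: "(- \<gamma>) (coroot G ?a) = of_nat d"
    unfolding \<gamma>_def using refl_coroot[OF simple_root[OF j], of \<theta>] td by simp
  \<comment> \<open>\<open>u q\<close> has weight \<open>- \<delta> q\<close>; as \<open>\<gamma>\<close> is the reflection of \<open>\<theta>\<close>, \<open>u d\<close> spans the root space of \<open>- \<theta>\<close>.\<close>
  define u where "u q = (brk G (xminus G ?a) ^^ q) (xminus G \<gamma>)" for q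
  define \<delta> where "\<delta> q = \<gamma> + (\<lambda>y. of_nat q * ?a y)" for q
  have u_space: "u q \<in> root_space G (- \<delta> q)" for q
  proof -
    have "- \<gamma> + (\<lambda>H. of_nat q * (- ?a) H) = - \<delta> q" by (simp add: \<delta>_def fun_eq_iff)
    then show ?thesis
      using ad_pow_space[OF root_vectors(3)[OF a] root_vectors(3)[OF \<gamma>], of q] unfolding u_def by metis
  qed
  have \<delta>_hstar: "\<delta> q \<in> hstar G" for q
    unfolding \<delta>_def by (intro hstar_add hstar_scale pos_root_hstar \<gamma> a)
  have \<delta>_height: "height (\<delta> q) = height \<gamma> + real q" for q
    unfolding \<delta>_def by (simp only: height_simps) (simp add: height_def height_elt(2)[OF j])
  have \<delta>_pos: "\<delta> q \<in> pos_roots G" if "u q \<noteq> 0" for q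
  proof -
    have h: "height (\<delta> q) > 0" using \<delta>_height height_pos[OF \<gamma>] by simp
    then have "- \<delta> q \<noteq> 0" by (metis height_simps(3,4) less_irrefl neg_equal_0_iff_equal)
    then have "- \<delta> q \<in> roots G"
      using rootI[OF hstar_uminus[OF \<delta>_hstar] _ u_space that] by blast
    then have "\<delta> q \<in> roots G" using uminus_root by fastforce
    then show ?thesis using pos_iff_height h by blast
  qed
  have \<delta>_d: "\<delta> d = \<theta>" by (simp add: \<delta>_def \<gamma>d)
  define z where "z q = Tm (u q) (pn \<gamma> + q * pn ?a + 1)" for q
  have z_X: "\<exists>c. z q = sc c * X (\<delta> q) (pn (\<delta> q) + 1) \<and> (u q \<noteq> 0 \<longrightarrow> c \<noteq> 0)" if nz: "u q \<noteq> 0" for q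
  proof -
    obtain c where c: "u q = scl G c (xminus G (\<delta> q))"
      using root_space_one_dim(2)[OF \<delta>_pos[OF nz] u_space] by blast
    moreover have "pn (\<delta> q) = pn \<gamma> + q * pn ?a"
      using pn_multiple[OF \<gamma> a \<delta>_pos[OF nz]] by (simp add: \<delta>_def)
    ultimately show ?thesis using nz by (intro exI[of _ c]) (auto simp: z_def Tm_scl)
  qed
  have theta_commute: "brk G (u q) (xminus G \<theta>) = 0" for q
  proof (cases "u q = 0")
    case False
    then show ?thesis
    proof -
      have "nconst (\<delta> q) \<theta> = 0"
        using highest_add_not_root(2)[OF \<delta>_pos[OF False]] pos_rootD by (auto simp: nconst_def)
      then have "brk G (xminus G (\<delta> q)) (xminus G \<theta>) = 0"
        using brk_xminus[OF \<delta>_pos[OF False] highest_pos] by simp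
      moreover obtain c where "u q = scl G c (xminus G (\<delta> q))"
        using root_space_one_dim(2)[OF \<delta>_pos[OF False] u_space] by blast
      ultimately show ?thesis by (simp add: brk_scl_left)
    qed
  qed simp
  have z_Z: "z q * Z = Z * z q" for q
    using Tm_brk'[of "u q" "pn \<gamma> + q * pn ?a + 1" "xminus G \<theta>" "pn \<theta> + 1"] theta_commute
    by (simp add: z_def Z_def Tm_zero)
  have z_mem: "z q * Z ^ i \<in> A" if q: "q < d" for q
  proof (cases "u q = 0")
    case True
    then show ?thesis by (simp add: z_def Tm_zero zero_mem)
  next
    case False
    have "\<delta> q \<noteq> \<theta>"
    proof
      assume "\<delta> q = \<theta>"
      then have "height (\<delta> q) = height (\<delta> d)" using \<delta>_d by simp
      then show False using \<delta>_height q by simp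
    qed
    then have "tn (\<delta> q) \<le> 1" using tn(2)[OF \<delta>_pos[OF False]] by auto
    then have "X (\<delta> q) (pn (\<delta> q) + 1) \<in> A"
      using X_mem_mono[OF \<delta>_pos[OF False] b1[OF \<delta>_pos[OF False]]] by simp
    then have "z q \<in> A" using z_X[OF False] mult_mem by auto
    moreover have "z q * Z ^ i = Z ^ i * z q"
      by (rule power_commuting_commutes[OF z_Z[symmetric], symmetric])
    ultimately show ?thesis by (simp add: mult_mem)
  qed
  have z_y: "z q * y = y * z q - z (Suc q)" for q
  proof -
    have "pn ?a + (pn \<gamma> + q * pn ?a + 1) = pn \<gamma> + Suc q * pn ?a + 1" by simp
    then have "y * z q = z q * y + z (Suc q)"
      using Tm_brk'[of "xminus G ?a" "pn ?a" "u q" "pn \<gamma> + q * pn ?a + 1"] by (simp add: y_def z_def u_def add_ac)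
    then show ?thesis by simp
  qed
  have z_top: "z (Suc d) = 0"
  proof -
    have "u (Suc d) = 0"
    proof (rule ccontr)
      assume nz: "u (Suc d) \<noteq> 0"
      have "\<delta> (Suc d) = \<theta> + ?a"
        using \<delta>_d by (simp add: \<delta>_def fun_eq_iff algebra_simps)
      then show False using \<delta>_pos[OF nz] highest_add_not_root(1)[OF a] pos_rootD by simp
    qed
    then show ?thesis by (simp add: z_def Tm_zero)
  qed
  \<comment> \<open>Moving \<open>z q\<close> to the right through \<open>y ^ n\<close> produces multiples of \<open>z q, z (q + 1), \<dots>, z d\<close>; all but the
    last annihilate \<open>Z ^ i\<close> applied to the vector.\<close>
  have z_power: "z q * y ^ n * Z ^ i - (- 1) ^ (d - q) * of_nat (n choose (d - q)) * (y ^ (n - (d - q)) * z d * Z ^ i) \<in> A"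
    if "q \<le> d" for q n
    using that
  proof (induction n arbitrary: q)
    case 0
    show ?case
    proof (cases "q = d")
      case False
      then obtain e where "d - q = Suc e" using 0 by (cases "d - q") auto
      then show ?thesis using z_mem[of q] 0 False by simp
    qed (simp add: zero_mem)
  next
    case (Suc n)
    have zy: "z q * y ^ Suc n * Z ^ i = y * (z q * y ^ n * Z ^ i) - z (Suc q) * y ^ n * Z ^ i"
      by (simp add: mult.assoc[symmetric] z_y left_diff_distrib)
    show ?case
    proof (cases "q = d")
      case True
      have "z d * y ^ n' = y ^ n' * z d" for n'
        using power_commuting_commutes[of y "z d" n'] z_y[of d] z_top by simp
      then show ?thesis using True by (simp add: zero_mem del: power_Suc)
    next
      case False
      define e where "e = d - Suc q"
      have e: "d - q = Suc e" "d - Suc q = e" using False Suc.prems by (auto simp: e_def)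
      let ?W = "\<lambda>n. y ^ n * z d * Z ^ i"
      have 1: "y * (z q * y ^ n * Z ^ i - (- 1) ^ Suc e * of_nat (n choose Suc e) * ?W (n - Suc e)) \<in> A"
        using mult_mem[OF Suc.IH[OF Suc.prems], of y] unfolding e by simp
      have 2: "z (Suc q) * y ^ n * Z ^ i - (- 1) ^ e * of_nat (n choose e) * ?W (n - e) \<in> A"
        using Suc.IH[of "Suc q"] False Suc.prems unfolding e by simp
      have yW: "y * (of_int w * ?W n') = of_int w * ?W (Suc n')" for w n'
      proof -
        have "y * (of_int w * a) = of_int w * (y * a)" for a
          by (metis mult.assoc mult_of_int_commute)
        then show ?thesis by (simp add: mult.assoc)
      qed
      have c: "(- 1) ^ p * of_nat (n choose e') = (of_int ((- 1) ^ p * int (n choose e')) :: 'r)" for p n e'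
        by simp
      have w1: "y * ((- 1) ^ Suc e * of_nat (n choose Suc e) * ?W (n - Suc e)) = (- 1) ^ Suc e * of_nat (n choose Suc e) * ?W (n - e)"
      proof (cases "n \<ge> Suc e")
        case True
        then have "Suc (n - Suc e) = n - e" by simp
        then show ?thesis unfolding c yW by simp
      qed (simp add: binomial_eq_0)
      have "z q * y ^ Suc n * Z ^ i - (- 1) ^ Suc e * of_nat (Suc n choose Suc e) * ?W (n - e) =
        y * (z q * y ^ n * Z ^ i - (- 1) ^ Suc e * of_nat (n choose Suc e) * ?W (n - Suc e))
        - (z (Suc q) * y ^ n * Z ^ i - (- 1) ^ e * of_nat (n choose e) * ?W (n - e))"
        unfolding zy right_diff_distrib[of y] w1 by (simp add: algebra_simps)
      then show ?thesis using diff_mem[OF 1 2] unfolding e by simp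
    qed
  qed
  have nz: "u d \<noteq> 0"
    unfolding u_def using lower_nonzero[OF a root_vectors(3)[OF \<gamma>] root_vectors(4)[OF \<gamma>] gd] by simp
  obtain c where c: "z d = sc c * Z" "c \<noteq> 0"
    using z_X[OF nz] nz unfolding \<delta>_d Z_def by blast
  have "z 0 * y ^ n * Z ^ i \<in> A"
    using mult_mem[OF mem, of "z 0"] by (simp add: y_def Z_def mult.assoc)
  then have "(- 1) ^ d * of_nat (n choose d) * (y ^ (n - d) * z d * Z ^ i) \<in> A"
    using diff_mem[OF _ z_power[of 0 n]] by fastforce
  then have "(- 1) ^ d * ((- 1) ^ d * of_nat (n choose d) * (y ^ (n - d) * z d * Z ^ i)) \<in> A"
    by (rule mult_mem)
  then have "of_nat (n choose d) * (y ^ (n - d) * z d * Z ^ i) \<in> A"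
    by (cases "even d") (simp_all add: mult.assoc)
  then have "sc (of_nat (n choose d)) * (y ^ (n - d) * z d * Z ^ i) \<in> A" by (simp only: sc_of_nat)
  then have "y ^ (n - d) * z d * Z ^ i \<in> A"
    using n by (rule_tac sc_mem_cancel) (auto simp: d_def)
  moreover have "y ^ (n - d) * z d * Z ^ i = sc c * (y ^ (n - d) * Z ^ Suc i)"
  proof -
    have "y ^ (n - d) * sc c = sc c * y ^ (n - d)"
      by (rule power_commuting_commutes) (simp add: y_def Tm_sc)
    then show ?thesis by (simp add: c(1) mult.assoc[symmetric])
  qed
  ultimately have "sc c * (y ^ (n - d) * Z ^ Suc i) \<in> A" by simp
  then show ?thesis using sc_mem_cancel c(2) unfolding y_def Z_def d_def by blast
qed

text \<open>In the third family, simple roots are treated by induction on \<open>i\<close> with \<open>simple_exchange\<close>.  For the other roots, the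
  elements \<open>x\<^sup>-\<^sub>\<gamma> \<otimes> t\<^bsup>(\<lambda>|\<gamma>)\<^esup>\<close> satisfy the relations of \<open>\<nn>\<^sup>-\<close>, and the annihilator of \<open>(x\<^sup>-\<^sub>\<theta> \<otimes> t\<^bsup>(\<lambda>|\<theta>)+1\<^esup>)\<^sup>i v\<close> contains the
  powers of the simple ones that belong to the dominant weight \<open>(k - i)\<theta>\<close>.\<close>

lemma root_rel_imp_bold:
  assumes rel: "\<And>\<alpha>. \<alpha> \<in> pos_roots G \<Longrightarrow> root_rel \<alpha>"
  shows bold_rel
proof -
  have sum: "part_1 \<theta> + part_2 \<theta> = 2 * k" by (simp add: part_1_def part_2_def)
  have b1: "X \<alpha> (pn \<alpha> + tn \<alpha>) \<in> A" if \<alpha>: "\<alpha> \<in> pos_roots G" for \<alpha>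
  proof -
    note r = rel[OF \<alpha>, unfolded root_rel_iff[OF \<alpha>]]
    consider "\<alpha> \<noteq> \<theta>" "tn \<alpha> = 0" | "\<alpha> \<noteq> \<theta>" "tn \<alpha> = 1" | "\<alpha> = \<theta>" using tn(2)[OF \<alpha>] by metis
    then show ?thesis
    proof cases
      case 1
      then have "part_1 \<alpha> + part_2 \<alpha> + 1 \<le> 1 + 2 * 0" by (simp add: part_1_def part_2_def)
      then have "X \<alpha> (pn \<alpha>) ^ 1 * X \<alpha> (pn \<alpha> + 1) ^ 0 \<in> A"
        using r by blast
      then show ?thesis using 1 by simp
    next
      case 2
      then show ?thesis using r by (simp add: part_2_def)
    next
      case 3
      then show ?thesis using r tn(3) by simp
    qed
  qed
  have theta_case: "X \<theta> (pn \<theta>) ^ ((k - i) * 2 + 1) * X \<theta> (pn \<theta> + 1) ^ i \<in> A" if "i \<le> k" for i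
  proof -
    have "2 * k + 1 \<le> (k - i) * 2 + 1 + 2 * i" using that by simp
    then show ?thesis using rel[OF highest_pos, unfolded root_rel_iff[OF highest_pos] sum] by blast
  qed
  have simple: "X (sroot G j) (pn (sroot G j)) ^ ((k - i) * (dn (sroot G j) * tn (sroot G j)) + 1) * X \<theta> (pn \<theta> + 1) ^ i \<in> A"
    if j: "j \<in> {1..rank G}" and i: "i \<le> k" for i j
  proof (cases "sroot G j = \<theta>")
    case True
    then show ?thesis using theta_case[OF i] tn(3,4) by simp
  next
    case False
    let ?a = "sroot G j"
    note a = simple_pos[OF j]
    consider "tn ?a = 0" | "tn ?a = 1" using tn(2)[OF a False] by metis
    then show ?thesis
    proof cases
      case 1
      have "nconst ?a \<theta> = 0"
        using highest_add_not_root(2)[OF a] pos_rootD by (auto simp: nconst_def)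
      then have "X \<theta> (pn \<theta> + 1) * X ?a (pn ?a) = X ?a (pn ?a) * X \<theta> (pn \<theta> + 1)"
        using X_brk[OF a highest_pos, of "pn ?a" "pn \<theta> + 1"] by (simp add: sc_zero)
      then have "X \<theta> (pn \<theta> + 1) ^ i * X ?a (pn ?a) = X ?a (pn ?a) * X \<theta> (pn \<theta> + 1) ^ i"
        by (rule power_commuting_commutes)
      moreover have "X \<theta> (pn \<theta> + 1) ^ i * X ?a (pn ?a) \<in> A"
        using b1[OF a] 1 by (simp add: mult_mem)
      ultimately show ?thesis using 1 by simp
    next
      case 2
      show ?thesis using i
      proof (induction i)
        case 0
        have "part_1 ?a + part_2 ?a + 1 \<le> dn ?a * k + 1 + 2 * 0"
          using 2 False by (simp add: part_1_def part_2_def)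
        then have "X ?a (pn ?a) ^ (dn ?a * k + 1) * X ?a (pn ?a + 1) ^ 0 \<in> A"
          using rel[OF a, unfolded root_rel_iff[OF a]] by blast
        then show ?case using 2 by (simp add: mult.commute)
      next
        case (Suc i)
        let ?d = "dn ?a * tn ?a"
        have ki: "k - i = Suc (k - Suc i)" using Suc.prems by simp
        have "X ?a (pn ?a) ^ ((k - i) * ?d + 1) * X \<theta> (pn \<theta> + 1) ^ i \<in> A" using Suc by simp
        from simple_exchange[OF b1 j False _ this] have "X ?a (pn ?a) ^ ((k - i) * ?d + 1 - ?d) * X \<theta> (pn \<theta> + 1) ^ Suc i \<in> A"
          using ki by simp
        moreover have "(k - i) * ?d + 1 - ?d = (k - Suc i) * ?d + 1" using ki by simp
        ultimately show ?case by (simp only:)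
      qed
    qed
  qed
  have b2: "X \<alpha> (pn \<alpha>) ^ ((k - i) * (dn \<alpha> * tn \<alpha>) + 1) * X \<theta> (pn \<theta> + 1) ^ i \<in> A"
    if \<alpha>: "\<alpha> \<in> pos_roots G" and i: "i \<le> k" for \<alpha> i
  proof -
    interpret w: dominant_weight G "\<lambda>y. of_nat (k - i) * \<theta> y" "\<lambda>\<alpha>. (k - i) * (dn \<alpha> * tn \<alpha>)"
      by unfold_locales (use hstar_scale[OF theta_hstar] theta_coroot in auto)
    \<comment> \<open>the annihilator of the vector after \<open>i\<close> applications of \<open>X \<theta> (pn \<theta> + 1)\<close>\<close>
    let ?A = "{r. r * X \<theta> (pn \<theta> + 1) ^ i \<in> A}"
    have "X \<alpha> (pn \<alpha>) ^ Suc ((k - i) * (dn \<alpha> * tn \<alpha>)) \<in> ?A"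
    proof (rule w.power_of_root_vector_in_left_ideal[where sc = sc])
      show "left_ideal ?A"
        by unfold_locales (auto simp: zero_mem add_mem mult_mem distrib_right mult.assoc)
      show "scalars sc" by unfold_locales
      show "X \<gamma> (pn \<gamma>) * X \<delta> (pn \<delta>) - X \<delta> (pn \<delta>) * X \<gamma> (pn \<gamma>) = sc (nconst \<gamma> \<delta>) * X (\<gamma> + \<delta>) (pn (\<gamma> + \<delta>))"
        if "\<gamma> \<in> pos_roots G" "\<delta> \<in> pos_roots G" for \<gamma> \<delta>
      proof (cases "\<gamma> + \<delta> \<in> pos_roots G")
        case True
        then show ?thesis using X_brk[OF that] pn_add[OF that True] by simp
      next
        case False
        then have "nconst \<gamma> \<delta> = 0" by (simp add: nconst_def)
        then show ?thesis using X_brk[OF that, of "pn \<gamma>" "pn \<delta>"] by (simp add: sc_zero)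
      qed
      show "X (sroot G j) (pn (sroot G j)) ^ Suc ((k - i) * (dn (sroot G j) * tn (sroot G j))) \<in> ?A" if "j \<in> {1..rank G}" for j
        using simple[OF that i] by simp
    qed (use \<alpha> Tm_sc in auto)
    then show ?thesis by simp
  qed
  have top: "X \<theta> (pn \<theta> + 1) ^ (part_2 \<theta> + 1) \<in> A"
    using rel[OF highest_pos, unfolded root_rel_iff[OF highest_pos]] by blast
  show ?thesis
    unfolding bold_rel_def using b1 b2 top by (auto simp: part_2_def split: if_splits)
qed

lemma CV_rel_iff_bold_rel: "CV_rel \<longleftrightarrow> bold_rel"
  using CV_rel_iff bold_imp_root_rel root_rel_imp_bold by blast

end

section \<open>Equality of the two left ideals\<close>

lemma (in quotient_action) represents_divpow: "represents a X \<Longrightarrow> represents (divpow a n) (sop (1 / fact n) * X ^ n)"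
  unfolding divpow_def by (intro represents_mult represents_const represents_power)

lemma (in quotient_action) represents_xbold:
  assumes "divided_powers sop (\<lambda>j. op (monom (xminus G \<alpha>) j))"
  shows "represents (xbold G \<alpha> r s) (divided_powers.xb sop (\<lambda>j. op (monom (xminus G \<alpha>) j)) r s)"
proof -
  interpret d: divided_powers sop "\<lambda>j. op (monom (xminus G \<alpha>) j)" by fact
  show ?thesis
    unfolding xbold_def d.xb_def d.monomial_def d.divided_def
    by (intro represents_sum represents_prod_list represents_divpow represents_gen finite_seqs)
qed

context level_datum
begin

lemma hw_relators_lkweight:
  "hw_relators G (lkweight G l lam k) =
     {gen (monom (xplus G (sroot G i)) s) | i s. i \<in> {1..rank G}} \<union>
     {gen (monom (coroot G (sroot G i)) s) - const (if s = 0 then lkweight G l lam k (coroot G (sroot G i)) else 0) | i s. i \<in> {1..rank G}} \<union>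
     {gen (monom (xminus G (sroot G i)) 0) ^ Suc (N (sroot G i)) | i. i \<in> {1..rank G}}"
proof -
  have "cnat (lkweight G l lam k (coroot G (sroot G i))) + 1 = Suc (N (sroot G i))" if "i \<in> {1..rank G}" for i
    using lkweight_coroot[OF simple_pos[OF that]] by simp
  then show ?thesis
    unfolding hw_relators_def by (intro arg_cong2[where f = "(\<union>)"] refl Collect_cong) metis
qed

text \<open>The generator of the module presented by \<open>S\<close>, for any \<open>S\<close> whose left ideal contains the highest weight relations.\<close>

lemma relation_comparison_quotient:
  assumes "quotient_action G S \<pi>" and hw: "hw_relators G (lkweight G l lam k) \<subseteq> rel_ideal G S" and "k \<le> m"
  shows "relation_comparison G lam l m k (quotient_action.sop) (quotient_action.annihilator \<pi>) (quotient_action.op \<pi>)"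
proof -
  interpret q: quotient_action G S \<pi> by fact
  interpret c: current_representation G q.sop q.annihilator q.op by (rule q.current_representation)
  interpret r: root_operators G q.sop q.annihilator q.op by unfold_locales
  have mem: "a \<in> rel_ideal G S" if "a \<in> hw_relators G (lkweight G l lam k)" for a using hw that by blast
  show ?thesis
  proof unfold_locales
    show "r.Tm (xplus G (sroot G i)) s \<in> q.annihilator" if "i \<in> {1..rank G}" for i s
      unfolding r.Tm_def q.represents_mem[OF q.represents_gen, symmetric]
      by (rule mem) (use that in \<open>auto simp: hw_relators_lkweight\<close>)
    show "r.Tm (coroot G (sroot G i)) s \<in> q.annihilator" if "i \<in> {1..rank G}" "1 \<le> s" for i s
    proof -
      have "gen (monom (coroot G (sroot G i)) s) - const (if s = 0 then lkweight G l lam k (coroot G (sroot G i)) else 0) \<in> rel_ideal G S"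
        by (rule mem, unfold hw_relators_lkweight, rule UnI1, rule UnI2) (use that in blast)
      then have "gen (monom (coroot G (sroot G i)) s) \<in> rel_ideal G S"
        using that(2) by (simp add: const_def)
      then show ?thesis
        unfolding r.Tm_def q.represents_mem[OF q.represents_gen, symmetric] .
    qed
    show "r.X (sroot G i) 0 ^ Suc (N (sroot G i)) \<in> q.annihilator" if "i \<in> {1..rank G}" for i
      unfolding r.Tm_def q.represents_mem[OF q.represents_power[OF q.represents_gen], symmetric]
      by (rule mem) (use that in \<open>auto simp: hw_relators_lkweight\<close>)
  qed fact
qed

lemma
  assumes "quotient_action G S \<pi>" and hw: "hw_relators G (lkweight G l lam k) \<subseteq> rel_ideal G S" and mk: "k \<le> m"
  shows CV_relators_subset_iff: "CV_relators G (lkweight G l lam k) (xi_tuple G l lam m k) \<subseteq> rel_ideal G S \<longleftrightarrow>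
      relation_comparison.CV_rel G lam l m k quotient_action.sop (quotient_action.annihilator \<pi>) (quotient_action.op \<pi>)"
    and bold_relators_subset_iff: "bold_relators G l lam m k \<subseteq> rel_ideal G S \<longleftrightarrow>
      relation_comparison.bold_rel G lam m k (quotient_action.annihilator \<pi>) (quotient_action.op \<pi>)"
proof -
  interpret q: quotient_action G S \<pi> by fact
  interpret R: relation_comparison G lam l m k q.sop q.annihilator q.op
    by (rule relation_comparison_quotient[OF assms])
  have X: "q.op (monom (xminus G \<alpha>) s) = R.X \<alpha> s" for \<alpha> s by (simp add: R.Tm_def)
  have dp: "divided_powers q.sop (\<lambda>j. q.op (monom (xminus G \<alpha>) j))" for \<alpha>
    unfolding X by unfold_locales (auto simp: R.X_commute R.Tm_sc)
  have rx: "xbold G \<alpha> r s \<in> rel_ideal G S \<longleftrightarrow> divided_powers.xb q.sop (R.X \<alpha>) r s \<in> q.annihilator" for \<alpha> r s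
    using q.represents_mem[OF q.represents_xbold[OF dp]] unfolding X .
  show "CV_relators G (lkweight G l lam k) (xi_tuple G l lam m k) \<subseteq> rel_ideal G S \<longleftrightarrow> R.CV_rel"
    unfolding CV_relators_def R.CV_rel_def rx[symmetric] using hw by blast
  have rp: "gen (monom (xminus G \<alpha>) a) ^ n \<in> rel_ideal G S \<longleftrightarrow> R.X \<alpha> a ^ n \<in> q.annihilator" for \<alpha> a n
    using q.represents_mem[OF q.represents_power[OF q.represents_gen]] unfolding X[symmetric] .
  have r1: "gen (monom (xminus G \<alpha>) a) \<in> rel_ideal G S \<longleftrightarrow> R.X \<alpha> a \<in> q.annihilator" for \<alpha> a
    using rp[of \<alpha> a 1] by simp
  have rpp: "gen (monom (xminus G \<alpha>) a) ^ n * gen (monom (xminus G \<beta>) b) ^ i \<in> rel_ideal G S \<longleftrightarrow>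
      R.X \<alpha> a ^ n * R.X \<beta> b ^ i \<in> q.annihilator" for \<alpha> \<beta> a b n i
    using q.represents_mem[OF q.represents_mult[OF q.represents_power[OF q.represents_gen] q.represents_power[OF q.represents_gen]]]
    unfolding X[symmetric] .
  have e1: "cnat (wform G (\<lambda>x. lam x + \<theta> x) \<alpha>) = pn \<alpha> + tn \<alpha>" if "\<alpha> \<in> pos_roots G" for \<alpha>
  proof -
    have "wform G (\<lambda>x. lam x + \<theta> x) \<alpha> = of_nat (pn \<alpha> + tn \<alpha>)"
      using wform_add_left[OF lam_hstar theta_hstar pos_root_hstar[OF that]] pn[OF that] tn(1)[OF that]
      by (simp add: plus_fun_def)
    then show ?thesis by (simp only: cnat_of_nat)
  qed
  have e2: "cnat (of_nat (k - i) * \<theta> (coroot G \<alpha>)) = (k - i) * (dn \<alpha> * tn \<alpha>)" if "\<alpha> \<in> pos_roots G" for \<alpha> i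
    unfolding theta_coroot[OF that] of_nat_mult[symmetric] cnat_of_nat by simp
  show "bold_relators G l lam m k \<subseteq> rel_ideal G S \<longleftrightarrow> R.bold_rel"
  proof -
    have "bold_relators G l lam m k \<subseteq> rel_ideal G S \<longleftrightarrow>
      (\<forall>\<alpha>\<in>pos_roots G. gen (monom (xminus G \<alpha>) (pn \<alpha> + tn \<alpha>)) \<in> rel_ideal G S) \<and>
      (\<forall>\<alpha>\<in>pos_roots G. \<forall>i\<le>k. gen (monom (xminus G \<alpha>) (pn \<alpha>)) ^ ((k - i) * (dn \<alpha> * tn \<alpha>) + 1) * gen (monom (xminus G \<theta>) (pn \<theta> + 1)) ^ i \<in> rel_ideal G S) \<and>
      (m \<le> 2 * k \<longrightarrow> gen (monom (xminus G \<theta>) (pn \<theta> + 1)) ^ (2 * k - m + 1) \<in> rel_ideal G S) \<and>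
      (m \<ge> 2 * k \<longrightarrow> gen (monom (xminus G \<theta>) (pn \<theta> + 1)) \<in> rel_ideal G S)"
      (is "_ = ?rhs")
    proof
      assume *: "bold_relators G l lam m k \<subseteq> rel_ideal G S"
      note sub = subsetD[OF *[unfolded bold_relators_def Let_def]]
      show ?rhs
      proof (intro conjI ballI allI impI)
        fix \<alpha> assume \<alpha>: "\<alpha> \<in> pos_roots G"
        show "gen (monom (xminus G \<alpha>) (pn \<alpha> + tn \<alpha>)) \<in> rel_ideal G S"
          unfolding e1[OF \<alpha>, symmetric] by (rule sub) (use \<alpha> in blast)
        fix i assume i: "i \<le> k"
        show "gen (monom (xminus G \<alpha>) (pn \<alpha>)) ^ ((k - i) * (dn \<alpha> * tn \<alpha>) + 1) * gen (monom (xminus G \<theta>) (pn \<theta> + 1)) ^ i \<in> rel_ideal G S"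
          unfolding e2[OF \<alpha>, symmetric] pn_def by (rule sub) (use \<alpha> i in blast)
      next
        assume "m \<le> 2 * k"
        then show "gen (monom (xminus G \<theta>) (pn \<theta> + 1)) ^ (2 * k - m + 1) \<in> rel_ideal G S"
          unfolding pn_def by (intro sub) simp
      next
        assume "2 * k \<le> m"
        then show "gen (monom (xminus G \<theta>) (pn \<theta> + 1)) \<in> rel_ideal G S"
          unfolding pn_def by (intro sub) simp
      qed
    next
      assume rhs: ?rhs
      show "bold_relators G l lam m k \<subseteq> rel_ideal G S"
        unfolding bold_relators_def Let_def
      proof (intro Un_least)
        show "hw_relators G (lkweight G l lam k) \<subseteq> rel_ideal G S" by (rule hw)
        show "{gen (monom (xminus G \<alpha>) (cnat (wform G (\<lambda>x. lam x + \<theta> x) \<alpha>))) |\<alpha>. \<alpha> \<in> pos_roots G} \<subseteq> rel_ideal G S"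
          using rhs e1 by auto
        show "{gen (monom (xminus G \<alpha>) (cnat (wform G lam \<alpha>))) ^ (cnat (of_nat (k - i) * \<theta> (coroot G \<alpha>)) + 1) *
             gen (monom (xminus G \<theta>) (cnat (wform G lam \<theta>) + 1)) ^ i |\<alpha> i. \<alpha> \<in> pos_roots G \<and> i \<le> k} \<subseteq> rel_ideal G S"
        proof clarify
          fix \<alpha> i assume "\<alpha> \<in> pos_roots G" "i \<le> k"
          then show "gen (monom (xminus G \<alpha>) (cnat (wform G lam \<alpha>))) ^ (cnat (of_nat (k - i) * \<theta> (coroot G \<alpha>)) + 1) *
             gen (monom (xminus G \<theta>) (cnat (wform G lam \<theta>) + 1)) ^ i \<in> rel_ideal G S"
            unfolding e2[OF \<open>\<alpha> \<in> pos_roots G\<close>] pn_def[symmetric] using rhs by blast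
        qed
      qed (use rhs in \<open>auto simp: pn_def\<close>)
    qed
    then show ?thesis unfolding rp r1 rpp R.bold_rel_def .
  qed
qed

text \<open>The comparison in the module presented by either set of relations shows that the other set holds there.\<close>

lemma rel_ideal_CV_eq_bold:
  assumes mk: "k \<le> m"
  shows "rel_ideal G (CV_relators G (lkweight G l lam k) (xi_tuple G l lam m k)) = rel_ideal G (bold_relators G l lam m k)"
    (is "rel_ideal G ?CV = rel_ideal G ?bold")
proof
  have hw: "hw_relators G (lkweight G l lam k) \<subseteq> ?CV" "hw_relators G (lkweight G l lam k) \<subseteq> ?bold"
    by (auto simp: CV_relators_def bold_relators_def Let_def)
  have self: "S \<subseteq> rel_ideal G S" for S by (auto intro: rel_ideal.rel)
  have iff: "?CV \<subseteq> rel_ideal G S \<longleftrightarrow> ?bold \<subseteq> rel_ideal G S"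
    if "hw_relators G (lkweight G l lam k) \<subseteq> S" for S
  proof -
    obtain \<pi> where q: "quotient_action G S \<pi>" using exists_quotient_action by blast
    have h: "hw_relators G (lkweight G l lam k) \<subseteq> rel_ideal G S" using that self by blast
    show ?thesis
      unfolding CV_relators_subset_iff[OF q h mk] bold_relators_subset_iff[OF q h mk]
      by (rule relation_comparison.CV_rel_iff_bold_rel[OF relation_comparison_quotient[OF q h mk]])
  qed
  show "rel_ideal G ?CV \<subseteq> rel_ideal G ?bold"
    using iff[OF hw(2)] self by (intro rel_ideal_subset) blast
  show "rel_ideal G ?bold \<subseteq> rel_ideal G ?CV"
    using iff[OF hw(1)] self by (intro rel_ideal_subset) blast
qed

end

theorem theorem5p1:
  fixes G :: "'g::ab_group_add lie_datum"
    and k l m :: nat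
    and lam :: "'g \<Rightarrow> complex"
  assumes "simple_lie_datum G"
    and "k \<ge> 1" and "l \<ge> 1" and "m \<ge> 1"
    and "l \<ge> m" and "m \<ge> k"
    and "lam \<in> Lplus G"
  shows "cur_module_isomorphic
           (CV_module G (lkweight G l lam k) (xi_tuple G l lam m k))
           (bold_V G l lam m k)"
proof -
  interpret level_datum G lam l m k
    by unfold_locales (use assms in auto)
  show ?thesis
    unfolding CV_module_def bold_V_def
    by (rule cyclic_module_isomorphic[OF rel_ideal_CV_eq_bold[OF assms(6)]])
qed

end
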